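(* Every $4$-edge-connected, essentially $41$-edge-connected graph admits a nowhere-zero $3$-flow.
   Context: Graphs are finite and loopless, but may contain parallel edges. An edge-cut of a graph is an inclusion-minimal set of edges whose removal increases the number of connected components (i.e. a bond). A component is nontrivial if it contains an edge. An edge-cut $F$ of a connected graph $G$ is essential if $G-F$ has at least two nontrivial components. A connected graph $G$ is essentially $t$-edge-connected if it has no essential edge-cut with fewer than $t$ edges; equivalently, deleting any set of at most $t-1$ edges leaves at most one nontrivial component. For an integer $k\ge 2$, a nowhere-zero $k$-flow of $G$ is a pair $(D,f)$ where $D$ is an orientation of $G$ and $f:E(G)\to\{1,2,\ldots,k-1\}$ satisfies $\sum_{e\in E_D^+(v)}f(e)=\sum_{e\in E_D^-(v)}f(e)$ for every $v\in V(G)$, where $E_D^+(v)$ and $E_D^-(v)$ are the sets of edges directed away from and toward $v$ in $D$, respectively. *)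

theory Defs
  imports "Graph_Theory.Digraph"
begin

record ('v, 'e) multigraph =
  mverts :: "'v set"
  medges :: "'e set"
  ends :: "'e \<Rightarrow> 'v set"

(* Parallel edges are distinct elements of medges with the same set of ends;
   an edge with two ends is not a loop. *)
locale finite_multigraph =
  fixes G :: "('v, 'e) multigraph" (structure)
  assumes finite_verts: "finite (mverts G)"
    and finite_edges: "finite (medges G)"
    and ends_in_verts: "e \<in> medges G \<Longrightarrow> ends G e \<subseteq> mverts G"
    and loopless: "e \<in> medges G \<Longrightarrow> card (ends G e) = 2"

definition adjacency :: "('v, 'e) multigraph \<Rightarrow> ('v \<times> 'v) set" where
  "adjacency G = {(u, v). \<exists>e \<in> medges G. ends G e = {u, v}}"

(* A connected component is represented by its vertex set. *)
definition components :: "('v, 'e) multigraph \<Rightarrow> 'v set set" where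
  "components G = (\<lambda>v. (adjacency G)\<^sup>* `` {v}) ` mverts G"

(* The graph without vertices has no component and is not connected. *)
definition connected_multigraph :: "('v, 'e) multigraph \<Rightarrow> bool" where
  "connected_multigraph G \<longleftrightarrow> card (components G) = 1"

definition delete_edges :: "('v, 'e) multigraph \<Rightarrow> 'e set \<Rightarrow> ('v, 'e) multigraph" where
  "delete_edges G F = G\<lparr>medges := medges G - F\<rparr>"

definition separating :: "('v, 'e) multigraph \<Rightarrow> 'e set \<Rightarrow> bool" where
  "separating G F \<longleftrightarrow>
     F \<subseteq> medges G \<and> card (components (delete_edges G F)) > card (components G)"

definition edge_cut :: "('v, 'e) multigraph \<Rightarrow> 'e set \<Rightarrow> bool" where
  "edge_cut G F \<longleftrightarrow> separating G F \<and> (\<forall>F'. F' \<subset> F \<longrightarrow> \<not> separating G F')"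

definition nontrivial_components :: "('v, 'e) multigraph \<Rightarrow> 'v set set" where
  "nontrivial_components G = {C \<in> components G. \<exists>e \<in> medges G. ends G e \<subseteq> C}"

definition essential_edge_cut :: "('v, 'e) multigraph \<Rightarrow> 'e set \<Rightarrow> bool" where
  "essential_edge_cut G F \<longleftrightarrow>
     edge_cut G F \<and> card (nontrivial_components (delete_edges G F)) \<ge> 2"

(* The one-vertex graph is k-edge-connected for every k. *)
definition k_edge_connected :: "nat \<Rightarrow> ('v, 'e) multigraph \<Rightarrow> bool" where
  "k_edge_connected k G \<longleftrightarrow>
     connected_multigraph G \<and>
     (\<forall>F \<subseteq> medges G. card F < k \<longrightarrow> connected_multigraph (delete_edges G F))"

definition essentially_edge_connected :: "nat \<Rightarrow> ('v, 'e) multigraph \<Rightarrow> bool" where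
  "essentially_edge_connected t G \<longleftrightarrow>
     connected_multigraph G \<and> \<not> (\<exists>F. essential_edge_cut G F \<and> card F < t)"

definition orientation_of :: "('v, 'e) multigraph \<Rightarrow> ('v, 'e) pre_digraph \<Rightarrow> bool" where
  "orientation_of G D \<longleftrightarrow>
     verts D = mverts G \<and> arcs D = medges G \<and>
     (\<forall>e \<in> medges G. {tail D e, head D e} = ends G e)"

definition nowhere_zero_flow ::
    "nat \<Rightarrow> ('v, 'e) multigraph \<Rightarrow> ('v, 'e) pre_digraph \<Rightarrow> ('e \<Rightarrow> nat) \<Rightarrow> bool" where
  "nowhere_zero_flow k G D f \<longleftrightarrow>
     orientation_of G D \<and>
     (\<forall>e \<in> medges G. f e \<in> {1..k - 1}) \<and>
     (\<forall>v \<in> mverts G. (\<Sum>e \<in> out_arcs D v. f e) = (\<Sum>e \<in> in_arcs D v. f e))"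

end

theory Submission
  imports Defs "HOL-Library.Nat_Bijection"
begin

text \<open>
A nowhere-zero 3-flow amounts to an orientation in which the net out-degree of every vertex is
divisible by 3: such an orientation is a flow modulo 3 with all values 1, and augmenting along residual
edges, which changes values 1 to -2, makes it an integral one (\<open>integral_flow_of_mod3\<close>).
The proof finds, more generally, an orientation whose net out-degrees have arbitrary prescribed residues \<open>\<gamma>\<close> with sum 0 modulo 3. This
generality is what makes induction possible: if a vertex set \<open>B\<close> is contracted and the quotient has
been oriented, what remains to be done inside \<open>B\<close> is a problem of the same kind.

The engine is the theorem of Lovasz, Thomassen, Wu and Zhang that all residues can be prescribed in a
graph all of whose cuts have at least 6 edges (\<open>orientable_of_six_edge_connected\<close>). It is proved in a
rooted form, with one vertex whose edges are already directed, because a tight cut splits the problem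
into two: contract one side, orient, and let the oriented cut edges be the edges at the root of the
other side. In a minimal counterexample every tight set is therefore a single vertex, which leaves
enough room to lift and delete edges until only a very rigid configuration is left.

Here the cuts around vertices of degree 4 and 5 are too small for that theorem. Essential
connectivity separates these low vertices from each other: all their neighbours have degree at least
38. A low vertex \<open>v\<close> is suppressed: two of its edges \<open>va\<close>, \<open>vb\<close> become one edge \<open>ab\<close>, and the
remaining edges, at least two of them, are directed so that \<open>v\<close> has its residue
(\<open>suppress_star\<close>). The pair \<open>a\<close>, \<open>b\<close> must be chosen so that the graph stays well connected. The right
measure is partition-connectedness: at least \<open>4(k - 1)\<close> edges cross every partition into \<open>k\<close> classes, where
the neighbourhood of a low vertex counts as one hyperedge. Uncrossing in the lattice of partitions
shows that a hyperedge can be trimmed to a pair of its vertices (\<open>trim_to_pair\<close>), and a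
charging argument derives partition-connectedness from the hypothesis on essential cuts
(\<open>colouring_bound\<close>).

A partition-connected graph without hyperedges that has a cut with at most 5 edges either has a
vertex of degree 4 or 5, which is suppressed in the same way, or it has a proper subset that is dense
enough to be partition-connected itself and can be contracted. Otherwise the theorem about 6-edge cuts
applies (\<open>orientable_of_partition_connected\<close>).

The charging argument breaks down for one family of graphs, those with two adjacent vertices that
together meet every edge. They have so many parallel edges that contracting these suffices
(\<open>orientable_two_hubs\<close>).
\<close>

section \<open>Orientations with prescribed residues\<close>

definition joins :: "('e \<Rightarrow> 'v) \<Rightarrow> ('e \<Rightarrow> 'v) \<Rightarrow> 'e \<Rightarrow> 'v \<Rightarrow> 'v \<Rightarrow> bool" where
  "joins s t e x y \<longleftrightarrow> (s e = x \<and> t e = y) \<or> (s e = y \<and> t e = x)"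

definition net :: "'e set \<Rightarrow> ('e \<Rightarrow> 'v) \<Rightarrow> ('e \<Rightarrow> 'v) \<Rightarrow> ('e \<Rightarrow> int) \<Rightarrow> 'v \<Rightarrow> int" where
  "net E s t \<sigma> x = (\<Sum>e\<in>E. \<sigma> e * (of_bool (s e = x) - of_bool (t e = x)))"

text \<open>
The edges carry a reference direction from \<open>s\<close> to \<open>t\<close>, and \<open>\<sigma> e = -1\<close> reverses it. Loops are
admitted, because contraction creates them; they contribute 0 to every net out-degree.
\<close>

definition orientable_mod3 ::
    "'v set \<Rightarrow> 'e set \<Rightarrow> ('e \<Rightarrow> 'v) \<Rightarrow> ('e \<Rightarrow> 'v) \<Rightarrow> ('v \<Rightarrow> int) \<Rightarrow> bool" where
  "orientable_mod3 V E s t \<gamma> \<longleftrightarrow>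
     (\<exists>\<sigma>. (\<forall>e. \<sigma> e \<in> {1, -1}) \<and> (\<forall>x\<in>V. 3 dvd net E s t \<sigma> x - \<gamma> x))"

lemma orientable_mod3E:
  assumes "orientable_mod3 V E s t \<gamma>"
  obtains \<sigma> where "\<forall>e. \<sigma> e \<in> {1, -1}" "\<forall>x\<in>V. 3 dvd net E s t \<sigma> x - \<gamma> x"
  using assms unfolding orientable_mod3_def by blast

lemma orientable_mod3I:
  assumes "\<And>e. \<sigma> e \<in> {1, -1}" "\<And>x. x \<in> V \<Longrightarrow> 3 dvd net E s t \<sigma> x - \<gamma> x"
  shows "orientable_mod3 V E s t \<gamma>"
  using assms unfolding orientable_mod3_def by blast

definition cut :: "'e set \<Rightarrow> ('e \<Rightarrow> 'v) \<Rightarrow> ('e \<Rightarrow> 'v) \<Rightarrow> 'v set \<Rightarrow> int" where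
  "cut E s t A = (\<Sum>e\<in>E. of_bool ((s e \<in> A) \<noteq> (t e \<in> A)))"

lemma cut_eq_card: "finite E \<Longrightarrow> cut E s t A = int (card {e \<in> E. (s e \<in> A) \<noteq> (t e \<in> A)})"
  unfolding cut_def by (simp add: of_bool_def sum.If_cases Int_def)

lemma sum_net:
  assumes "finite A" "finite E"
  shows "(\<Sum>x\<in>A. net E s t \<sigma> x) = (\<Sum>e\<in>E. \<sigma> e * (of_bool (s e \<in> A) - of_bool (t e \<in> A)))"
proof -
  have ob: "(\<Sum>x\<in>A. of_bool (y = x)) = (of_bool (y \<in> A) :: int)" for y
    using assms(1) by (simp add: of_bool_def)
  have "(\<Sum>x\<in>A. net E s t \<sigma> x)
      = (\<Sum>e\<in>E. \<Sum>x\<in>A. \<sigma> e * (of_bool (s e = x) - of_bool (t e = x)))"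
    unfolding net_def by (rule sum.swap)
  also have "\<dots> = (\<Sum>e\<in>E. \<sigma> e * (of_bool (s e \<in> A) - of_bool (t e \<in> A)))"
    by (simp add: sum_distrib_left[symmetric] sum_subtractf ob)
  finally show ?thesis .
qed

lemma sum_net_zero:
  assumes "finite V" "finite E" "\<forall>e\<in>E. s e \<in> V \<and> t e \<in> V"
  shows "(\<Sum>x\<in>V. net E s t \<sigma> x) = 0"
  using assms by (simp add: sum_net)

lemma net_split:
  assumes "finite E" "F \<subseteq> E"
  shows "net E s t \<sigma> x = net F s t \<sigma> x + net (E - F) s t \<sigma> x"
  unfolding net_def using sum.subset_diff[OF assms(2,1)] by (simp add: add.commute)

lemma net_cong:
  assumes "\<And>e. e \<in> E \<Longrightarrow> s e = x \<or> t e = x \<Longrightarrow> \<sigma> e = \<sigma>' e"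
  shows "net E s t \<sigma> x = net E s t \<sigma>' x"
  unfolding net_def using assms by (intro sum.cong) auto

text \<open>
The net out-degrees sum to 0, so the residue at the last vertex comes for free.
\<close>

lemma orientable_extend_vertex:
  assumes fin: "finite V" "finite E" and ends: "\<forall>e\<in>E. s e \<in> V \<and> t e \<in> V"
    and "x \<in> V" and zero: "3 dvd (\<Sum>y\<in>V. \<gamma> y)"
    and "orientable_mod3 (V - {x}) E s t \<gamma>"
  shows "orientable_mod3 V E s t \<gamma>"
proof -
  obtain \<sigma> where s: "\<forall>e. \<sigma> e \<in> {1,-1}" "\<forall>y\<in>V-{x}. 3 dvd net E s t \<sigma> y - \<gamma> y"
    using assms(6) unfolding orientable_mod3_def by blast
  have "(\<Sum>y\<in>V. net E s t \<sigma> y - \<gamma> y) = - (\<Sum>y\<in>V. \<gamma> y)"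
    using sum_net_zero[OF fin ends] by (simp add: sum_subtractf)
  moreover have "(\<Sum>y\<in>V. net E s t \<sigma> y - \<gamma> y)
      = (net E s t \<sigma> x - \<gamma> x) + (\<Sum>y\<in>V-{x}. net E s t \<sigma> y - \<gamma> y)"
    using fin(1) \<open>x \<in> V\<close> by (rule sum.remove)
  moreover have "3 dvd (\<Sum>y\<in>V-{x}. net E s t \<sigma> y - \<gamma> y)"
    using s(2) by (intro dvd_sum) auto
  ultimately have "3 dvd net E s t \<sigma> x - \<gamma> x" using zero by presburger
  with s have "\<forall>y\<in>V. 3 dvd net E s t \<sigma> y - \<gamma> y" by auto
  with s(1) show ?thesis unfolding orientable_mod3_def by blast
qed

text \<open>
Two signs alone already realise the sums 2, 0 and -2, that is, all residues modulo 3.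
\<close>

lemma signs_attain_residue:
  fixes w :: "'e \<Rightarrow> int" and r :: int
  assumes "finite F" "card F \<ge> 2" and w: "\<And>e. e \<in> F \<Longrightarrow> w e \<in> {1, -1}"
  obtains \<sigma> where "\<forall>e. \<sigma> e \<in> {1, -1}" "3 dvd (\<Sum>e\<in>F. \<sigma> e * w e) - r"
proof -
  obtain a b where ab: "a \<in> F" "b \<in> F" "a \<noteq> b"
    using assms(1,2) by (metis card_le_Suc0_iff_eq not_less_eq_eq numeral_2_eq_2)
  define K where "K = (\<Sum>e\<in>F-{a,b}. w e)"
  have "\<exists>i\<in>{1,-1}. \<exists>j\<in>{1,-1}. 3 dvd K + i + j - r"
    by (simp; presburger)
  then obtain i j :: int where ij: "i \<in> {1,-1}" "j \<in> {1,-1}" "3 dvd K + i + j - r" by blast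
  define \<sigma> where "\<sigma> e = (if e = a then i * w a else if e = b then j * w b else 1)" for e
  have wab: "w a \<in> {1,-1}" "w b \<in> {1,-1}" using w ab by auto
  have "(\<Sum>e\<in>F. \<sigma> e * w e) = (\<Sum>e\<in>F-{a,b}. \<sigma> e * w e) + (\<Sum>e\<in>{a,b}. \<sigma> e * w e)"
    using ab assms(1) by (intro sum.subset_diff) auto
  also have "(\<Sum>e\<in>F-{a,b}. \<sigma> e * w e) = K"
    unfolding K_def by (intro sum.cong) (auto simp: \<sigma>_def)
  also have "(\<Sum>e\<in>{a,b}. \<sigma> e * w e) = i + j"
    using ab wab by (auto simp: \<sigma>_def)
  finally have "3 dvd (\<Sum>e\<in>F. \<sigma> e * w e) - r" using ij(3) by (simp add: algebra_simps)
  moreover have "\<forall>e. \<sigma> e \<in> {1,-1}" using ij wab by (auto simp: \<sigma>_def)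
  ultimately show ?thesis using that by blast
qed

text \<open>
Every vertex \<open>w\<close> corrects its own residue with its edges to \<open>u\<close>; these edge sets are disjoint, and \<open>u\<close>
is right because the total is. This covers bundles of parallel edges as well.
\<close>

lemma orientable_star:
  assumes fin: "finite V" "finite E" and ends: "\<forall>e\<in>E. s e \<in> V \<and> t e \<in> V"
    and "u \<in> V" and zero: "3 dvd (\<Sum>y\<in>V. \<gamma> y)"
    and two: "\<And>w. w \<in> V - {u} \<Longrightarrow> card {e \<in> E. joins s t e w u} \<ge> 2"
  shows "orientable_mod3 V E s t \<gamma>"
proof -
  define F where "F w = {e \<in> E. joins s t e w u}" for w
  define inc where "inc e w = (of_bool (s e = w) - of_bool (t e = w) :: int)" for e w
  have "\<exists>\<sigma>. (\<forall>e. \<sigma> e \<in> {1, -1}) \<and>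
      3 dvd (\<Sum>e\<in>F w. \<sigma> e * inc e w) - (\<gamma> w - (\<Sum>e\<in>E - F w. inc e w))"
    if "w \<in> V - {u}" for w
  proof -
    have "\<And>e. e \<in> F w \<Longrightarrow> inc e w \<in> {1,-1}"
      using that by (auto simp: F_def joins_def inc_def)
    moreover have "finite (F w)" using fin by (simp add: F_def)
    moreover have "card (F w) \<ge> 2" using two[OF that] by (simp add: F_def)
    ultimately obtain \<sigma> where "\<forall>e. \<sigma> e \<in> {1, -1}"
      "3 dvd (\<Sum>e\<in>F w. \<sigma> e * inc e w) - (\<gamma> w - (\<Sum>e\<in>E - F w. inc e w))"
      using signs_attain_residue[of "F w" "\<lambda>e. inc e w"] by blast
    then show ?thesis by blast
  qed
  then have "\<forall>w. \<exists>\<sigma>. w \<in> V - {u} \<longrightarrow> (\<forall>e. \<sigma> e \<in> {1, -1::int}) \<and>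
      3 dvd (\<Sum>e\<in>F w. \<sigma> e * inc e w) - (\<gamma> w - (\<Sum>e\<in>E - F w. inc e w))" by blast
  from choice[OF this] obtain S where S: "\<And>w e. w \<in> V - {u} \<Longrightarrow> S w e \<in> {1,-1::int}"
    "\<And>w. w \<in> V - {u} \<Longrightarrow> 3 dvd (\<Sum>e\<in>F w. S w e * inc e w) - (\<gamma> w - (\<Sum>e\<in>E - F w. inc e w))"
    by blast
  define \<sigma> where "\<sigma> e = (if e \<in> E \<and> s e = u \<and> t e \<noteq> u then S (t e) e
      else if e \<in> E \<and> t e = u \<and> s e \<noteq> u then S (s e) e else 1)" for e
  have sg: "\<sigma> e \<in> {1,-1}" for e
  proof (cases "e \<in> E \<and> (s e = u) \<noteq> (t e = u)")
    case True
    then show ?thesis using S(1)[of "s e" e] S(1)[of "t e" e] ends unfolding \<sigma>_def by auto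
  next
    case False
    then show ?thesis unfolding \<sigma>_def by auto
  qed
  have "3 dvd net E s t \<sigma> w - \<gamma> w" if w: "w \<in> V - {u}" for w
  proof -
    have "net E s t \<sigma> w = (\<Sum>e\<in>E - F w. \<sigma> e * inc e w) + (\<Sum>e\<in>F w. \<sigma> e * inc e w)"
      unfolding net_def inc_def using fin by (intro sum.subset_diff) (auto simp: F_def)
    also have "(\<Sum>e\<in>E - F w. \<sigma> e * inc e w) = (\<Sum>e\<in>E - F w. inc e w)"
    proof (rule sum.cong[OF refl])
      fix e assume e: "e \<in> E - F w"
      have "\<sigma> e = 1" if "s e = w \<or> t e = w"
        using that e w unfolding F_def joins_def \<sigma>_def by (simp split: if_split) metis
      then show "\<sigma> e * inc e w = inc e w" by (cases "s e = w \<or> t e = w") (auto simp: inc_def)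
    qed
    also have "(\<Sum>e\<in>F w. \<sigma> e * inc e w) = (\<Sum>e\<in>F w. S w e * inc e w)"
    proof (rule sum.cong[OF refl])
      fix e assume e: "e \<in> F w"
      then have "\<sigma> e = S w e" using w unfolding F_def joins_def \<sigma>_def by auto
      then show "\<sigma> e * inc e w = S w e * inc e w" by simp
    qed
    finally show ?thesis using S(2)[OF w] by (simp add: algebra_simps)
  qed
  then have "orientable_mod3 (V - {u}) E s t \<gamma>" unfolding orientable_mod3_def using sg by blast
  then show ?thesis using orientable_extend_vertex[OF fin ends \<open>u \<in> V\<close> zero] by blast
qed

lemma inc_joins:
  assumes "joins s t e x y" "x \<noteq> y"
  shows "\<exists>k\<in>{1,-1::int}. \<forall>z. of_bool (s e = z) - of_bool (t e = z) = k * (of_bool (z = x) - of_bool (z = y))"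
proof (cases "s e = x \<and> t e = y")
  case True
  then show ?thesis by (intro bexI[of _ 1]) auto
next
  case False
  then have "s e = y \<and> t e = x" using assms(1) unfolding joins_def by blast
  then show ?thesis by (intro bexI[of _ "-1"]) auto
qed

lemma net_remove:
  assumes "finite E" "e \<in> E"
  shows "net E s t \<sigma> z = \<sigma> e * (of_bool (s e = z) - of_bool (t e = z)) + net (E - {e}) s t \<sigma> z"
  unfolding net_def using assms by (simp add: sum.remove)

text \<open>
The edge is directed from \<open>x\<close> to \<open>y\<close>, which changes what the other edges have to achieve at its ends.
\<close>

lemma orientable_delete:
  assumes "finite E" "e \<in> E" "joins s t e x y" "x \<noteq> y"
    and "orientable_mod3 V (E - {e}) s t (\<gamma>(x := \<gamma> x - 1, y := \<gamma> y + 1))"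
  shows "orientable_mod3 V E s t \<gamma>"
proof -
  obtain \<sigma> where s: "\<forall>e. \<sigma> e \<in> {1,-1}"
    "\<forall>z\<in>V. 3 dvd net (E-{e}) s t \<sigma> z - (\<gamma>(x := \<gamma> x - 1, y := \<gamma> y + 1)) z"
    using assms(5) unfolding orientable_mod3_def by blast
  obtain k :: int where k: "k \<in> {1,-1}"
    "\<And>z. of_bool (s e = z) - of_bool (t e = z) = k * (of_bool (z = x) - of_bool (z = y))"
    using inc_joins[OF assms(3,4)] by blast
  define \<tau> where "\<tau> = \<sigma>(e := k)"
  have "3 dvd net E s t \<tau> z - \<gamma> z" if "z \<in> V" for z
  proof -
    have "net (E-{e}) s t \<tau> z = net (E-{e}) s t \<sigma> z" by (rule net_cong) (auto simp: \<tau>_def)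
    then have "net E s t \<tau> z = k * (k * (of_bool (z = x) - of_bool (z = y))) + net (E-{e}) s t \<sigma> z"
      using net_remove[OF assms(1,2), of s t \<tau> z] k(2)[of z] by (simp add: \<tau>_def)
    also have "k * (k * (of_bool (z = x) - of_bool (z = y))) = of_bool (z = x) - of_bool (z = y)"
      using k(1) by auto
    finally have "net E s t \<tau> z - \<gamma> z
        = net (E-{e}) s t \<sigma> z - (\<gamma>(x := \<gamma> x - 1, y := \<gamma> y + 1)) z"
      using assms(4) by auto
    then show ?thesis using s(2) that by metis
  qed
  moreover have "\<tau> f \<in> {1,-1}" for f
  proof -
    have "\<sigma> f \<in> {1,-1}" using s(1) by blast
    then show ?thesis using k(1) by (auto simp: \<tau>_def)
  qed
  ultimately show ?thesis unfolding orientable_mod3_def by blast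
qed

text \<open>
A directed path through \<open>x\<close> takes the place of the new edge between \<open>y\<close> and \<open>z\<close>, so nothing changes at
\<open>x\<close>.
\<close>

lemma orientable_lift:
  assumes "finite E" "e \<in> E" "f \<in> E" "e \<noteq> f" "joins s t e x y" "joins s t f x z" "x \<noteq> y" "x \<noteq> z"
    and "orientable_mod3 V (E - {f}) (s(e := y)) (t(e := z)) \<gamma>"
  shows "orientable_mod3 V E s t \<gamma>"
proof -
  obtain \<sigma> where s: "\<forall>e. \<sigma> e \<in> {1,-1}"
    "\<forall>v\<in>V. 3 dvd net (E-{f}) (s(e := y)) (t(e := z)) \<sigma> v - \<gamma> v"
    using assms(9) by (rule orientable_mod3E)
  obtain k :: int where k: "k \<in> {1,-1}"
    "\<And>v. of_bool (s e = v) - of_bool (t e = v) = k * (of_bool (v = x) - of_bool (v = y))"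
    using inc_joins[OF assms(5,7)] by blast
  obtain l :: int where l: "l \<in> {1,-1}"
    "\<And>v. of_bool (s f = v) - of_bool (t f = v) = l * (of_bool (v = x) - of_bool (v = z))"
    using inc_joins[OF assms(6,8)] by blast
  define \<tau> where "\<tau> = \<sigma>(e := - \<sigma> e * k, f := \<sigma> e * l)"
  have "net E s t \<tau> v = net (E-{f}) (s(e := y)) (t(e := z)) \<sigma> v" for v
  proof -
    have "net E s t \<tau> v = \<sigma> e * l * (l * (of_bool (v = x) - of_bool (v = z)))
       + (- \<sigma> e * k * (k * (of_bool (v = x) - of_bool (v = y))) + net (E-{f}-{e}) s t \<tau> v)"
      using net_remove[OF assms(1,3), of s t \<tau> v] net_remove[of "E-{f}" e s t \<tau> v] assms(1-4)
      by (simp add: \<tau>_def k(2) l(2))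
    also have "\<dots> = \<sigma> e * (of_bool (y = v) - of_bool (z = v)) + net (E-{f}-{e}) s t \<tau> v"
      using k(1) l(1) by (auto simp: algebra_simps)
    also have "net (E-{f}-{e}) s t \<tau> v = net (E-{f}-{e}) (s(e := y)) (t(e := z)) \<sigma> v"
      unfolding net_def by (intro sum.cong) (auto simp: \<tau>_def)
    finally show ?thesis
      using net_remove[of "E-{f}" e "s(e := y)" "t(e := z)" \<sigma> v] assms(1-4) by simp
  qed
  moreover have "\<tau> v \<in> {1,-1}" for v
  proof -
    have "\<sigma> v \<in> {1,-1}" "\<sigma> e \<in> {1,-1}" using s(1) by blast+
    then show ?thesis using k(1) l(1) by (auto simp: \<tau>_def)
  qed
  ultimately show ?thesis using s(2) by (intro orientable_mod3I[of \<tau>]) auto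
qed

lemma orientable_loop:
  assumes "finite E" "e \<in> E" "s e = t e" "orientable_mod3 V (E - {e}) s t \<gamma>"
  shows "orientable_mod3 V E s t \<gamma>"
  using assms net_remove[OF assms(1,2), of s t] unfolding orientable_mod3_def by auto

lemma orientable_uminus:
  assumes "orientable_mod3 V E s t (\<lambda>x. - \<gamma> x)"
  shows "orientable_mod3 V E s t \<gamma>"
proof -
  obtain \<sigma> where s: "\<forall>e. \<sigma> e \<in> {1,-1}" "\<forall>z\<in>V. 3 dvd net E s t \<sigma> z + \<gamma> z"
    using assms unfolding orientable_mod3_def by auto
  have "net E s t (\<lambda>e. - \<sigma> e) z = - net E s t \<sigma> z" for z
    unfolding net_def by (simp add: sum_negf[symmetric])
  then have "3 dvd net E s t (\<lambda>e. - \<sigma> e) z - \<gamma> z" if "z \<in> V" for z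
    using s(2) that by (metis dvd_minus_iff minus_add_distrib uminus_add_conv_diff add.commute diff_conv_add_uminus)
  moreover have "\<forall>e. - \<sigma> e \<in> {1,-1}" using s(1) by fastforce
  ultimately show ?thesis unfolding orientable_mod3_def by (intro exI[of _ "\<lambda>e. - \<sigma> e"]) auto
qed


section \<open>Contraction\<close>

definition collapse :: "'v set \<Rightarrow> 'v \<Rightarrow> 'v \<Rightarrow> 'v" where
  "collapse B a x = (if x \<in> B then a else x)"

text \<open>
An orientation of the quotient fixes the edges outside \<open>B\<close>. What it leaves to be achieved inside \<open>B\<close>
has sum 0 modulo 3 because the vertex that represents \<open>B\<close> is satisfied. The residual prescription
depends on the orientation \<open>\<sigma>\<close> of the quotient, which therefore appears in the conclusion.
\<close>

lemma orientable_contract: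
  assumes fin: "finite V" "finite E" and B: "B \<subseteq> V" "a \<in> B"
    and con: "orientable_mod3 (insert a (V - B)) E (collapse B a \<circ> s) (collapse B a \<circ> t)
               (\<gamma>(a := \<Sum>x\<in>B. \<gamma> x))"
  obtains \<sigma> where "\<forall>e. \<sigma> e \<in> {1, -1}"
    "3 dvd (\<Sum>x\<in>B. \<gamma> x - net {e \<in> E. \<not> (s e \<in> B \<and> t e \<in> B)} s t \<sigma> x)"
    "orientable_mod3 B {e \<in> E. s e \<in> B \<and> t e \<in> B} s t
       (\<lambda>x. \<gamma> x - net {e \<in> E. \<not> (s e \<in> B \<and> t e \<in> B)} s t \<sigma> x) \<Longrightarrow> orientable_mod3 V E s t \<gamma>"
proof -
  let ?EB = "{e \<in> E. s e \<in> B \<and> t e \<in> B}"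
  let ?EO = "{e \<in> E. \<not> (s e \<in> B \<and> t e \<in> B)}"
  obtain \<sigma> where s: "\<forall>e. \<sigma> e \<in> {1,-1}"
    "\<forall>x\<in>insert a (V - B). 3 dvd net E (collapse B a \<circ> s) (collapse B a \<circ> t) \<sigma> x
        - (\<gamma>(a := \<Sum>x\<in>B. \<gamma> x)) x"
    using con unfolding orientable_mod3_def by blast
  have EO: "E - ?EB = ?EO" by auto
  have finB: "finite B" using B fin finite_subset by blast
  have col_a: "(collapse B a z = a) = (z \<in> B)" for z using B(2) by (auto simp: collapse_def)
  have col_x: "(collapse B a z = x) = (z = x)" if "x \<notin> B" for x z
    using that B(2) by (auto simp: collapse_def)
  have "net E (collapse B a \<circ> s) (collapse B a \<circ> t) \<sigma> a
      = (\<Sum>e\<in>E. \<sigma> e * (of_bool (s e \<in> B) - of_bool (t e \<in> B)))"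
    unfolding net_def by (simp add: col_a)
  also have "\<dots> = (\<Sum>e\<in>?EO. \<sigma> e * (of_bool (s e \<in> B) - of_bool (t e \<in> B)))"
    using fin by (intro sum.mono_neutral_right) auto
  also have "\<dots> = (\<Sum>x\<in>B. net ?EO s t \<sigma> x)"
    using finB fin by (simp add: sum_net)
  finally have "3 dvd (\<Sum>x\<in>B. net ?EO s t \<sigma> x) - (\<Sum>x\<in>B. \<gamma> x)"
    using s(2) by auto
  then have c2: "3 dvd (\<Sum>x\<in>B. \<gamma> x - net ?EO s t \<sigma> x)"
    by (simp add: sum_subtractf dvd_diff_commute)
  have main: "orientable_mod3 V E s t \<gamma>" if sub: "orientable_mod3 B ?EB s t (\<lambda>x. \<gamma> x - net ?EO s t \<sigma> x)"
  proof -
    obtain \<rho> where r: "\<forall>e. \<rho> e \<in> {1,-1}" "\<forall>x\<in>B. 3 dvd net ?EB s t \<rho> x - (\<gamma> x - net ?EO s t \<sigma> x)"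
      using sub unfolding orientable_mod3_def by blast
    define \<tau> where "\<tau> e = (if e \<in> ?EB then \<rho> e else \<sigma> e)" for e
    have "net ?EB s t \<tau> x = net ?EB s t \<rho> x" "net ?EO s t \<tau> x = net ?EO s t \<sigma> x" for x
      by (auto intro!: net_cong simp: \<tau>_def)
    then have nt: "net E s t \<tau> x = net ?EB s t \<rho> x + net ?EO s t \<sigma> x" for x
      using net_split[of E ?EB s t \<tau> x] fin EO by simp
    have "3 dvd net E s t \<tau> x - \<gamma> x" if x: "x \<in> V" for x
    proof (cases "x \<in> B")
      case True
      then show ?thesis using r(2) nt by (simp add: algebra_simps)
    next
      case False
      have "net ?EB s t \<rho> x = 0" "net ?EB s t \<sigma> x = 0"
        unfolding net_def using False by (auto intro!: sum.neutral)
      then have "net E s t \<tau> x = net E s t \<sigma> x"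
        using nt net_split[of E ?EB s t \<sigma> x] fin EO by simp
      also have "\<dots> = net E (collapse B a \<circ> s) (collapse B a \<circ> t) \<sigma> x"
        unfolding net_def using col_x[OF False] by simp
      finally show ?thesis using s(2) x False B(2) by (auto split: if_splits)
    qed
    moreover have "\<forall>e. \<tau> e \<in> {1,-1}" using r(1) s(1) by (auto simp: \<tau>_def)
    ultimately show ?thesis unfolding orientable_mod3_def by blast
  qed
  show ?thesis by (rule that[OF s(1) c2 main])
qed

lemma orientable_contract_all:
  assumes fin: "finite V" "finite E" and B: "B \<subseteq> V" "a \<in> B"
    and con: "orientable_mod3 (insert a (V - B)) E (collapse B a \<circ> s) (collapse B a \<circ> t)
               (\<gamma>(a := \<Sum>x\<in>B. \<gamma> x))"
    and sub: "\<And>\<gamma>'. 3 dvd (\<Sum>x\<in>B. \<gamma>' x) \<Longrightarrow> orientable_mod3 B {e \<in> E. s e \<in> B \<and> t e \<in> B} s t \<gamma>'"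
  shows "orientable_mod3 V E s t \<gamma>"
proof (rule orientable_contract[OF assms(1-5)])
  fix \<sigma>
  let ?g = "\<lambda>x. \<gamma> x - net {e \<in> E. \<not> (s e \<in> B \<and> t e \<in> B)} s t \<sigma> x"
  assume "3 dvd (\<Sum>x\<in>B. ?g x)"
    and "orientable_mod3 B {e \<in> E. s e \<in> B \<and> t e \<in> B} s t ?g \<Longrightarrow> orientable_mod3 V E s t \<gamma>"
  then show ?thesis using sub[of ?g] by simp
qed

lemma sum_contract:
  fixes f :: "'v \<Rightarrow> int"
  assumes "finite V" "B \<subseteq> V" "a \<in> B" "A \<subseteq> insert a (V - B)"
  shows "(\<Sum>x\<in>A. (f(a := \<Sum>x\<in>B. f x)) x) = (\<Sum>x\<in>(if a \<in> A then A \<union> B else A). f x)"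
proof (cases "a \<in> A")
  case True
  have "finite A" using assms finite_subset[OF assms(4)] by auto
  have "(\<Sum>x\<in>A. (f(a := \<Sum>x\<in>B. f x)) x) = (\<Sum>x\<in>B. f x) + (\<Sum>x\<in>A-{a}. (f(a := \<Sum>x\<in>B. f x)) x)"
    using sum.remove[OF \<open>finite A\<close> True, of "f(a := \<Sum>x\<in>B. f x)"] by simp
  also have "(\<Sum>x\<in>A-{a}. (f(a := \<Sum>x\<in>B. f x)) x) = (\<Sum>x\<in>A-{a}. f x)"
    by (intro sum.cong) auto
  also have "(\<Sum>x\<in>B. f x) + (\<Sum>x\<in>A-{a}. f x) = (\<Sum>x\<in>B \<union> (A-{a}). f x)"
    using assms \<open>finite A\<close> by (intro sum.union_disjoint[symmetric]) (auto intro: finite_subset)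
  also have "B \<union> (A-{a}) = A \<union> B" using assms by auto
  finally show ?thesis using True by simp
next
  case False
  then show ?thesis by (auto intro!: sum.cong)
qed

section \<open>Rooted instances and tight sets\<close>

text \<open>
Let \<open>\<tau>\<close> be the integer of least absolute value that has the parity of \<open>d\<close> and the residue of \<open>g\<close> modulo
3; it lies between -3 and 3. A set with \<open>d\<close> boundary edges and residue \<open>g\<close> has net out-degree
congruent to \<open>\<tau>\<close> modulo 6. The value below is \<open>4 + \<bar>\<tau>\<bar>\<close>.
\<close>

definition threshold :: "int \<Rightarrow> int \<Rightarrow> int" where
  "threshold d g = (if even d then (if 3 dvd g then 4 else 6) else (if 3 dvd g then 7 else 5))"

text \<open>
The root is not a vertex of \<open>V\<close>. Its edges are directed in advance and occur only as numbers: \<open>p x\<close>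
edges from \<open>x\<close> to the root and \<open>q x\<close> edges from the root to \<open>x\<close>. The load of \<open>A\<close> is the size of its
cut in the graph with the root.
\<close>

definition load ::
    "'e set \<Rightarrow> ('e \<Rightarrow> 'v) \<Rightarrow> ('e \<Rightarrow> 'v) \<Rightarrow> ('v \<Rightarrow> int) \<Rightarrow> ('v \<Rightarrow> int) \<Rightarrow> 'v set \<Rightarrow> int" where
  "load E s t p q A = cut E s t A + (\<Sum>x\<in>A. p x + q x)"

text \<open>
While \<open>\<gamma>\<close> prescribes the net out-degree in \<open>E\<close> alone, the demand is the residue that results for \<open>A\<close> when
the directed edges at the root are counted as well.
\<close>

definition demand :: "('v \<Rightarrow> int) \<Rightarrow> ('v \<Rightarrow> int) \<Rightarrow> ('v \<Rightarrow> int) \<Rightarrow> 'v set \<Rightarrow> int" where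
  "demand p q \<gamma> A = (\<Sum>x\<in>A. \<gamma> x + p x - q x)"

text \<open>
Every set has to be loaded enough, but the root must not be: its degree is bounded from above by the
same threshold. This is exactly the situation at a root that arises by contracting the complement of
a tight set. The conclusion to be drawn, that \<open>E\<close> can be oriented for \<open>\<gamma>\<close>, mentions neither \<open>p\<close>
nor \<open>q\<close>; they serve as a certificate and may be altered as long as admissibility is kept.
\<close>

definition admissible :: "'v set \<Rightarrow> 'e set \<Rightarrow> ('e \<Rightarrow> 'v) \<Rightarrow> ('e \<Rightarrow> 'v) \<Rightarrow>
    ('v \<Rightarrow> int) \<Rightarrow> ('v \<Rightarrow> int) \<Rightarrow> ('v \<Rightarrow> int) \<Rightarrow> bool" where
  "admissible V E s t p q \<gamma> \<longleftrightarrow> finite V \<and> finite E \<and> (\<forall>e\<in>E. s e \<in> V \<and> t e \<in> V)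
     \<and> (\<forall>x. 0 \<le> p x \<and> 0 \<le> q x) \<and> 3 dvd (\<Sum>x\<in>V. \<gamma> x)
     \<and> (\<Sum>x\<in>V. p x + q x) \<le> threshold (\<Sum>x\<in>V. p x + q x) (\<Sum>x\<in>V. p x - q x)
     \<and> (\<forall>A. A \<noteq> {} \<longrightarrow> A \<subset> V \<longrightarrow>
          threshold (load E s t p q A) (demand p q \<gamma> A) \<le> load E s t p q A)"

text \<open>
This holds as soon as no proper subset with at least two vertices is tight, since a load and its threshold have
the same parity (\<open>threshold_gap\<close>).
\<close>

definition slack where
  "slack V E s t p q \<gamma> \<longleftrightarrow> (\<forall>A. A \<subset> V \<longrightarrow> 2 \<le> card A \<longrightarrow>
      threshold (load E s t p q A) (demand p q \<gamma> A) + 2 \<le> load E s t p q A)"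

lemma threshold_cong:
  assumes "even (d - d')" "3 dvd g - g'"
  shows "threshold d g = threshold d' g'"
proof -
  have "even d = even d'" using assms(1) by simp
  moreover have "(3 dvd g) = (3 dvd g')"
    using dvd_add_right_iff[OF assms(2), of g'] by simp
  ultimately show ?thesis by (simp add: threshold_def)
qed

lemma threshold_shift: "3 dvd g - g' \<Longrightarrow> threshold d g = threshold d g'"
  by (rule threshold_cong) auto

lemma threshold_uminus: "threshold d (- g) = threshold d g"
  by (simp add: threshold_def)

lemma threshold_bounds: "4 \<le> threshold d g" "threshold d g \<le> 7" by (auto simp: threshold_def)

lemma threshold_gap: "threshold d g \<le> d \<Longrightarrow> d \<noteq> threshold d g \<Longrightarrow> threshold d g + 2 \<le> d"
  unfolding threshold_def by presburger

text \<open>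
This is the triangle inequality for the absolute value of the residue modulo 6.
\<close>

lemma threshold_subadditive: "threshold (a + b) (g + h) + 4 \<le> threshold a g + threshold b h"
proof (cases "3 dvd g")
  case True
  then have "(3 dvd g + h) = (3 dvd h)" by (simp add: dvd_add_right_iff)
  with True show ?thesis by (auto simp: threshold_def)
next
  case g: False
  show ?thesis
  proof (cases "3 dvd h")
    case True
    then have "(3 dvd g + h) = (3 dvd g)" by (simp add: dvd_add_left_iff)
    with True g show ?thesis by (auto simp: threshold_def)
  next
    case False
    with g show ?thesis by (auto simp: threshold_def)
  qed
qed

lemma cut_remove_edge:
  assumes "finite E" "e \<in> E"
  shows "cut E s t A = of_bool ((s e \<in> A) \<noteq> (t e \<in> A)) + cut (E - {e}) s t A"
  unfolding cut_def using assms by (rule sum.remove)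

lemma cut_loop: "finite E \<Longrightarrow> e \<in> E \<Longrightarrow> s e = t e \<Longrightarrow> cut (E - {e}) s t A = cut E s t A"
  by (simp add: cut_remove_edge[of E e])

lemma cut_remove:
  assumes "finite E" "e \<in> E" "joins s t e x y"
  shows "cut E s t A = cut (E - {e}) s t A + of_bool ((x \<in> A) \<noteq> (y \<in> A))"
  using assms(3) cut_remove_edge[OF assms(1,2), of s t A] unfolding joins_def by auto

lemma cut_nonneg: "0 \<le> cut E s t A" unfolding cut_def by (intro sum_nonneg) auto

lemma cut_compl:
  assumes "\<forall>e\<in>E. s e \<in> V \<and> t e \<in> V"
  shows "cut E s t (V - A) = cut E s t A"
  unfolding cut_def using assms by (intro sum.cong) auto

lemma cut_subset_collapse:
  assumes "\<forall>e\<in>E. s e \<in> V \<and> t e \<in> V" "a \<in> B" "A \<subseteq> insert a (V - B)"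
  shows "cut E (collapse B a \<circ> s) (collapse B a \<circ> t) A = cut E s t (if a \<in> A then A \<union> B else A)"
proof -
  have "(collapse B a z \<in> A) = (z \<in> (if a \<in> A then A \<union> B else A))" for z
    using assms(2,3) by (auto simp: collapse_def)
  then show ?thesis unfolding cut_def by simp
qed

lemma admissible_collapse:
  assumes I: "admissible V E s t p q \<gamma>" and B: "B \<subseteq> V" "a \<in> B"
  shows "admissible (insert a (V - B)) E (collapse B a \<circ> s) (collapse B a \<circ> t)
     (p(a := \<Sum>x\<in>B. p x)) (q(a := \<Sum>x\<in>B. q x)) (\<gamma>(a := \<Sum>x\<in>B. \<gamma> x))"
proof -
  let ?V = "insert a (V - B)"
  let ?p = "p(a := \<Sum>x\<in>B. p x)" and ?q = "q(a := \<Sum>x\<in>B. q x)" and ?g = "\<gamma>(a := \<Sum>x\<in>B. \<gamma> x)"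
  have fin: "finite V" "finite E" and ends: "\<forall>e\<in>E. s e \<in> V \<and> t e \<in> V"
    and pq: "\<And>x. 0 \<le> p x \<and> 0 \<le> q x"
    using I unfolding admissible_def by auto
  have Veq: "?V \<union> B = V" using B by auto
  note sc = sum_contract[OF fin(1) B]
  have load: "load E (collapse B a \<circ> s) (collapse B a \<circ> t) ?p ?q A
      = load E s t p q (if a \<in> A then A \<union> B else A)"
    and dem: "demand ?p ?q ?g A = demand p q \<gamma> (if a \<in> A then A \<union> B else A)" if "A \<subseteq> ?V" for A
    using that cut_subset_collapse[OF ends B(2) that] sc[OF that, of p] sc[OF that, of q] sc[OF that, of \<gamma>]
    unfolding load_def demand_def by (simp_all only: sum.distrib sum_subtractf)
  have "threshold (load E (collapse B a \<circ> s) (collapse B a \<circ> t) ?p ?q A) (demand ?p ?q ?g A)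
      \<le> load E (collapse B a \<circ> s) (collapse B a \<circ> t) ?p ?q A" if "A \<noteq> {}" "A \<subset> ?V" for A
  proof -
    let ?A = "if a \<in> A then A \<union> B else A"
    have "?A \<noteq> {}" "?A \<subset> V" using that B by auto
    then have "threshold (load E s t p q ?A) (demand p q \<gamma> ?A) \<le> load E s t p q ?A"
      using I unfolding admissible_def by blast
    then show ?thesis using load[of A] dem[of A] that(2) by simp
  qed
  moreover have "(\<Sum>x\<in>?V. ?p x + ?q x) = (\<Sum>x\<in>V. p x + q x)"
    "(\<Sum>x\<in>?V. ?p x - ?q x) = (\<Sum>x\<in>V. p x - q x)" "(\<Sum>x\<in>?V. ?g x) = (\<Sum>x\<in>V. \<gamma> x)"
    using sc[OF order_refl, of p] sc[OF order_refl, of q] sc[OF order_refl, of \<gamma>] Veq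
    by (simp_all only: sum.distrib sum_subtractf insertI1 if_True)
  moreover have "\<forall>x. 0 \<le> ?p x \<and> 0 \<le> ?q x" using pq by (auto intro: sum_nonneg)
  moreover have "\<forall>e\<in>E. (collapse B a \<circ> s) e \<in> ?V \<and> (collapse B a \<circ> t) e \<in> ?V"
    using ends by (auto simp: collapse_def)
  moreover have "finite ?V" using fin by simp
  ultimately show ?thesis using I fin unfolding admissible_def by (simp del: fun_upd_apply)
qed

text \<open>
The rest of the graph becomes the root of \<open>B\<close>. Its degree is the load of \<open>B\<close>, and tightness of \<open>B\<close> is
precisely the upper bound that admissibility imposes at a root.
\<close>

lemma admissible_inside_tight:
  assumes I: "admissible V E s t p q \<gamma>" and B: "B \<subset> V" "B \<noteq> {}"
    and tight: "load E s t p q B = threshold (load E s t p q B) (demand p q \<gamma> B)"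
    and sg: "\<forall>e. \<sigma> e \<in> {1, -1}"
    and z: "3 dvd (\<Sum>x\<in>B. \<gamma> x - net {e \<in> E. \<not> (s e \<in> B \<and> t e \<in> B)} s t \<sigma> x)"
  shows "\<exists>p' q'. admissible B {e \<in> E. s e \<in> B \<and> t e \<in> B} s t p' q'
     (\<lambda>x. \<gamma> x - net {e \<in> E. \<not> (s e \<in> B \<and> t e \<in> B)} s t \<sigma> x)"
proof -
  let ?EB = "{e \<in> E. s e \<in> B \<and> t e \<in> B}"
  let ?EO = "{e \<in> E. \<not> (s e \<in> B \<and> t e \<in> B)}"
  define g where "g x = \<gamma> x - net ?EO s t \<sigma> x" for x
  define inc where "inc e x = \<sigma> e * (of_bool (s e = x) - of_bool (t e = x))" for e x
  define p' where "p' x = p x + (\<Sum>e\<in>?EO. of_bool (inc e x = 1))" for x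
  define q' where "q' x = q x + (\<Sum>e\<in>?EO. of_bool (inc e x = -1))" for x
  have fin: "finite V" "finite E" and ends: "\<forall>e\<in>E. s e \<in> V \<and> t e \<in> V"
    and pq: "\<And>x. 0 \<le> p x \<and> 0 \<le> q x"
    using I unfolding admissible_def by auto
  have finB: "finite B" using B fin finite_subset by blast
  have inc_val: "inc e x \<in> {-1,0,1}" for e x
  proof -
    have "\<sigma> e \<in> {1,-1}" using sg by blast
    then show ?thesis by (auto simp: inc_def)
  qed
  have diff: "p' x - q' x = p x - q x + net ?EO s t \<sigma> x" for x
  proof -
    have "(\<Sum>e\<in>?EO. of_bool (inc e x = 1)) - (\<Sum>e\<in>?EO. of_bool (inc e x = -1)) = (\<Sum>e\<in>?EO. inc e x)"
      unfolding sum_subtractf[symmetric]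
    proof (rule sum.cong[OF refl])
      fix e show "of_bool (inc e x = 1) - of_bool (inc e x = -1) = inc e x" using inc_val[of e x] by auto
    qed
    then show ?thesis unfolding p'_def q'_def net_def inc_def by simp
  qed
  have ob: "(\<Sum>x\<in>A. of_bool (y = x)) = (of_bool (y \<in> A) :: int)" if "finite A" for y and A :: "'a set"
    using that by (simp add: of_bool_def)
  have plus: "(\<Sum>x\<in>A. p' x + q' x) = (\<Sum>x\<in>A. p x + q x) + cut ?EO s t A" if A: "A \<subseteq> B" for A
  proof -
    have finA: "finite A" using A finB finite_subset by blast
    have "(\<Sum>x\<in>A. p' x + q' x) = (\<Sum>x\<in>A. p x + q x)
        + (\<Sum>x\<in>A. \<Sum>e\<in>?EO. of_bool (inc e x = 1) + of_bool (inc e x = -1))"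
      unfolding p'_def q'_def by (simp add: sum.distrib)
    also have "(\<Sum>x\<in>A. \<Sum>e\<in>?EO. of_bool (inc e x = 1) + of_bool (inc e x = -1) :: int)
        = (\<Sum>e\<in>?EO. \<Sum>x\<in>A. of_bool (inc e x = 1) + of_bool (inc e x = -1))" by (rule sum.swap)
    also have "\<dots> = cut ?EO s t A"
      unfolding cut_def
    proof (rule sum.cong[OF refl])
      fix e assume e: "e \<in> ?EO"
      have "of_bool (inc e x = 1) + of_bool (inc e x = -1) = (of_bool (s e = x) + of_bool (t e = x) :: int)"
        if "x \<in> A" for x
      proof -
        have "\<sigma> e \<in> {1,-1}" using sg by blast
        moreover have "\<not> (s e = x \<and> t e = x)" using e that A by auto
        ultimately show ?thesis unfolding inc_def by auto
      qed
      then have "(\<Sum>x\<in>A. of_bool (inc e x = 1) + of_bool (inc e x = -1))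
          = (\<Sum>x\<in>A. of_bool (s e = x) + of_bool (t e = x) :: int)" by simp
      also have "\<dots> = of_bool (s e \<in> A) + of_bool (t e \<in> A)"
        using ob[OF finA] by (simp add: sum.distrib)
      also have "\<dots> = of_bool ((s e \<in> A) \<noteq> (t e \<in> A))" using e A by auto
      finally show "(\<Sum>x\<in>A. of_bool (inc e x = 1) + of_bool (inc e x = -1))
          = (of_bool ((s e \<in> A) \<noteq> (t e \<in> A)) :: int)" .
    qed
    finally show ?thesis .
  qed
  have cut2: "cut E s t A = cut ?EB s t A + cut ?EO s t A" for A
  proof -
    have "cut E s t A = cut (E - ?EB) s t A + cut ?EB s t A"
      unfolding cut_def using fin by (intro sum.subset_diff) auto
    moreover have "E - ?EB = ?EO" by auto
    ultimately show ?thesis by simp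
  qed
  have load: "load ?EB s t p' q' A = load E s t p q A" if "A \<subseteq> B" for A
    unfolding load_def using plus[OF that] cut2[of A] by simp
  have dem: "demand p' q' g A = demand p q \<gamma> A" for A
    unfolding demand_def g_def using diff by (intro sum.cong refl) (simp add: algebra_simps)
  have "cut ?EB s t B = 0" unfolding cut_def by (intro sum.neutral) auto
  then have tB: "(\<Sum>x\<in>B. p' x + q' x) = load E s t p q B" using load[of B] unfolding load_def by simp
  have "(\<Sum>x\<in>B. p' x - q' x) = demand p' q' g B - (\<Sum>x\<in>B. g x)"
    unfolding demand_def by (simp add: sum.distrib sum_subtractf)
  then have "3 dvd demand p q \<gamma> B - (\<Sum>x\<in>B. p' x - q' x)" using z dem[of B] by (simp add: g_def)
  then have "threshold (\<Sum>x\<in>B. p' x + q' x) (\<Sum>x\<in>B. p' x - q' x) = threshold (load E s t p q B) (demand p q \<gamma> B)"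
    using tB threshold_shift by metis
  then have root: "(\<Sum>x\<in>B. p' x + q' x) \<le> threshold (\<Sum>x\<in>B. p' x + q' x) (\<Sum>x\<in>B. p' x - q' x)"
    using tight tB by linarith
  have nn: "\<forall>x. 0 \<le> p' x \<and> 0 \<le> q' x"
    using pq unfolding p'_def q'_def by (auto intro!: add_nonneg_nonneg sum_nonneg)
  have cuts: "threshold (load ?EB s t p' q' A) (demand p' q' g A) \<le> load ?EB s t p' q' A"
    if "A \<noteq> {}" "A \<subset> B" for A
  proof -
    have "A \<subset> V" using that B by auto
    then have "threshold (load E s t p q A) (demand p q \<gamma> A) \<le> load E s t p q A"
      using I that unfolding admissible_def by blast
    then show ?thesis using load[of A] dem[of A] that by simp
  qed
  have "admissible B ?EB s t p' q' g"
    unfolding admissible_def using finB fin nn root cuts z by (auto simp: g_def)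
  then show ?thesis unfolding g_def by blast
qed

text \<open>
The induction hypothesis on the number of vertices. The type arguments pin down the types of vertices
and edges.
\<close>

definition solves_below :: "nat \<Rightarrow> 'v itself \<Rightarrow> 'e itself \<Rightarrow> bool" where
  "solves_below n _ _ \<longleftrightarrow> (\<forall>(V :: 'v set) (E :: 'e set) s t p q \<gamma>.
     admissible V E s t p q \<gamma> \<longrightarrow> 2 \<le> card V \<longrightarrow> card V < n \<longrightarrow> orientable_mod3 V E s t \<gamma>)"

lemma solves_belowD:
  fixes V :: "'v set" and E :: "'e set"
  assumes "solves_below n TYPE('v) TYPE('e)" "admissible V E s t p q \<gamma>" "2 \<le> card V" "card V < n"
  shows "orientable_mod3 V E s t \<gamma>"
  using assms unfolding solves_below_def by blast

lemma card_collapse: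
  assumes "finite V" "B \<subset> V" "a \<in> B"
  shows "card (insert a (V - B)) = card V - card B + 1" "card B < card V"
proof -
  have "finite B" using assms finite_subset by blast
  then show "card (insert a (V - B)) = card V - card B + 1"
    using assms by (simp add: card_Diff_subset)
  show "card B < card V" using assms by (simp add: psubset_card_mono)
qed

lemma orientable_of_tight:
  fixes V :: "'v set" and E :: "'e set"
  assumes I: "admissible V E s t p q \<gamma>" and IH: "solves_below (card V) TYPE('v) TYPE('e)"
    and B: "B \<subset> V" "2 \<le> card B"
    and tight: "load E s t p q B = threshold (load E s t p q B) (demand p q \<gamma> B)"
  shows "orientable_mod3 V E s t \<gamma>"
proof -
  obtain a where a: "a \<in> B" using B(2) by fastforce
  have fin: "finite V" "finite E" using I unfolding admissible_def by auto
  have sub: "B \<subseteq> V" using B by auto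
  have cd: "card (insert a (V - B)) = card V - card B + 1" "card B < card V"
    using card_collapse[OF fin(1) B(1) a] by auto
  have "orientable_mod3 (insert a (V - B)) E (collapse B a \<circ> s) (collapse B a \<circ> t) (\<gamma>(a := \<Sum>x\<in>B. \<gamma> x))"
  proof -
    have "2 \<le> card (insert a (V - B))" "card (insert a (V - B)) < card V" using cd B(2) by linarith+
    then show ?thesis by (rule solves_belowD[OF IH admissible_collapse[OF I sub a]])
  qed
  then show ?thesis
  proof (rule orientable_contract[OF fin sub a])
    fix \<sigma>
    let ?g = "\<lambda>x. \<gamma> x - net {e \<in> E. \<not> (s e \<in> B \<and> t e \<in> B)} s t \<sigma> x"
    assume sg: "\<forall>e. \<sigma> e \<in> {1, -1}" and z: "3 dvd (\<Sum>x\<in>B. ?g x)"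
      and imp: "orientable_mod3 B {e \<in> E. s e \<in> B \<and> t e \<in> B} s t ?g \<Longrightarrow> orientable_mod3 V E s t \<gamma>"
    have "B \<noteq> {}" using a by auto
    from admissible_inside_tight[OF I B(1) this tight sg z]
    obtain p' q' where J: "admissible B {e \<in> E. s e \<in> B \<and> t e \<in> B} s t p' q' ?g"
      by (elim exE)
    have "orientable_mod3 B {e \<in> E. s e \<in> B \<and> t e \<in> B} s t ?g"
      by (rule solves_belowD[OF IH J B(2) cd(2)])
    then show ?thesis by (rule imp)
  qed
qed

lemma slack_of_not_orientable:
  fixes V :: "'v set" and E :: "'e set"
  assumes I: "admissible V E s t p q \<gamma>" and IH: "solves_below (card V) TYPE('v) TYPE('e)"
    and no: "\<not> orientable_mod3 V E s t \<gamma>"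
  shows "slack V E s t p q \<gamma>"
  unfolding slack_def
proof (intro allI impI)
  fix A assume A: "A \<subset> V" "2 \<le> card A"
  then have "A \<noteq> {}" by auto
  then have "threshold (load E s t p q A) (demand p q \<gamma> A) \<le> load E s t p q A"
    using I A unfolding admissible_def by blast
  moreover have "load E s t p q A \<noteq> threshold (load E s t p q A) (demand p q \<gamma> A)"
    using orientable_of_tight[OF I IH A] no by blast
  ultimately show "threshold (load E s t p q A) (demand p q \<gamma> A) + 2 \<le> load E s t p q A"
    by (rule threshold_gap)
qed

text \<open>
Two parallel edges realise every residue at \<open>x\<close>, so their ends can be contracted. One more vertex is
assumed so that the quotient still has two vertices.
\<close>

lemma orientable_of_parallel:
  fixes V :: "'v set" and E :: "'e set"
  assumes I: "admissible V E s t p q \<gamma>" and IH: "solves_below (card V) TYPE('v) TYPE('e)"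
    and "2 < card V" "e \<in> E" "f \<in> E" "e \<noteq> f" "joins s t e x y" "joins s t f x y" "x \<noteq> y"
  shows "orientable_mod3 V E s t \<gamma>"
proof -
  have fin: "finite V" "finite E" and ends: "\<forall>e\<in>E. s e \<in> V \<and> t e \<in> V"
    using I unfolding admissible_def by auto
  have xy: "x \<in> V" "y \<in> V" using ends assms(4) assms(7) by (auto simp: joins_def)
  let ?B = "{x,y}"
  have B: "?B \<subseteq> V" "x \<in> ?B" "?B \<subset> V" using xy assms(3,9) by auto
  have "card (insert x (V - ?B)) = card V - card ?B + 1" "card ?B < card V"
    using card_collapse[OF fin(1) B(3,2)] by auto
  then have "2 \<le> card (insert x (V - ?B))" "card (insert x (V - ?B)) < card V"
    using assms(3,9) by auto
  then have "orientable_mod3 (insert x (V - ?B)) E (collapse ?B x \<circ> s) (collapse ?B x \<circ> t)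
      (\<gamma>(x := \<Sum>z\<in>?B. \<gamma> z))"
    by (rule solves_belowD[OF IH admissible_collapse[OF I B(1,2)]])
  then show ?thesis
  proof (rule orientable_contract_all[OF fin B(1,2)])
    fix g :: "'v \<Rightarrow> int" assume g: "3 dvd (\<Sum>z\<in>?B. g z)"
    let ?EB = "{e \<in> E. s e \<in> ?B \<and> t e \<in> ?B}"
    show "orientable_mod3 ?B ?EB s t g"
    proof (rule orientable_star[where u = x])
      fix w assume w: "w \<in> ?B - {x}"
      have "{e,f} \<subseteq> {e \<in> ?EB. joins s t e w x}" using w assms(4-8) by (auto simp: joins_def)
      then have "card {e,f} \<le> card {e \<in> ?EB. joins s t e w x}" using fin by (intro card_mono) auto
      then show "2 \<le> card {e \<in> ?EB. joins s t e w x}" using assms(6) by simp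
    qed (use fin g in auto)
  qed
qed

text \<open>
The two loads exceed the degree of the root by twice the number of edges between the vertices, and
the triangle inequality turns this into at least two such edges.
\<close>

lemma orientable_of_two_vertices:
  assumes I: "admissible V E s t p q \<gamma>" and V: "V = {x,y}" "x \<noteq> y"
  shows "orientable_mod3 V E s t \<gamma>"
proof (rule orientable_star[where u = x])
  show "finite V" "finite E" "\<forall>e\<in>E. s e \<in> V \<and> t e \<in> V" "x \<in> V" "3 dvd (\<Sum>y\<in>V. \<gamma> y)"
    using I V unfolding admissible_def by auto
  fix w assume "w \<in> V - {x}"
  then have w: "w = y" using V by auto
  have fin: "finite E" and ends: "\<forall>e\<in>E. s e \<in> V \<and> t e \<in> V"
    using I unfolding admissible_def by auto
  have cx: "cut E s t {x} = int (card {e \<in> E. joins s t e y x})"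
    unfolding cut_eq_card[OF fin] using ends V
    by (intro arg_cong[where f = "\<lambda>A. int (card A)"] Collect_cong) (auto simp: joins_def)
  have "cut E s t {y} = cut E s t (V - {y})" using cut_compl[OF ends] by simp
  also have "V - {y} = {x}" using V by auto
  finally have cy: "cut E s t {y} = cut E s t {x}" .
  have "threshold (load E s t p q {x}) (demand p q \<gamma> {x}) \<le> load E s t p q {x}"
    "threshold (load E s t p q {y}) (demand p q \<gamma> {y}) \<le> load E s t p q {y}"
    using I V unfolding admissible_def by auto
  moreover have root: "(p x + q x) + (p y + q y)
      \<le> threshold ((p x + q x) + (p y + q y)) ((p x - q x) + (p y - q y))"
    and z: "3 dvd \<gamma> x + \<gamma> y"
    using I V unfolding admissible_def by auto
  moreover have "threshold ((p x + q x) + (p y + q y)) ((p x - q x) + (p y - q y))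
      = threshold (load E s t p q {x} + load E s t p q {y}) (demand p q \<gamma> {x} + demand p q \<gamma> {y})"
  proof (rule threshold_cong)
    have "(p x + q x) + (p y + q y) - (load E s t p q {x} + load E s t p q {y}) = - 2 * cut E s t {x}"
      using cy unfolding load_def by simp
    then show "even ((p x + q x) + (p y + q y) - (load E s t p q {x} + load E s t p q {y}))" by simp
    have "(p x - q x) + (p y - q y) - (demand p q \<gamma> {x} + demand p q \<gamma> {y}) = - (\<gamma> x + \<gamma> y)"
      unfolding demand_def by simp
    then show "3 dvd (p x - q x) + (p y - q y) - (demand p q \<gamma> {x} + demand p q \<gamma> {y})"
      using z by (simp only: dvd_minus_iff)
  qed
  ultimately have "(p x + q x) + (p y + q y) + 4 \<le> load E s t p q {x} + load E s t p q {y}"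
    using threshold_subadditive[of "load E s t p q {x}" "load E s t p q {y}" "demand p q \<gamma> {x}" "demand p q \<gamma> {y}"]
    by linarith
  then have "2 \<le> cut E s t {x}"
    using cy unfolding load_def by simp
  then show "2 \<le> card {e \<in> E. joins s t e w x}" using cx w by simp
qed

section \<open>Reductions that preserve admissibility\<close>

lemma sum_upd:
  fixes f :: "'v \<Rightarrow> int"
  assumes "finite A"
  shows "(\<Sum>z\<in>A. (f(x := v)) z) = (\<Sum>z\<in>A. f z) + (v - f x) * of_bool (x \<in> A)"
proof (cases "x \<in> A")
  case True
  have "(\<Sum>z\<in>A-{x}. (f(x := v)) z) = (\<Sum>z\<in>A-{x}. f z)" by (intro sum.cong) auto
  then show ?thesis
    using sum.remove[OF assms True, of f] sum.remove[OF assms True, of "f(x := v)"] True by simp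
next
  case False
  then have "(\<Sum>z\<in>A. (f(x := v)) z) = (\<Sum>z\<in>A. f z)" by (intro sum.cong) auto
  then show ?thesis using False by simp
qed

lemma load_alt: "load E s t p q A = cut E s t A + sum p A + sum q A"
  by (simp add: load_def sum.distrib)

lemma demand_alt: "demand p q \<gamma> A = sum \<gamma> A + sum p A - sum q A"
  by (simp add: demand_def sum.distrib sum_subtractf)

lemma cut_upd:
  assumes "e \<notin> E"
  shows "cut E (s(e := a)) (t(e := b)) A = cut E s t A"
  unfolding cut_def using assms by (intro sum.cong) auto

lemma admissibleD:
  assumes "admissible V E s t p q \<gamma>"
  shows "finite V" "finite E" "\<forall>e\<in>E. s e \<in> V \<and> t e \<in> V" "\<forall>x. 0 \<le> p x \<and> 0 \<le> q x"
    "3 dvd sum \<gamma> V" "sum p V + sum q V \<le> threshold (sum p V + sum q V) (sum p V - sum q V)"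
    "\<And>A. A \<noteq> {} \<Longrightarrow> A \<subset> V \<Longrightarrow> threshold (load E s t p q A) (demand p q \<gamma> A) \<le> load E s t p q A"
  using assms unfolding admissible_def by (simp_all add: sum.distrib sum_subtractf)

lemma admissibleI:
  assumes "finite V" "finite E" "\<forall>e\<in>E. s e \<in> V \<and> t e \<in> V" "\<forall>x. 0 \<le> p x \<and> 0 \<le> q x"
    "3 dvd sum \<gamma> V" "sum p V + sum q V \<le> threshold (sum p V + sum q V) (sum p V - sum q V)"
    "\<And>z. z \<in> V \<Longrightarrow> {z} \<subset> V \<Longrightarrow> threshold (load E s t p q {z}) (demand p q \<gamma> {z}) \<le> load E s t p q {z}"
    "\<And>A. A \<noteq> {} \<Longrightarrow> A \<subset> V \<Longrightarrow> 2 \<le> card A \<Longrightarrow> threshold (load E s t p q A) (demand p q \<gamma> A) \<le> load E s t p q A"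
  shows "admissible V E s t p q \<gamma>"
proof -
  have "threshold (load E s t p q A) (demand p q \<gamma> A) \<le> load E s t p q A" if A: "A \<noteq> {}" "A \<subset> V" for A
  proof (cases "2 \<le> card A")
    case True
    then show ?thesis using assms(8) A by blast
  next
    case False
    have "finite A" using A assms(1) finite_subset by blast
    then have "card A \<noteq> 0" using A(1) by simp
    then have "card A = 1" using False by linarith
    then obtain z where "A = {z}" by (rule card_1_singletonE)
    then show ?thesis using assms(7) A by blast
  qed
  then show ?thesis using assms(1-6) unfolding admissible_def by (simp add: sum.distrib sum_subtractf)
qed

lemma slackD:
  assumes "slack V E s t p q \<gamma>" "A \<subset> V" "2 \<le> card A"
  shows "threshold (load E s t p q A) (demand p q \<gamma> A) + 2 \<le> load E s t p q A"
  using assms unfolding slack_def by blast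

lemma threshold_step: "threshold d g + 2 \<le> d \<Longrightarrow> threshold (d - 1) (g - 1) \<le> d - 1"
  "threshold d g + 2 \<le> d \<Longrightarrow> threshold (d - 1) (g + 1) \<le> d - 1"
  unfolding threshold_def by presburger+

lemma threshold_down: "threshold d g + 2 \<le> d \<Longrightarrow> threshold (d - 2) g \<le> d - 2"
  by (simp add: threshold_def)

lemma threshold_up: "threshold d g \<le> d \<Longrightarrow> 5 \<le> d \<Longrightarrow> threshold (d + 1) (g + 3) \<le> d + 1"
  unfolding threshold_def by presburger

lemma threshold_root_dec: "d \<le> threshold d g \<Longrightarrow> d - 1 \<le> threshold (d - 1) (g - 1)"
  unfolding threshold_def by presburger

lemma threshold_root_swap: "0 \<le> d \<Longrightarrow> d \<le> threshold d (- d) \<Longrightarrow> d + 1 \<le> threshold (d + 1) (3 - d)"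
  unfolding threshold_def by presburger

lemma admissible_loop:
  assumes I: "admissible V E s t p q \<gamma>" and e: "e \<in> E" "s e = t e"
  shows "admissible V (E - {e}) s t p q \<gamma>"
proof -
  have "load (E - {e}) s t p q A = load E s t p q A" for A
    unfolding load_def using cut_loop[of E e] admissibleD(2)[OF I] e by simp
  then show ?thesis using I unfolding admissible_def by auto
qed

text \<open>
A larger set that is left by the edge loses 1 of its load and its threshold rises by at most 1, which
a slack of 2 absorbs. Only the two ends of the edge have to be checked.
\<close>

lemma admissible_delete:
  assumes I: "admissible V E s t p q \<gamma>" and S: "slack V E s t p q \<gamma>"
    and e: "e \<in> E" "joins s t e x y" "x \<noteq> y"
    and hx: "threshold (load E s t p q {x} - 1) (demand p q \<gamma> {x} - 1) \<le> load E s t p q {x} - 1"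
    and hy: "threshold (load E s t p q {y} - 1) (demand p q \<gamma> {y} + 1) \<le> load E s t p q {y} - 1"
  shows "admissible V (E - {e}) s t p q (\<gamma>(x := \<gamma> x - 1, y := \<gamma> y + 1))"
proof -
  let ?g = "\<gamma>(x := \<gamma> x - 1, y := \<gamma> y + 1)"
  note D = admissibleD[OF I]
  have xy: "x \<in> V" "y \<in> V" using D(3) e(1,2) unfolding joins_def by auto
  have sg: "sum ?g A = sum \<gamma> A - of_bool (x \<in> A) + of_bool (y \<in> A)" if "finite A" for A
    using sum_upd[OF that, of "\<gamma>(x := \<gamma> x - 1)" y "\<gamma> y + 1"] sum_upd[OF that, of \<gamma> x "\<gamma> x - 1"] e(3)
    by simp
  have dem: "demand p q ?g A = demand p q \<gamma> A - of_bool (x \<in> A) + of_bool (y \<in> A)" if "finite A" for A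
    using sg[OF that] by (simp add: demand_alt)
  have load: "load (E - {e}) s t p q A = load E s t p q A - of_bool ((x \<in> A) \<noteq> (y \<in> A))" for A
    using cut_remove[OF D(2) e(1,2), of A] by (simp add: load_alt)
  show ?thesis
  proof (rule admissibleI)
    show "3 dvd sum ?g V" using sg[OF D(1)] xy D(5) by simp
  next
    fix z assume z: "z \<in> V" "{z} \<subset> V"
    consider "z = x" | "z = y" | "z \<noteq> x" "z \<noteq> y" by blast
    then show "threshold (load (E - {e}) s t p q {z}) (demand p q ?g {z}) \<le> load (E - {e}) s t p q {z}"
    proof cases
      case 1
      then show ?thesis using hx e(3) load[of "{z}"] dem[of "{z}"] by auto
    next
      case 2
      then show ?thesis using hy e(3) load[of "{z}"] dem[of "{z}"] by auto
    next
      case 3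
      then show ?thesis using D(7)[of "{z}"] z load[of "{z}"] dem[of "{z}"] by auto
    qed
  next
    fix A assume A: "A \<subset> V" "2 \<le> card A"
    then have finA: "finite A" using D(1) finite_subset by blast
    note sl = slackD[OF S A]
    note st = threshold_step[OF sl]
    show "threshold (load (E - {e}) s t p q A) (demand p q ?g A) \<le> load (E - {e}) s t p q A"
      unfolding load dem[OF finA] using sl st by (cases "x \<in> A"; cases "y \<in> A") simp_all
  qed (use D in auto)
qed

text \<open>
Lifting costs a load of 2 for the sets that separate \<open>x\<close> from both \<open>y\<close> and \<open>z\<close>, and among the single
vertices this concerns \<open>x\<close> only.
\<close>

lemma admissible_lift:
  assumes I: "admissible V E s t p q \<gamma>" and S: "slack V E s t p q \<gamma>"
    and ef: "e \<in> E" "f \<in> E" "e \<noteq> f" "joins s t e x y" "joins s t f x z"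
    and ne: "x \<noteq> y" "x \<noteq> z" "y \<noteq> z"
    and hx: "threshold (load E s t p q {x}) (demand p q \<gamma> {x}) + 2 \<le> load E s t p q {x}"
  shows "admissible V (E - {f}) (s(e := y)) (t(e := z)) p q \<gamma>"
proof -
  note D = admissibleD[OF I]
  have V: "x \<in> V" "y \<in> V" "z \<in> V" using D(3) ef unfolding joins_def by auto
  have "cut E s t A = cut (E - {f} - {e}) s t A + of_bool ((x \<in> A) \<noteq> (y \<in> A)) + of_bool ((x \<in> A) \<noteq> (z \<in> A))" for A
    using cut_remove[OF D(2) ef(2,5), of A] cut_remove[of "E - {f}" e s t x y A] D(2) ef by simp
  moreover have "cut (E - {f}) (s(e := y)) (t(e := z)) A
      = cut (E - {f} - {e}) s t A + of_bool ((y \<in> A) \<noteq> (z \<in> A))" for A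
    using cut_remove[of "E - {f}" e "s(e := y)" "t(e := z)" y z A] D(2) ef
    by (simp add: cut_upd joins_def)
  ultimately have load: "load (E - {f}) (s(e := y)) (t(e := z)) p q A
      = load E s t p q A - 2 * of_bool ((x \<in> A) \<noteq> (y \<in> A) \<and> (x \<in> A) \<noteq> (z \<in> A))" for A
    unfolding load_alt by auto
  show ?thesis
  proof (rule admissibleI)
    show "\<forall>g\<in>E - {f}. (s(e := y)) g \<in> V \<and> (t(e := z)) g \<in> V" using D(3) V by auto
  next
    fix w assume w: "w \<in> V" "{w} \<subset> V"
    show "threshold (load (E - {f}) (s(e := y)) (t(e := z)) p q {w}) (demand p q \<gamma> {w})
        \<le> load (E - {f}) (s(e := y)) (t(e := z)) p q {w}"
      unfolding load using D(7)[of "{w}"] w ne threshold_down[OF hx] by (cases "w = x") auto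
  next
    fix A assume A: "A \<subset> V" "2 \<le> card A"
    note sl = slackD[OF S A]
    show "threshold (load (E - {f}) (s(e := y)) (t(e := z)) p q A) (demand p q \<gamma> A)
        \<le> load (E - {f}) (s(e := y)) (t(e := z)) p q A"
      unfolding load using sl threshold_down[OF sl]
      by (cases "(x \<in> A) \<noteq> (y \<in> A) \<and> (x \<in> A) \<noteq> (z \<in> A)") simp_all
  qed (use D in auto)
qed

text \<open>
The orientation problem on \<open>E\<close> is unchanged; only the certificate gets smaller.
\<close>

lemma admissible_root_decrease:
  assumes I: "admissible V E s t p q \<gamma>" and S: "slack V E s t p q \<gamma>"
    and x: "x \<in> V" "1 \<le> p x"
    and hx: "threshold (load E s t p q {x} - 1) (demand p q \<gamma> {x} - 1) \<le> load E s t p q {x} - 1"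
  shows "admissible V E s t (p(x := p x - 1)) q \<gamma>"
proof -
  let ?p = "p(x := p x - 1)"
  note D = admissibleD[OF I]
  have sp: "sum ?p A = sum p A - of_bool (x \<in> A)" if "finite A" for A
    using sum_upd[OF that, of p x "p x - 1"] by simp
  have dem: "demand ?p q \<gamma> A = demand p q \<gamma> A - of_bool (x \<in> A)" if "finite A" for A
    unfolding demand_alt using sp[OF that] by linarith
  have load: "load E s t ?p q A = load E s t p q A - of_bool (x \<in> A)" if "finite A" for A
    unfolding load_alt using sp[OF that] by linarith
  show ?thesis
  proof (rule admissibleI)
    have "sum p V + sum q V - 1 \<le> threshold (sum p V + sum q V - 1) (sum p V - sum q V - 1)"
      using threshold_root_dec[OF D(6)] .
    moreover have "sum ?p V + sum q V = sum p V + sum q V - 1" "sum ?p V - sum q V = sum p V - sum q V - 1"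
      using sp[OF D(1)] x by simp_all
    ultimately show "sum ?p V + sum q V \<le> threshold (sum ?p V + sum q V) (sum ?p V - sum q V)" by (simp only:)
    show "\<forall>z. 0 \<le> ?p z \<and> 0 \<le> q z" using D(4) x by auto
  next
    fix w assume w: "w \<in> V" "{w} \<subset> V"
    have f: "finite {w}" by simp
    show "threshold (load E s t ?p q {w}) (demand ?p q \<gamma> {w}) \<le> load E s t ?p q {w}"
      unfolding load[OF f] dem[OF f] using D(7)[of "{w}"] w hx by (cases "w = x") auto
  next
    fix A assume A: "A \<subset> V" "2 \<le> card A"
    then have finA: "finite A" using D(1) finite_subset by blast
    note sl = slackD[OF S A]
    show "threshold (load E s t ?p q A) (demand ?p q \<gamma> A) \<le> load E s t ?p q A"
      unfolding load[OF finA] dem[OF finA] using sl threshold_step[OF sl] by (cases "x \<in> A") simp_all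
  qed (use D in auto)
qed

text \<open>
One edge from the root to \<open>x\<close> contributes -1 to the net out-degree of \<open>x\<close>, two edges from \<open>x\<close> to the
root contribute 2, and these agree modulo 3. The exchange shifts the residue modulo 6 that \<open>x\<close> has to
realise by 3, which turns a positive one into one that is 0 or negative; \<open>x\<close> can then take in edges.
\<close>

lemma admissible_root_swap:
  assumes I: "admissible V E s t p q \<gamma>" and S: "slack V E s t p q \<gamma>"
    and x: "x \<in> V" "1 \<le> q x" and p0: "\<forall>z\<in>V. p z = 0"
    and hx: "5 \<le> load E s t p q {x}"
  shows "admissible V E s t (p(x := p x + 2)) (q(x := q x - 1)) \<gamma>"
proof -
  let ?p = "p(x := p x + 2)" and ?q = "q(x := q x - 1)"
  note D = admissibleD[OF I]
  have sp: "sum ?p A = sum p A + 2 * of_bool (x \<in> A)"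
    and sq: "sum ?q A = sum q A - of_bool (x \<in> A)" if "finite A" for A
    using sum_upd[OF that, of p x "p x + 2"] sum_upd[OF that, of q x "q x - 1"] by simp_all
  have dem: "demand ?p ?q \<gamma> A = demand p q \<gamma> A + 3 * of_bool (x \<in> A)" if "finite A" for A
    unfolding demand_alt using sp[OF that] sq[OF that] by linarith
  have load: "load E s t ?p ?q A = load E s t p q A + of_bool (x \<in> A)" if "finite A" for A
    unfolding load_alt using sp[OF that] sq[OF that] by linarith
  show ?thesis
  proof (rule admissibleI)
    have "sum p V = 0" using p0 by simp
    moreover have "0 \<le> sum q V" using D(4) by (auto intro: sum_nonneg)
    ultimately have "sum q V + 1 \<le> threshold (sum q V + 1) (3 - sum q V)"
      using threshold_root_swap[of "sum q V"] D(6) by simp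
    moreover have "sum ?p V + sum ?q V = sum q V + 1" "sum ?p V - sum ?q V = 3 - sum q V"
      using sp[OF D(1)] sq[OF D(1)] x \<open>sum p V = 0\<close> by simp_all
    ultimately show "sum ?p V + sum ?q V \<le> threshold (sum ?p V + sum ?q V) (sum ?p V - sum ?q V)" by (simp only:)
    show "\<forall>z. 0 \<le> ?p z \<and> 0 \<le> ?q z" using D(4) x by auto
  next
    fix w assume w: "w \<in> V" "{w} \<subset> V"
    have f: "finite {w}" by simp
    show "threshold (load E s t ?p ?q {w}) (demand ?p ?q \<gamma> {w}) \<le> load E s t ?p ?q {w}"
      unfolding load[OF f] dem[OF f] using D(7)[of "{w}"] w hx threshold_up[of "load E s t p q {w}" "demand p q \<gamma> {w}"]
      by (cases "w = x") auto
  next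
    fix A assume A: "A \<subset> V" "2 \<le> card A"
    then have finA: "finite A" using D(1) finite_subset by blast
    note sl = slackD[OF S A]
    have "threshold (load E s t p q A) (demand p q \<gamma> A) \<le> load E s t p q A" "5 \<le> load E s t p q A"
      using sl threshold_bounds(1)[of "load E s t p q A" "demand p q \<gamma> A"] by linarith+
    from this(1) threshold_up[OF this]
    show "threshold (load E s t ?p ?q A) (demand ?p ?q \<gamma> A) \<le> load E s t ?p ?q A"
      unfolding load[OF finA] dem[OF finA] by (cases "x \<in> A") simp_all
  qed (use D in auto)
qed

lemma demand_flip: "demand q p (\<lambda>x. - \<gamma> x) A = - demand p q \<gamma> A"
  by (simp add: demand_alt sum_negf)

lemma load_flip: "load E s t q p A = load E s t p q A"
  by (simp add: load_alt)

lemma admissible_flip: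
  assumes I: "admissible V E s t p q \<gamma>"
  shows "admissible V E s t q p (\<lambda>x. - \<gamma> x)"
proof -
  note D = admissibleD[OF I]
  have "threshold (sum q V + sum p V) (sum q V - sum p V) = threshold (sum p V + sum q V) (sum p V - sum q V)"
    using threshold_uminus[of "sum p V + sum q V" "sum p V - sum q V"] by (simp add: add.commute)
  moreover have "3 dvd sum (\<lambda>x. - \<gamma> x) V" using D(5) by (simp add: sum_negf)
  ultimately show ?thesis
    using D by (intro admissibleI) (auto simp: demand_flip load_flip threshold_uminus add.commute)
qed

lemma orientable_cong:
  assumes "orientable_mod3 V E s t \<gamma>" "\<And>x. x \<in> V \<Longrightarrow> \<gamma> x = \<gamma>' x"
  shows "orientable_mod3 V E s t \<gamma>'"
  using assms unfolding orientable_mod3_def by auto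

text \<open>
A vertex \<open>x\<close> of load 4 and demand 0 is suppressed by lifting its edges in two pairs. A set containing both
ends of exactly one new edge loses 2, which its slack covers. A set \<open>A\<close> containing all four neighbours
loses 4, but then its new load is the load of \<open>A\<close> together with \<open>x\<close>.
\<close>

lemma admissible_split4:
  assumes I: "admissible V E s t p q \<gamma>" and S: "slack V E s t p q \<gamma>"
    and x: "x \<in> V" "2 \<le> card (V - {x})" "3 dvd demand p q \<gamma> {x}" "p x = 0" "q x = 0"
    and In: "{e \<in> E. s e = x \<or> t e = x} = {e1,e2,e3,e4}" and dist: "distinct [e1,e2,e3,e4]"
    and j: "joins s t e1 x y1" "joins s t e2 x y2" "joins s t e3 x y3" "joins s t e4 x y4"
    and ny: "distinct [x,y1,y2,y3,y4]"
  shows "admissible (V - {x}) (E - {e2} - {e4}) (s(e1 := y1, e3 := y3)) (t(e1 := y2, e3 := y4)) p q \<gamma>"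
    and "orientable_mod3 (V - {x}) (E - {e2} - {e4}) (s(e1 := y1, e3 := y3)) (t(e1 := y2, e3 := y4)) \<gamma>
        \<Longrightarrow> orientable_mod3 V E s t \<gamma>"
proof -
  note D = admissibleD[OF I]
  let ?E = "E - {e2} - {e4}" and ?s = "s(e1 := y1, e3 := y3)" and ?t = "t(e1 := y2, e3 := y4)"
  have E: "e1 \<in> E" "e2 \<in> E" "e3 \<in> E" "e4 \<in> E" using In by auto
  have yV: "y1 \<in> V" "y2 \<in> V" "y3 \<in> V" "y4 \<in> V" using D(3) E j unfolding joins_def by auto
  define R where "R = E - {e2} - {e4} - {e1} - {e3}"
  have c1: "cut E s t A = cut R s t A + of_bool ((x \<in> A) \<noteq> (y1 \<in> A)) + of_bool ((x \<in> A) \<noteq> (y2 \<in> A))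
     + of_bool ((x \<in> A) \<noteq> (y3 \<in> A)) + of_bool ((x \<in> A) \<noteq> (y4 \<in> A))" for A
  proof -
    have "cut (E - {e2}) s t A = cut (E - {e2} - {e4}) s t A + of_bool ((x \<in> A) \<noteq> (y4 \<in> A))"
      by (rule cut_remove) (use D E j dist in auto)
    moreover have "cut (E - {e2} - {e4}) s t A
        = cut (E - {e2} - {e4} - {e1}) s t A + of_bool ((x \<in> A) \<noteq> (y1 \<in> A))"
      by (rule cut_remove) (use D E j dist in auto)
    moreover have "cut (E - {e2} - {e4} - {e1}) s t A = cut R s t A + of_bool ((x \<in> A) \<noteq> (y3 \<in> A))"
      unfolding R_def by (rule cut_remove) (use D E j dist in auto)
    ultimately show ?thesis using cut_remove[OF D(2) E(2) j(2), of A] by linarith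
  qed
  have cR: "cut R ?s ?t A = cut R s t A" for A
  proof -
    have "e3 \<notin> R" "e1 \<notin> R" by (auto simp: R_def)
    then show ?thesis by (simp add: cut_upd)
  qed
  have c2: "cut ?E ?s ?t A = cut R s t A + of_bool ((y1 \<in> A) \<noteq> (y2 \<in> A)) + of_bool ((y3 \<in> A) \<noteq> (y4 \<in> A))" for A
  proof -
    have "cut ?E ?s ?t A = cut (?E - {e1}) ?s ?t A + of_bool ((y1 \<in> A) \<noteq> (y2 \<in> A))"
      by (rule cut_remove) (use D E dist in \<open>auto simp: joins_def\<close>)
    moreover have "cut (?E - {e1}) ?s ?t A = cut R ?s ?t A + of_bool ((y3 \<in> A) \<noteq> (y4 \<in> A))"
      unfolding R_def by (rule cut_remove) (use D E dist in \<open>auto simp: joins_def\<close>)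
    ultimately show ?thesis using cR[of A] by linarith
  qed
  have sV: "sum f V = f x + sum f (V - {x})" for f :: "'a \<Rightarrow> int"
    using D(1) x(1) by (rule sum.remove)
  have main: "threshold (load ?E ?s ?t p q A) (demand p q \<gamma> A) \<le> load ?E ?s ?t p q A"
    if A: "A \<noteq> {}" "A \<subset> V - {x}" for A
  proof -
    have AV: "A \<subset> V" and xA: "x \<notin> A" using A by auto
    have finA: "finite A" using AV D(1) finite_subset by blast
    have B: "insert x A \<noteq> {}" "insert x A \<subset> V" using A x by auto
    have lB: "load E s t p q (insert x A) = cut E s t (insert x A) + sum p A + sum q A"
      using finA xA x by (simp add: load_alt)
    have dB: "demand p q \<gamma> (insert x A) = demand p q \<gamma> {x} + demand p q \<gamma> A"
      using finA xA by (simp add: demand_alt)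
    have loB: "threshold (load E s t p q (insert x A)) (demand p q \<gamma> A) \<le> load E s t p q (insert x A)"
    proof -
      have "threshold (load E s t p q (insert x A)) (demand p q \<gamma> (insert x A))
          = threshold (load E s t p q (insert x A)) (demand p q \<gamma> A)"
        by (rule threshold_shift) (use dB x(3) in simp)
      then show ?thesis using D(7)[OF B] by simp
    qed
    have loA: "threshold (load E s t p q A) (demand p q \<gamma> A) \<le> load E s t p q A" using D(7)[OF A(1) AV] .
    consider (all) "y1 \<in> A" "y2 \<in> A" "y3 \<in> A" "y4 \<in> A"
      | (two) "(y1 \<in> A \<and> y2 \<in> A) \<noteq> (y3 \<in> A \<and> y4 \<in> A)"
      | (none) "\<not> (y1 \<in> A \<and> y2 \<in> A)" "\<not> (y3 \<in> A \<and> y4 \<in> A)" by blast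
    then show ?thesis
    proof cases
      case all
      have "cut R s t (insert x A) = cut R s t A"
        unfolding cut_def
      proof (rule sum.cong[OF refl])
        fix e assume "e \<in> R"
        then have "s e \<noteq> x" "t e \<noteq> x" using In unfolding R_def by blast+
        then show "of_bool ((s e \<in> insert x A) \<noteq> (t e \<in> insert x A)) = (of_bool ((s e \<in> A) \<noteq> (t e \<in> A)) :: int)"
          by simp
      qed
      then have "cut ?E ?s ?t A = cut E s t (insert x A)"
        using c1[of "insert x A"] c2[of A] all by simp
      then have "load ?E ?s ?t p q A = load E s t p q (insert x A)"
        using lB load_alt[of ?E ?s ?t p q A] by linarith
      then show ?thesis using loB by simp
    next
      case two
      then have l2: "load ?E ?s ?t p q A = load E s t p q A - 2"
        unfolding load_alt using c1[of A] c2[of A] xA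
        by (cases "y1 \<in> A"; cases "y2 \<in> A"; cases "y3 \<in> A"; cases "y4 \<in> A") simp_all
      have "\<exists>u v. u \<noteq> v \<and> {u,v} \<subseteq> A" using two ny by auto
      then obtain u v where "u \<noteq> v" "{u,v} \<subseteq> A" by blast
      then have "card {u,v} \<le> card A" "card {u,v} = 2" using card_mono[OF finA, of "{u,v}"] by simp_all
      then have "2 \<le> card A" by linarith
      from threshold_down[OF slackD[OF S AV this]] show ?thesis unfolding l2 .
    next
      case none
      then have "load ?E ?s ?t p q A = load E s t p q A"
        unfolding load_alt using c1[of A] c2[of A] xA
        by (cases "y1 \<in> A"; cases "y2 \<in> A"; cases "y3 \<in> A"; cases "y4 \<in> A") simp_all
      then show ?thesis using loA by simp
    qed
  qed
  have g3: "3 dvd \<gamma> x" using x(3-5) by (simp add: demand_alt)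
  show "admissible (V - {x}) ?E ?s ?t p q \<gamma>"
  proof (rule admissibleI)
    show "\<forall>e\<in>?E. ?s e \<in> V - {x} \<and> ?t e \<in> V - {x}"
    proof
      fix e assume e: "e \<in> ?E"
      show "?s e \<in> V - {x} \<and> ?t e \<in> V - {x}"
      proof (cases "e = e1 \<or> e = e3")
        case True
        then show ?thesis using yV ny dist by auto
      next
        case False
        then have "\<not> (s e = x \<or> t e = x)" using In e by blast
        then show ?thesis using False D(3) e by auto
      qed
    qed
    show "3 dvd sum \<gamma> (V - {x})"
      using D(5) g3 sV[of \<gamma>] by (simp add: dvd_add_right_iff)
    show "sum p (V - {x}) + sum q (V - {x}) \<le> threshold (sum p (V - {x}) + sum q (V - {x})) (sum p (V - {x}) - sum q (V - {x}))"
      using D(6) sV[of p] sV[of q] x by simp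
  qed (use D main in auto)
  assume o: "orientable_mod3 (V - {x}) ?E ?s ?t \<gamma>"
  have "orientable_mod3 (V - {x}) (E - {e2}) (s(e1 := y1)) (t(e1 := y2)) \<gamma>"
  proof (rule orientable_lift[of "E - {e2}" e3 e4 _ _ x y3 y4])
    show "orientable_mod3 (V - {x}) (E - {e2} - {e4}) (s(e1 := y1, e3 := y3)) (t(e1 := y2, e3 := y4)) \<gamma>"
      by (rule o)
    show "joins (s(e1 := y1)) (t(e1 := y2)) e3 x y3" "joins (s(e1 := y1)) (t(e1 := y2)) e4 x y4"
      using j dist by (auto simp: joins_def)
  qed (use D E dist ny in auto)
  moreover have ne: "e1 \<noteq> e2" "x \<noteq> y1" "x \<noteq> y2" using dist ny by auto
  ultimately have "orientable_mod3 (V - {x}) E s t \<gamma>"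
    by (intro orientable_lift[OF D(2) E(1,2) ne(1) j(1,2) ne(2,3)])
  then show "orientable_mod3 V E s t \<gamma>"
    by (rule orientable_extend_vertex[OF D(1-3) x(1) D(5)])
qed

text \<open>
The same suppression when one of the four edges at \<open>x\<close> leads to the root. The edge from \<open>y3\<close> and the
edge to the root combine to an edge from \<open>y3\<close> to the root.
\<close>

lemma admissible_split3:
  assumes I: "admissible V E s t p q \<gamma>" and S: "slack V E s t p q \<gamma>"
    and x: "x \<in> V" "2 \<le> card (V - {x})" "3 dvd demand p q \<gamma> {x}" "p x = 1" "q x = 0"
    and In: "{e \<in> E. s e = x \<or> t e = x} = {e1,e2,e3}" and dist: "distinct [e1,e2,e3]"
    and j: "joins s t e1 x y1" "joins s t e2 x y2" "joins s t e3 x y3"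
    and ny: "distinct [x,y1,y2,y3]"
  shows "admissible (V - {x}) (E - {e2} - {e3}) (s(e1 := y1)) (t(e1 := y2)) (p(y3 := p y3 + 1)) q (\<gamma>(y3 := \<gamma> y3 - 1))"
    and "orientable_mod3 (V - {x}) (E - {e2} - {e3}) (s(e1 := y1)) (t(e1 := y2)) (\<gamma>(y3 := \<gamma> y3 - 1))
        \<Longrightarrow> orientable_mod3 V E s t \<gamma>"
proof -
  note D = admissibleD[OF I]
  let ?E = "E - {e2} - {e3}" and ?s = "s(e1 := y1)" and ?t = "t(e1 := y2)"
  let ?p = "p(y3 := p y3 + 1)" and ?g = "\<gamma>(y3 := \<gamma> y3 - 1)"
  have E: "e1 \<in> E" "e2 \<in> E" "e3 \<in> E" using In by auto
  have yV: "y1 \<in> V" "y2 \<in> V" "y3 \<in> V" using D(3) E j unfolding joins_def by auto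
  define R where "R = E - {e2} - {e3} - {e1}"
  have c1: "cut E s t A = cut R s t A + of_bool ((x \<in> A) \<noteq> (y1 \<in> A)) + of_bool ((x \<in> A) \<noteq> (y2 \<in> A))
     + of_bool ((x \<in> A) \<noteq> (y3 \<in> A))" for A
  proof -
    have "cut (E - {e2}) s t A = cut (E - {e2} - {e3}) s t A + of_bool ((x \<in> A) \<noteq> (y3 \<in> A))"
      by (rule cut_remove) (use D E j dist in auto)
    moreover have "cut (E - {e2} - {e3}) s t A = cut R s t A + of_bool ((x \<in> A) \<noteq> (y1 \<in> A))"
      unfolding R_def by (rule cut_remove) (use D E j dist in auto)
    ultimately show ?thesis using cut_remove[OF D(2) E(2) j(2), of A] by linarith
  qed
  have cR: "cut R ?s ?t A = cut R s t A" for A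
    by (rule cut_upd) (simp add: R_def)
  have c2: "cut ?E ?s ?t A = cut R s t A + of_bool ((y1 \<in> A) \<noteq> (y2 \<in> A))" for A
  proof -
    have "cut ?E ?s ?t A = cut R ?s ?t A + of_bool ((y1 \<in> A) \<noteq> (y2 \<in> A))"
      unfolding R_def by (rule cut_remove) (use D E dist in \<open>auto simp: joins_def\<close>)
    then show ?thesis using cR[of A] by linarith
  qed
  have sV: "sum f V = f x + sum f (V - {x})" for f :: "'a \<Rightarrow> int"
    using D(1) x(1) by (rule sum.remove)
  have sp: "sum ?p A = sum p A + of_bool (y3 \<in> A)" and sg: "sum ?g A = sum \<gamma> A - of_bool (y3 \<in> A)"
    if "finite A" for A
    using sum_upd[OF that, of p y3 "p y3 + 1"] sum_upd[OF that, of \<gamma> y3 "\<gamma> y3 - 1"] by simp_all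
  have main: "threshold (load ?E ?s ?t ?p q A) (demand ?p q ?g A) \<le> load ?E ?s ?t ?p q A"
    if A: "A \<noteq> {}" "A \<subset> V - {x}" for A
  proof -
    have AV: "A \<subset> V" and xA: "x \<notin> A" using A by auto
    have finA: "finite A" using AV D(1) finite_subset by blast
    have dem: "demand ?p q ?g A = demand p q \<gamma> A"
      unfolding demand_alt using sp[OF finA] sg[OF finA] by linarith
    show ?thesis
    proof (cases "y1 \<in> A \<and> y2 \<in> A")
      case True
      then have l2: "load ?E ?s ?t ?p q A = load E s t p q A - 2"
        unfolding load_alt using c1[of A] c2[of A] xA sp[OF finA] by simp
      have "card {y1,y2} \<le> card A" "card {y1,y2} = 2"
        using card_mono[OF finA, of "{y1,y2}"] True ny by simp_all
      then have "2 \<le> card A" by linarith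
      from threshold_down[OF slackD[OF S AV this]] show ?thesis unfolding l2 dem .
    next
      case False
      then have "load ?E ?s ?t ?p q A = load E s t p q A"
        unfolding load_alt using c1[of A] c2[of A] xA sp[OF finA]
        by (cases "y1 \<in> A"; cases "y2 \<in> A") simp_all
      then show ?thesis using D(7)[OF A(1) AV] dem by simp
    qed
  qed
  have g3: "3 dvd \<gamma> x + 1" using x(3-5) by (simp add: demand_alt)
  have y3: "y3 \<in> V - {x}" using yV ny by auto
  have finV: "finite (V - {x})" using D(1) by simp
  show "admissible (V - {x}) ?E ?s ?t ?p q ?g"
  proof (rule admissibleI)
    show "\<forall>e\<in>?E. ?s e \<in> V - {x} \<and> ?t e \<in> V - {x}"
    proof
      fix e assume e: "e \<in> ?E"
      show "?s e \<in> V - {x} \<and> ?t e \<in> V - {x}"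
      proof (cases "e = e1")
        case True
        then show ?thesis using yV ny by auto
      next
        case False
        then have "\<not> (s e = x \<or> t e = x)" using In e by blast
        then show ?thesis using False D(3) e by auto
      qed
    qed
    have "sum \<gamma> V = (\<gamma> x + 1) + sum ?g (V - {x})" using sV[of \<gamma>] sg[OF finV] y3 by simp
    then show "3 dvd sum ?g (V - {x})" using D(5) g3 by (simp only: dvd_add_right_iff)
    have "sum ?p (V - {x}) = sum p V" "sum q (V - {x}) = sum q V"
      using sV[of p] sV[of q] x sp[OF finV] y3 by simp_all
    then show "sum ?p (V - {x}) + sum q (V - {x}) \<le> threshold (sum ?p (V - {x}) + sum q (V - {x})) (sum ?p (V - {x}) - sum q (V - {x}))"
      using D(6) by (simp only:)
    show "\<forall>z. 0 \<le> ?p z \<and> 0 \<le> q z" using D(4) by (auto intro: add_nonneg_nonneg)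
    fix z assume "z \<in> V - {x}" "{z} \<subset> V - {x}"
    then show "threshold (load ?E ?s ?t ?p q {z}) (demand ?p q ?g {z}) \<le> load ?E ?s ?t ?p q {z}"
      by (intro main) auto
  next
    fix A assume A: "A \<subset> V - {x}" "2 \<le> card A"
    then have "A \<noteq> {}" by auto
    then show "threshold (load ?E ?s ?t ?p q A) (demand ?p q ?g A) \<le> load ?E ?s ?t ?p q A"
      using A(1) by (rule main)
  qed (use D in auto)
  assume o: "orientable_mod3 (V - {x}) ?E ?s ?t ?g"
  have "orientable_mod3 (V - {x}) (E - {e2}) ?s ?t \<gamma>"
  proof (rule orientable_delete[of "E - {e2}" e3 _ _ y3 x])
    show "joins ?s ?t e3 y3 x" using j dist by (auto simp: joins_def)
    show "orientable_mod3 (V - {x}) ?E ?s ?t (\<gamma>(y3 := \<gamma> y3 - 1, x := \<gamma> x + 1))"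
      using o by (rule orientable_cong) (use ny in auto)
  qed (use D E dist ny in auto)
  moreover have ne: "e1 \<noteq> e2" "x \<noteq> y1" "x \<noteq> y2" using dist ny by auto
  ultimately have "orientable_mod3 (V - {x}) E s t \<gamma>"
    by (intro orientable_lift[OF D(2) E(1,2) ne(1) j(1,2) ne(2,3)])
  then show "orientable_mod3 V E s t \<gamma>"
    by (rule orientable_extend_vertex[OF D(1-3) x(1) D(5)])
qed

section \<open>Minimal counterexamples\<close>

text \<open>
The number of vertices comes first, then the number of edges including those at the root. An exchange
by \<open>admissible_root_swap\<close> increases the latter, but the two deletions that it makes possible
more than compensate for that.
\<close>

locale minimal_counterexample =
  fixes V :: "'v set" and E :: "'e set" and s t p q \<gamma>
  assumes I: "admissible V E s t p q \<gamma>"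
    and no: "\<not> orientable_mod3 V E s t \<gamma>"
    and IH: "solves_below (card V) TYPE('v) TYPE('e)"
    and card3: "3 \<le> card V"
    and min: "\<And>(E' :: 'e set) s' t' p' q' \<gamma>'. admissible V E' s' t' p' q' \<gamma>' \<Longrightarrow>
        int (card E') + sum p' V + sum q' V < int (card E) + sum p V + sum q V \<Longrightarrow>
        orientable_mod3 V E' s' t' \<gamma>'"
begin

abbreviation L where "L x \<equiv> load E s t p q {x}"
abbreviation dm where "dm x \<equiv> demand p q \<gamma> {x}"

text \<open>
A vertex that gives out survives the deletion of an edge directed out of it, and one that takes in
survives the deletion of an edge directed into it.
\<close>

definition gives_out where "gives_out x \<longleftrightarrow> threshold (L x - 1) (dm x - 1) \<le> L x - 1"
definition takes_in where "takes_in x \<longleftrightarrow> threshold (L x - 1) (dm x + 1) \<le> L x - 1"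

lemmas D = admissibleD[OF I]

lemma slack: "slack V E s t p q \<gamma>"
  by (rule slack_of_not_orientable[OF I IH no])

lemma card_del: "e \<in> E \<Longrightarrow> int (card (E - {e})) = int (card E) - 1"
  using card_Suc_Diff1[OF D(2), of e] by linarith

lemma singleton_psubset: "x \<in> V \<Longrightarrow> {x} \<subset> V"
  using card3 by auto

lemma no_loop: "e \<in> E \<Longrightarrow> s e \<noteq> t e"
proof
  assume e: "e \<in> E" "s e = t e"
  have "orientable_mod3 V (E - {e}) s t \<gamma>"
    by (rule min[OF admissible_loop[OF I e]]) (use card_del e in simp)
  then show False using orientable_loop[of E e s t V \<gamma>] D(2) e no by blast
qed

lemma no_parallel: "e \<in> E \<Longrightarrow> f \<in> E \<Longrightarrow> joins s t e x y \<Longrightarrow> joins s t f x y \<Longrightarrow> e = f"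
proof (rule ccontr)
  assume a: "e \<in> E" "f \<in> E" "joins s t e x y" "joins s t f x y" "e \<noteq> f"
  have "x \<noteq> y" using no_loop[OF a(1)] a(3) by (auto simp: joins_def)
  moreover have "2 < card V" using card3 by simp
  ultimately show False using orientable_of_parallel[OF I IH _ a(1,2,5,3,4)] no by blast
qed

definition star where "star x = {e \<in> E. s e = x \<or> t e = x}"

lemma star_joins: "e \<in> star x \<Longrightarrow> \<exists>y. joins s t e x y \<and> x \<noteq> y \<and> y \<in> V"
  using no_loop[of e] D(3) unfolding star_def joins_def by auto

lemma cut_single: "cut E s t {x} = int (card (star x))"
proof -
  have "((s e \<in> {x}) \<noteq> (t e \<in> {x})) = (s e = x \<or> t e = x)" if "e \<in> E" for e
    using no_loop[OF that] by auto
  then have "{e \<in> E. (s e \<in> {x}) \<noteq> (t e \<in> {x})} = star x" unfolding star_def by blast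
  then show ?thesis unfolding cut_eq_card[OF D(2)] by simp
qed

text \<open>
The net out-degrees of \<open>A\<close> and of its complement add up to what enters the root, so that the upper
bound at the root can be compared with the two lower bounds.
\<close>

lemma root_bound:
  assumes "A \<noteq> {}" "A \<subset> V"
  shows "sum p V + sum q V + 4 \<le> threshold (load E s t p q A) (demand p q \<gamma> A)
      + threshold (load E s t p q (V - A)) (demand p q \<gamma> (V - A))"
proof -
  have sV: "sum f V = sum f A + sum f (V - A)" for f :: "'v \<Rightarrow> int"
    using sum.subset_diff[of A V f] assms(2) D(1) by (simp add: add.commute)
  have "threshold (sum p V + sum q V) (sum p V - sum q V) =
      threshold (load E s t p q A + load E s t p q (V - A)) (demand p q \<gamma> A + demand p q \<gamma> (V - A))"
  proof (rule threshold_cong)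
    have "sum p V + sum q V - (load E s t p q A + load E s t p q (V - A)) = - 2 * cut E s t A"
      unfolding load_alt cut_compl[OF D(3)] using sV[of p] sV[of q] by simp
    then show "even (sum p V + sum q V - (load E s t p q A + load E s t p q (V - A)))" by simp
    have "sum p V - sum q V - (demand p q \<gamma> A + demand p q \<gamma> (V - A)) = - sum \<gamma> V"
      unfolding demand_alt using sV[of p] sV[of q] sV[of \<gamma>] by simp
    then show "3 dvd sum p V - sum q V - (demand p q \<gamma> A + demand p q \<gamma> (V - A))"
      using D(5) by (simp only: dvd_minus_iff)
  qed
  then show ?thesis
    using D(6) threshold_subadditive[of "load E s t p q A" "load E s t p q (V - A)" "demand p q \<gamma> A" "demand p q \<gamma> (V - A)"]
    by linarith
qed

lemma load_compl_single:
  assumes "x \<in> V"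
  shows "load E s t p q (V - {x}) = L x + (sum p V + sum q V) - 2 * (p x + q x)"
proof -
  have sV: "sum f V = f x + sum f (V - {x})" for f :: "'v \<Rightarrow> int"
    using D(1) assms by (rule sum.remove)
  show ?thesis unfolding load_alt cut_compl[OF D(3)] using sV[of p] sV[of q] by simp
qed

text \<open>
If too many of the edges at \<open>x\<close> led to the root, the load of \<open>V - {x}\<close> would be too small.
\<close>

lemma degree_ge3:
  assumes "x \<in> V"
  shows "3 \<le> card (star x)"
proof -
  have c: "2 \<le> card (V - {x})" using assms card3 D(1) by simp
  have ps: "V - {x} \<subset> V" using assms by auto
  note rb = root_bound[OF _ singleton_psubset[OF assms]]
  have "threshold (load E s t p q (V - {x})) (demand p q \<gamma> (V - {x})) + 2 \<le> load E s t p q (V - {x})"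
    by (rule slackD[OF slack ps c])
  moreover have "threshold (L x) (dm x) \<le> L x" using D(7) singleton_psubset[OF assms] by simp
  ultimately have "3 \<le> L x - (p x + q x)"
    using rb load_compl_single[OF assms] by simp
  then have "3 \<le> cut E s t {x}" by (simp add: load_alt)
  then show ?thesis unfolding cut_single by simp
qed

lemma finite_star: "finite (star x)" using D(2) by (simp add: star_def)

lemma no_lift:
  assumes "x \<in> V" "threshold (L x) (dm x) + 2 \<le> L x" "e \<in> star x" "f \<in> star x" "e \<noteq> f"
  shows False
proof -
  obtain y where y: "joins s t e x y" "x \<noteq> y" using star_joins assms by blast
  obtain z where z: "joins s t f x z" "x \<noteq> z" using star_joins assms by blast
  have ef: "e \<in> E" "f \<in> E" using assms by (auto simp: star_def)
  have yz: "y \<noteq> z" using no_parallel[OF ef y(1)] z(1) assms(5) by blast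
  have "orientable_mod3 V (E - {f}) (s(e := y)) (t(e := z)) \<gamma>"
    by (rule min[OF admissible_lift[OF I slack ef assms(5) y(1) z(1) y(2) z(2) yz assms(2)]])
      (use card_del ef in simp)
  then show False using orientable_lift[OF D(2) ef assms(5) y(1) z(1) y(2) z(2)] no by blast
qed

lemma tight:
  assumes "x \<in> V"
  shows "L x = threshold (L x) (dm x)"
proof (rule ccontr)
  assume "L x \<noteq> threshold (L x) (dm x)"
  moreover have "threshold (L x) (dm x) \<le> L x" using D(7) singleton_psubset[OF assms] by simp
  ultimately have nt: "threshold (L x) (dm x) + 2 \<le> L x" by (intro threshold_gap)
  have "\<not> (\<forall>e\<in>star x. \<forall>f\<in>star x. e = f)"
    using degree_ge3[OF assms] card_le_Suc0_iff_eq[OF finite_star, of x] by auto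
  then show False using no_lift[OF assms nt] by blast
qed

lemma no_opposite_edge:
  assumes "e \<in> E" "joins s t e x y" "gives_out x" "takes_in y"
  shows False
proof -
  have ne: "x \<noteq> y" using no_loop[OF assms(1)] assms(2) by (auto simp: joins_def)
  have "orientable_mod3 V (E - {e}) s t (\<gamma>(x := \<gamma> x - 1, y := \<gamma> y + 1))"
    by (rule min[OF admissible_delete[OF I slack assms(1,2) ne]])
      (use assms(3,4) card_del[OF assms(1)] in \<open>auto simp: gives_out_def takes_in_def\<close>)
  then show False using orientable_delete[OF D(2) assms(1,2) ne] no by blast
qed

lemma distinct_neighbours:
  assumes "e \<in> star x" "f \<in> star x" "e \<noteq> f" "joins s t e x y" "joins s t f x z"
  shows "y \<noteq> z"
  using no_parallel[of e f x y] assms unfolding star_def by auto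

lemma no_load4_aux:
  assumes x: "x \<in> V" "L x = 4" "q x = 0"
  shows False
proof -
  have d3: "3 dvd dm x" using tight[OF x(1)] x(2) unfolding threshold_def by (auto split: if_splits)
  have c2: "2 \<le> card (V - {x})" using x card3 D(1) by simp
  have cV: "card (V - {x}) < card V" using x(1) D(1) by (intro psubset_card_mono) auto
  have "4 = int (card (star x)) + p x" using x cut_single[of x] by (simp add: load_alt)
  moreover have "3 \<le> card (star x)" by (rule degree_ge3[OF x(1)])
  moreover have "0 \<le> p x" using D(4) by blast
  ultimately have "p x = 0 \<and> card (star x) = 4 \<or> p x = 1 \<and> card (star x) = 3"
    by (cases "p x = 0") linarith+
  then consider (four) "card (star x) = 4" "p x = 0" | (three) "card (star x) = 3" "p x = 1" by blast
  then show False
  proof cases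
    case four
    obtain xs where xs: "set xs = star x" "distinct xs" using finite_distinct_list[OF finite_star] by blast
    then have "length xs = 4" using four distinct_card by fastforce
    then obtain e1 e2 e3 e4 where l: "xs = [e1,e2,e3,e4]" by (auto simp: length_Suc_conv numeral_eq_Suc)
    have star: "star x = {e1,e2,e3,e4}" using xs l by auto
    then have in_star: "e1 \<in> star x" "e2 \<in> star x" "e3 \<in> star x" "e4 \<in> star x" by auto
    obtain y1 where y1: "joins s t e1 x y1" "x \<noteq> y1" using star_joins in_star by blast
    obtain y2 where y2: "joins s t e2 x y2" "x \<noteq> y2" using star_joins in_star by blast
    obtain y3 where y3: "joins s t e3 x y3" "x \<noteq> y3" using star_joins in_star by blast
    obtain y4 where y4: "joins s t e4 x y4" "x \<noteq> y4" using star_joins in_star by blast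
    have dist: "distinct [e1,e2,e3,e4]" using xs l by simp
    have ny: "distinct [x,y1,y2,y3,y4]"
      using distinct_neighbours in_star dist y1 y2 y3 y4 by (simp; blast)
    note spl = admissible_split4[OF I slack x(1) c2 d3 four(2) x(3) star[unfolded star_def] dist y1(1) y2(1) y3(1) y4(1) ny]
    show False using spl(2)[OF solves_belowD[OF IH spl(1) c2 cV]] no by blast
  next
    case three
    obtain xs where xs: "set xs = star x" "distinct xs" using finite_distinct_list[OF finite_star] by blast
    then have "length xs = 3" using three distinct_card by fastforce
    then obtain e1 e2 e3 where l: "xs = [e1,e2,e3]" by (auto simp: length_Suc_conv numeral_eq_Suc)
    have star: "star x = {e1,e2,e3}" using xs l by auto
    then have in_star: "e1 \<in> star x" "e2 \<in> star x" "e3 \<in> star x" by auto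
    obtain y1 where y1: "joins s t e1 x y1" "x \<noteq> y1" using star_joins in_star by blast
    obtain y2 where y2: "joins s t e2 x y2" "x \<noteq> y2" using star_joins in_star by blast
    obtain y3 where y3: "joins s t e3 x y3" "x \<noteq> y3" using star_joins in_star by blast
    have dist: "distinct [e1,e2,e3]" using xs l by simp
    have ny: "distinct [x,y1,y2,y3]"
      using distinct_neighbours in_star dist y1 y2 y3 by (simp; blast)
    note spl = admissible_split3[OF I slack x(1) c2 d3 three(2) x(3) star[unfolded star_def] dist y1(1) y2(1) y3(1) ny]
    show False using spl(2)[OF solves_belowD[OF IH spl(1) c2 cV]] no by blast
  qed
qed

lemma not_orientable_flip: "\<not> orientable_mod3 V E s t (\<lambda>x. - \<gamma> x)"
  using orientable_uminus no by blast

lemma flip: "minimal_counterexample V E s t q p (\<lambda>x. - \<gamma> x)"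
proof
  fix E' :: "'e set" and s' t' p' q' \<gamma>'
  assume "admissible V E' s' t' p' q' \<gamma>'"
    "int (card E') + sum p' V + sum q' V < int (card E) + sum q V + sum p V"
  then show "orientable_mod3 V E' s' t' \<gamma>'" using min by simp
qed (use admissible_flip[OF I] not_orientable_flip IH card3 in auto)

lemma no_load4:
  assumes "x \<in> V"
  shows "L x \<noteq> 4"
proof
  assume L4: "L x = 4"
  have c: "3 \<le> card (star x)" by (rule degree_ge3[OF assms])
  have "4 = int (card (star x)) + p x + q x" using L4 cut_single[of x] by (simp add: load_alt)
  then have "p x = 0 \<or> q x = 0" using c D(4)[rule_format, of x] by linarith
  then show False
  proof
    assume "q x = 0"
    then show False using no_load4_aux assms L4 by blast
  next
    assume "p x = 0"
    then show False using minimal_counterexample.no_load4_aux[OF flip assms] L4 by (simp add: load_flip)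
  qed
qed

text \<open>
All edges at the root then point away from it. If there are none, the complement of a vertex is tight.
Otherwise an edge from the root to \<open>x\<close> is exchanged for two edges in the opposite direction,
after which \<open>x\<close> can take in two edges from neighbours that give out.
\<close>

lemma not_all_give_out:
  assumes out: "\<And>x. x \<in> V \<Longrightarrow> gives_out x"
  shows False
proof -
  have p0: "p x = 0" if x: "x \<in> V" for x
  proof (rule ccontr)
    assume "p x \<noteq> 0"
    then have px: "1 \<le> p x" using D(4)[rule_format, of x] by linarith
    have "sum (p(x := p x - 1)) V = sum p V - 1" using sum_upd[OF D(1), of p x "p x - 1"] x by simp
    then have "orientable_mod3 V E s t \<gamma>"
      by (intro min[OF admissible_root_decrease[OF I slack x px out[OF x, unfolded gives_out_def]]]) simp
    then show False using no by blast
  qed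
  have "\<exists>x\<in>V. 1 \<le> q x"
  proof (rule ccontr)
    assume "\<not> ?thesis"
    then have q0: "q x = 0" if "x \<in> V" for x using D(4)[rule_format, of x] that by force
    obtain x where x: "x \<in> V" using card3 by fastforce
    have c: "2 \<le> card (V - {x})" using x card3 D(1) by simp
    have ps: "V - {x} \<subset> V" using x by auto
    have l: "load E s t p q (V - {x}) = L x" using load_compl_single[OF x] p0 q0 x by simp
    have "sum \<gamma> V = \<gamma> x + sum \<gamma> (V - {x})" using D(1) x by (rule sum.remove)
    then have "demand p q \<gamma> (V - {x}) - (- dm x) = sum \<gamma> V"
      using p0 q0 x by (simp add: demand_alt)
    then have "threshold (L x) (demand p q \<gamma> (V - {x})) = threshold (L x) (dm x)"
      using threshold_shift[of "demand p q \<gamma> (V - {x})" "- dm x" "L x"] D(5) by (simp add: threshold_uminus)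
    then show False using slackD[OF slack ps c] l tight[OF x] by simp
  qed
  then obtain x where x: "x \<in> V" "1 \<le> q x" by blast
  have L5: "5 \<le> L x"
    using tight[OF x(1)] no_load4[OF x(1)] threshold_bounds(1)[of "L x" "dm x"] by linarith
  \<comment> \<open>now the load of \<open>x\<close> is one larger, and two edges can be directed into \<open>x\<close> and deleted\<close>
  let ?p = "p(x := p x + 2)" and ?q = "q(x := q x - 1)"
  have I1: "admissible V E s t ?p ?q \<gamma>"
    using admissible_root_swap[OF I slack x _ L5] p0 by blast
  have S1: "slack V E s t ?p ?q \<gamma>" by (rule slack_of_not_orientable[OF I1 IH no])
  have "\<not> (\<forall>e\<in>star x. \<forall>f\<in>star x. e = f)"
    using degree_ge3[OF x(1)] card_le_Suc0_iff_eq[OF finite_star, of x] by auto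
  then obtain e f where ef: "e \<in> star x" "f \<in> star x" "e \<noteq> f" by blast
  then have efE: "e \<in> E" "f \<in> E - {e}" "f \<in> E" by (auto simp: star_def)
  obtain y where y: "joins s t e x y" "x \<noteq> y" "y \<in> V" using star_joins ef by blast
  obtain z where z: "joins s t f x z" "x \<noteq> z" "z \<in> V" using star_joins ef by blast
  have yz: "y \<noteq> z" by (rule distinct_neighbours[OF ef y(1) z(1)])
  have jy: "joins s t e y x" and jz: "joins s t f z x" using y z by (auto simp: joins_def)
  let ?g1 = "\<gamma>(y := \<gamma> y - 1, x := \<gamma> x + 1)"
  let ?g2 = "?g1(z := ?g1 z - 1, x := ?g1 x + 1)"
  \<comment> \<open>these are the residues 1, 2 and 3 modulo 6 of a tight vertex\<close>
  have val: "L x = 5 \<and> dm x mod 3 = 1 \<or> L x = 6 \<and> dm x mod 3 = 2 \<or> L x = 7 \<and> dm x mod 3 = 0"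
    using tight[OF x(1)] no_load4[OF x(1)] out[OF x(1)] unfolding gives_out_def threshold_def
    by (simp split: if_splits) presburger+
  have l1x: "load E s t ?p ?q {x} = L x + 1" "demand ?p ?q \<gamma> {x} = dm x + 3"
    by (simp_all add: load_alt demand_alt)
  have l1: "load E s t ?p ?q {w} = L w" "demand ?p ?q \<gamma> {w} = dm w" if "w \<noteq> x" for w
    using that by (simp_all add: load_alt demand_alt)
  have I2: "admissible V (E - {e}) s t ?p ?q ?g1"
  proof (rule admissible_delete[OF I1 S1 efE(1) jy y(2)[symmetric]])
    show "threshold (load E s t ?p ?q {y} - 1) (demand ?p ?q \<gamma> {y} - 1) \<le> load E s t ?p ?q {y} - 1"
      using out[OF y(3)] l1[of y] y(2) unfolding gives_out_def by simp
    show "threshold (load E s t ?p ?q {x} - 1) (demand ?p ?q \<gamma> {x} + 1) \<le> load E s t ?p ?q {x} - 1"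
      unfolding l1x using val unfolding threshold_def by (simp; presburger)
  qed
  have no2: "\<not> orientable_mod3 V (E - {e}) s t ?g1"
    using orientable_delete[OF D(2) efE(1) jy y(2)[symmetric]] no by blast
  have S2: "slack V (E - {e}) s t ?p ?q ?g1" by (rule slack_of_not_orientable[OF I2 IH no2])
  have cE: "cut (E - {e}) s t A = cut E s t A - of_bool ((x \<in> A) \<noteq> (y \<in> A))" for A
    using cut_remove[OF D(2) efE(1) y(1), of A] by simp
  have l2x: "load (E - {e}) s t ?p ?q {x} = L x" "demand ?p ?q ?g1 {x} = dm x + 4"
    using y(2) cE[of "{x}"] by (simp_all add: load_alt demand_alt)
  have l2z: "load (E - {e}) s t ?p ?q {z} = L z" "demand ?p ?q ?g1 {z} = dm z"
    using z(2) yz cE[of "{z}"] by (simp_all add: load_alt demand_alt)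
  have I3: "admissible V (E - {e} - {f}) s t ?p ?q ?g2"
  proof (rule admissible_delete[OF I2 S2 efE(2) jz z(2)[symmetric]])
    show "threshold (load (E - {e}) s t ?p ?q {z} - 1) (demand ?p ?q ?g1 {z} - 1) \<le> load (E - {e}) s t ?p ?q {z} - 1"
      using out[OF z(3)] unfolding l2z gives_out_def .
    show "threshold (load (E - {e}) s t ?p ?q {x} - 1) (demand ?p ?q ?g1 {x} + 1) \<le> load (E - {e}) s t ?p ?q {x} - 1"
      unfolding l2x using val unfolding threshold_def by (simp; presburger)
  qed
  have "int (card (E - {e} - {f})) = int (card E) - 2"
    using card_del[OF efE(1)] card_Suc_Diff1[of "E - {e}" f] D(2) efE(2) by simp
  moreover have "sum ?p V = sum p V + 2" "sum ?q V = sum q V - 1"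
    using sum_upd[OF D(1), of p x "p x + 2"] sum_upd[OF D(1), of q x "q x - 1"] x(1) by simp_all
  ultimately have "orientable_mod3 V (E - {e} - {f}) s t ?g2"
    by (intro min[OF I3]) simp
  then have "orientable_mod3 V (E - {e}) s t ?g1"
    by (intro orientable_delete[OF _ efE(2) jz z(2)[symmetric]]) (use D(2) in simp)
  then show False using no2 by blast
qed

lemma gives_or_takes:
  assumes "x \<in> V"
  shows "gives_out x \<or> takes_in x"
  using tight[OF assms] no_load4[OF assms] unfolding gives_out_def takes_in_def threshold_def
  by (simp split: if_splits) presburger+

text \<open>
No edge joins the vertices that give out to the others, since such an edge could be deleted. If both
kinds occur, the root alone connects them and has too large a degree. The remaining cases are
mirror images of each other under reversal of all edges.
\<close>

lemma contradiction: False
proof -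
  define A where "A = {x \<in> V. gives_out x}"
  have AV: "A \<subseteq> V" by (auto simp: A_def)
  have in_B: "takes_in x" if "x \<in> V" "x \<notin> A" for x
    using gives_or_takes that by (auto simp: A_def)
  show False
  proof (cases "A = V \<or> A = {}")
    case True
    then show False
    proof
      assume "A = V"
      then show False using not_all_give_out by (auto simp: A_def)
    next
      assume "A = {}"
      then have "takes_in x" if "x \<in> V" for x using in_B that by blast
      then have "minimal_counterexample.gives_out E s t q p (\<lambda>x. - \<gamma> x) x" if "x \<in> V" for x
        using that threshold_uminus[of "L x - 1" "dm x + 1"]
        unfolding minimal_counterexample.gives_out_def[OF flip] takes_in_def
        by (simp add: load_flip demand_flip)
      then show False by (rule minimal_counterexample.not_all_give_out[OF flip])
    qed
  next
    case False
    then have A: "A \<noteq> {}" "A \<subset> V" using AV by auto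
    have "(s e \<in> A) = (t e \<in> A)" if e: "e \<in> E" for e
    proof (rule ccontr)
      assume a: "(s e \<in> A) \<noteq> (t e \<in> A)"
      have V: "s e \<in> V" "t e \<in> V" using D(3) e by auto
      show False
      proof (cases "s e \<in> A")
        case True
        then show False using a V in_B no_opposite_edge[OF e, of "s e" "t e"] by (auto simp: joins_def A_def)
      next
        case False
        then show False using a V in_B no_opposite_edge[OF e, of "t e" "s e"] by (auto simp: joins_def A_def)
      qed
    qed
    then have "cut E s t A = 0" unfolding cut_def by (intro sum.neutral) auto
    moreover have "sum f V = sum f A + sum f (V - A)" for f :: "'v \<Rightarrow> int"
      using sum.subset_diff[of A V f] AV D(1) by (simp add: add.commute)
    ultimately have "load E s t p q A + load E s t p q (V - A) = sum p V + sum q V"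
      unfolding load_alt cut_compl[OF D(3)] by simp
    moreover have "V - A \<noteq> {}" "V - A \<subset> V" using A by auto
    ultimately show False using root_bound[OF A] D(7)[OF A] D(7)[of "V - A"] by simp
  qed
qed

end

theorem orientable_of_admissible:
  fixes V :: "'v set" and E :: "'e set"
  assumes "admissible V E s t p q \<gamma>" "2 \<le> card V"
  shows "orientable_mod3 V E s t \<gamma>"
  using assms
proof (induction "card V" arbitrary: V E s t p q \<gamma> rule: less_induct)
  case less
  have finV: "finite V" using admissibleD(1)[OF less.prems(1)] .
  have IH: "solves_below (card V) TYPE('v) TYPE('e)"
    unfolding solves_below_def using less.hyps by blast
  show ?case
  proof (cases "card V = 2")
    case True
    then obtain x y where "V = {x,y}" "x \<noteq> y" by (auto simp: card_2_iff)
    then show ?thesis by (rule orientable_of_two_vertices[OF less.prems(1)])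
  next
    case False
    then have card3: "3 \<le> card V" using less.prems(2) by simp
    define bad where "bad k \<longleftrightarrow> (\<exists>(E' :: 'e set) s' t' p' q' \<gamma>'. admissible V E' s' t' p' q' \<gamma>' \<and>
      \<not> orientable_mod3 V E' s' t' \<gamma>' \<and> int k = int (card E') + sum p' V + sum q' V)" for k
    show ?thesis
    proof (rule ccontr)
      assume no: "\<not> orientable_mod3 V E s t \<gamma>"
      have bad_of: "bad (nat (int (card E') + sum p' V + sum q' V))"
        if "admissible V E' s' t' p' q' \<gamma>'" "\<not> orientable_mod3 V E' s' t' \<gamma>'"
        for E' :: "'e set" and s' t' p' q' \<gamma>'
      proof -
        have "0 \<le> sum p' V" "0 \<le> sum q' V" using admissibleD(4)[OF that(1)] by (auto intro: sum_nonneg)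
        then have "int (nat (int (card E') + sum p' V + sum q' V)) = int (card E') + sum p' V + sum q' V"
          by simp
        then show ?thesis unfolding bad_def using that by blast
      qed
      have "bad (LEAST k. bad k)" using LeastI bad_of[OF less.prems(1) no] by metis
      then obtain E0 :: "'e set" and s0 t0 p0 q0 \<gamma>0 where m: "admissible V E0 s0 t0 p0 q0 \<gamma>0"
        "\<not> orientable_mod3 V E0 s0 t0 \<gamma>0"
        "int (LEAST k. bad k) = int (card E0) + sum p0 V + sum q0 V" unfolding bad_def by blast
      have "minimal_counterexample V E0 s0 t0 p0 q0 \<gamma>0"
      proof
        fix E' :: "'e set" and s' t' p' q' \<gamma>'
        assume a: "admissible V E' s' t' p' q' \<gamma>'"
          "int (card E') + sum p' V + sum q' V < int (card E0) + sum p0 V + sum q0 V"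
        show "orientable_mod3 V E' s' t' \<gamma>'"
        proof (rule ccontr)
          assume "\<not> orientable_mod3 V E' s' t' \<gamma>'"
          then have "bad (nat (int (card E') + sum p' V + sum q' V))" by (rule bad_of[OF a(1)])
          then have "(LEAST k. bad k) \<le> nat (int (card E') + sum p' V + sum q' V)" by (rule Least_le)
          moreover have "0 \<le> sum p' V" "0 \<le> sum q' V" using admissibleD(4)[OF a(1)] by (auto intro: sum_nonneg)
          ultimately show False using a(2) m(3) by linarith
        qed
      qed (use m IH card3 in auto)
      then show False by (rule minimal_counterexample.contradiction)
    qed
  qed
qed

corollary orientable_of_six_edge_connected:
  fixes V :: "'v set" and E :: "'e set"
  assumes fin: "finite V" "finite E" and ends: "\<forall>e\<in>E. s e \<in> V \<and> t e \<in> V"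
    and z: "3 dvd sum \<gamma> V" and two: "2 \<le> card V"
    and cuts: "\<And>A. A \<noteq> {} \<Longrightarrow> A \<subset> V \<Longrightarrow> 6 \<le> cut E s t A"
  shows "orientable_mod3 V E s t \<gamma>"
proof (rule orientable_of_admissible[OF _ two])
  have "threshold (load E s t (\<lambda>_. 0) (\<lambda>_. 0) A) g \<le> load E s t (\<lambda>_. 0) (\<lambda>_. 0) A"
    if "A \<noteq> {}" "A \<subset> V" for A g
  proof -
    have "load E s t (\<lambda>_. 0) (\<lambda>_. 0) A = cut E s t A" by (simp add: load_alt)
    moreover have "threshold d g \<le> d" if "6 \<le> d" for d using that unfolding threshold_def by presburger
    ultimately show ?thesis using cuts[OF that] by simp
  qed
  then show "admissible V E s t (\<lambda>_. 0) (\<lambda>_. 0) \<gamma>"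
    using fin ends z by (intro admissibleI) (auto simp: threshold_def)
qed

section \<open>Partitions and the trimming of hyperedges\<close>

text \<open>
Partitions of \<open>W\<close> are represented by colourings, with the colour classes as parts. The function
\<open>meet f g\<close> below is their coarsest common refinement.
\<close>

definition crosses :: "('v \<Rightarrow> nat) \<Rightarrow> 'v set \<Rightarrow> bool" where
  "crosses c N \<longleftrightarrow> (\<exists>x\<in>N. \<exists>y\<in>N. c x \<noteq> c y)"

definition meet :: "('v \<Rightarrow> nat) \<Rightarrow> ('v \<Rightarrow> nat) \<Rightarrow> 'v \<Rightarrow> nat" where
  "meet f g x = prod_encode (f x, g x)"

definition coarser_on :: "'v set \<Rightarrow> ('v \<Rightarrow> nat) \<Rightarrow> ('v \<Rightarrow> nat) \<Rightarrow> bool" where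
  "coarser_on W j f \<longleftrightarrow> (\<forall>x\<in>W. \<forall>y\<in>W. f x = f y \<longrightarrow> j x = j y)"

lemma coarser_onD: "coarser_on W j f \<Longrightarrow> x \<in> W \<Longrightarrow> y \<in> W \<Longrightarrow> f x = f y \<Longrightarrow> j x = j y"
  unfolding coarser_on_def by blast

lemma meet_eq: "(meet f g x = meet f g y) = (f x = f y \<and> g x = g y)"
  by (simp add: meet_def)

lemma card_image_insert:
  assumes "finite W"
  shows "card (f ` insert w W) = card (f ` W) + of_bool (f w \<notin> f ` W)"
proof -
  have "f ` insert w W = insert (f w) (f ` W)" by (rule image_insert)
  then show ?thesis using assms by (simp add: card_insert_if)
qed

lemma image_notinD: "f w \<notin> f ` W \<Longrightarrow> x \<in> W \<Longrightarrow> f x = f w \<Longrightarrow> P"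
  by (metis imageI)

lemma coarser_on_extend:
  assumes "coarser_on W j f" "\<And>x. x \<in> W \<Longrightarrow> f x = f w \<Longrightarrow> j x = k" "w \<notin> W"
  shows "coarser_on (insert w W) (j(w := k)) f"
  unfolding coarser_on_def
proof (intro ballI impI)
  fix x y assume xy: "x \<in> insert w W" "y \<in> insert w W" "f x = f y"
  consider "x = w" "y = w" | "x = w" "y \<in> W" | "x \<in> W" "y = w" | "x \<in> W" "y \<in> W" using xy by blast
  then show "(j(w := k)) x = (j(w := k)) y"
  proof cases
    case 2
    then have "f y = f w" "y \<noteq> w" using assms(3) xy(3) by auto
    then show ?thesis using assms(2)[OF 2(2)] 2 by simp
  next
    case 3
    then have "f x = f w" "x \<noteq> w" using assms(3) xy(3) by auto
    then show ?thesis using assms(2)[OF 3(1)] 3 by simp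
  next
    case 4
    then have "x \<noteq> w" "y \<noteq> w" using assms(3) by auto
    moreover have "j x = j y" using 4 assms(1) xy(3) unfolding coarser_on_def by blast
    ultimately show ?thesis by simp
  qed simp
qed

text \<open>
This is semimodularity of the partition lattice. Adding the vertices one at a time, a new vertex creates a
class of \<open>j\<close> if it creates classes of both \<open>f\<close> and \<open>g\<close>, and it merges at most two
classes of \<open>j\<close>, which happens only if it creates a class of the refinement.
\<close>

lemma colourings_semimodular:
  fixes f g :: "'v \<Rightarrow> nat"
  assumes "finite W"
  shows "\<exists>j. coarser_on W j f \<and> coarser_on W j g \<and>
     card (f ` W) + card (g ` W) \<le> card (meet f g ` W) + card (j ` W)"
  using assms
proof (induction W rule: finite_induct)
  case empty
  then show ?case by (auto simp: coarser_on_def)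
next
  case (insert w W)
  obtain j where j: "coarser_on W j f" "coarser_on W j g"
    "card (f ` W) + card (g ` W) \<le> card (meet f g ` W) + card (j ` W)"
    using insert.IH by blast
  note ci = card_image_insert[OF insert.hyps(1), of f w] card_image_insert[OF insert.hyps(1), of g w]
  note cm = card_image_insert[OF insert.hyps(1), of "meet f g" w]
  have upd: "(j(w := k)) ` insert w W = insert k (j ` W)" for j :: "'v \<Rightarrow> nat" and k
  proof -
    have "(j(w := k)) ` W = j ` W" using insert.hyps(2) by (intro image_cong) auto
    then show ?thesis unfolding image_insert by (simp only: fun_upd_same)
  qed
  have updW: "card ((j(w := k)) ` insert w W) = card (j ` W) + of_bool (k \<notin> j ` W)" for j :: "'v \<Rightarrow> nat" and k
    unfolding upd using insert.hyps(1) insert.hyps(2) by (auto simp: card_insert_if)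
  consider (mold) w3 where "w3 \<in> W" "f w = f w3" "g w = g w3"
    | (old) w1 w2 where "w1 \<in> W" "w2 \<in> W" "f w = f w1" "g w = g w2" "meet f g w \<notin> meet f g ` W"
    | (fnew) w2 where "f w \<notin> f ` W" "w2 \<in> W" "g w = g w2"
    | (gnew) w1 where "g w \<notin> g ` W" "w1 \<in> W" "f w = f w1"
    | (new) "f w \<notin> f ` W" "g w \<notin> g ` W"
  proof (cases "f w \<in> f ` W")
    case fT: True
    then obtain w1 where w1: "w1 \<in> W" "f w = f w1" by (rule imageE)
    show thesis
    proof (cases "g w \<in> g ` W")
      case True
      then obtain w2 where w2: "w2 \<in> W" "g w = g w2" by (rule imageE)
      show thesis
      proof (cases "meet f g w \<in> meet f g ` W")
        case True
        then obtain w3 where "w3 \<in> W" "meet f g w = meet f g w3" by (rule imageE)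
        then show thesis using mold[of w3] by (simp add: meet_eq)
      qed (rule old[OF w1(1) w2(1) w1(2) w2(2)])
    qed (rule gnew[OF _ w1])
  next
    case fF: False
    show thesis
    proof (cases "g w \<in> g ` W")
      case True
      then obtain w2 where w2: "w2 \<in> W" "g w = g w2" by (rule imageE)
      show thesis by (rule fnew[OF fF w2])
    qed (rule new[OF fF])
  qed
  then show ?case
  proof cases
    case mold
    have "coarser_on (insert w W) (j(w := j w3)) f" "coarser_on (insert w W) (j(w := j w3)) g"
    proof -
      have "j x = j w3" if "x \<in> W" "f x = f w" for x
        using coarser_onD[OF j(1) that(1) mold(1)] that(2) mold(2) by simp
      then show "coarser_on (insert w W) (j(w := j w3)) f"
        by (rule coarser_on_extend[OF j(1) _ insert.hyps(2)])
      have "j x = j w3" if "x \<in> W" "g x = g w" for x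
        using coarser_onD[OF j(2) that(1) mold(1)] that(2) mold(3) by simp
      then show "coarser_on (insert w W) (j(w := j w3)) g"
        by (rule coarser_on_extend[OF j(2) _ insert.hyps(2)])
    qed
    moreover have "card (f ` insert w W) = card (f ` W)" "card (g ` insert w W) = card (g ` W)"
      using mold ci by auto
    moreover have "card (meet f g ` W) \<le> card (meet f g ` insert w W)" using cm by linarith
    moreover have "card (j ` W) \<le> card ((j(w := j w3)) ` insert w W)" by (simp only: updW)
    ultimately show ?thesis using j(3) by (intro exI[of _ "j(w := j w3)"] conjI) linarith+
  next
    case old
    \<comment> \<open>\<open>w\<close> lies in an old class of \<open>f\<close> and an old class of \<open>g\<close> that have not met before: the classes of \<open>j\<close> containing them are merged\<close>
    define j0 where "j0 x = (if j x = j w2 then j w1 else j x)" for x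
    let ?j = "j0(w := j w1)"
    have "coarser_on (insert w W) ?j f"
    proof (rule coarser_on_extend)
      show "coarser_on W j0 f" unfolding coarser_on_def
      proof (intro ballI impI)
        fix x y assume "x \<in> W" "y \<in> W" "f x = f y"
        then have "j x = j y" by (rule coarser_onD[OF j(1)])
        then show "j0 x = j0 y" by (simp add: j0_def)
      qed
      show "j0 x = j w1" if "x \<in> W" "f x = f w" for x
      proof -
        have "j x = j w1" using coarser_onD[OF j(1) that(1) old(1)] that(2) old(3) by simp
        then show ?thesis by (simp add: j0_def)
      qed
    qed (rule insert.hyps(2))
    moreover have "coarser_on (insert w W) ?j g"
    proof (rule coarser_on_extend)
      show "coarser_on W j0 g" unfolding coarser_on_def
      proof (intro ballI impI)
        fix x y assume "x \<in> W" "y \<in> W" "g x = g y"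
        then have "j x = j y" by (rule coarser_onD[OF j(2)])
        then show "j0 x = j0 y" by (simp add: j0_def)
      qed
      show "j0 x = j w1" if "x \<in> W" "g x = g w" for x
      proof -
        have "j x = j w2" using coarser_onD[OF j(2) that(1) old(2)] that(2) old(4) by simp
        then show ?thesis by (simp add: j0_def)
      qed
    qed (rule insert.hyps(2))
    moreover have "card (f ` insert w W) = card (f ` W)" "card (g ` insert w W) = card (g ` W)"
      using old(1-4) ci by auto
    moreover have "card (meet f g ` insert w W) = card (meet f g ` W) + 1" using old(5) cm by simp
    moreover have "card (j ` W) \<le> card (?j ` insert w W) + 1"
    proof -
      have "j ` W - {j w2} \<subseteq> j0 ` W" by (auto simp: j0_def)
      then have "card (j ` W - {j w2}) \<le> card (j0 ` W)" using insert.hyps(1) by (intro card_mono) auto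
      moreover have "card (j ` W) \<le> card (j ` W - {j w2}) + 1"
        using card_Diff_singleton[of "j w2" "j ` W"] old(2) by simp
      moreover have "card (j0 ` W) \<le> card (?j ` insert w W)" by (simp only: updW)
      ultimately show ?thesis by linarith
    qed
    ultimately show ?thesis using j(3) by (intro exI[of _ ?j] conjI) linarith+
  next
    case fnew
    let ?j = "j(w := j w2)"
    have "coarser_on (insert w W) ?j f"
      by (rule coarser_on_extend[OF j(1) image_notinD[OF fnew(1)] insert.hyps(2)])
    moreover have "coarser_on (insert w W) ?j g"
    proof (rule coarser_on_extend[OF j(2) _ insert.hyps(2)])
      show "j x = j w2" if "x \<in> W" "g x = g w" for x
        using coarser_onD[OF j(2) that(1) fnew(2)] that(2) fnew(3) by simp
    qed
    moreover have "card (f ` insert w W) = card (f ` W) + 1" "card (g ` insert w W) = card (g ` W)"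
      using fnew ci by auto
    moreover have "card (meet f g ` insert w W) = card (meet f g ` W) + 1"
    proof -
      have "meet f g w \<notin> meet f g ` W" using fnew(1) by (auto simp: meet_eq image_iff)
      then show ?thesis using cm by simp
    qed
    moreover have "card (j ` W) \<le> card (?j ` insert w W)" by (simp only: updW)
    ultimately show ?thesis using j(3) by (intro exI[of _ ?j] conjI) linarith+
  next
    case gnew
    let ?j = "j(w := j w1)"
    have "coarser_on (insert w W) ?j g"
      by (rule coarser_on_extend[OF j(2) image_notinD[OF gnew(1)] insert.hyps(2)])
    moreover have "coarser_on (insert w W) ?j f"
    proof (rule coarser_on_extend[OF j(1) _ insert.hyps(2)])
      show "j x = j w1" if "x \<in> W" "f x = f w" for x
        using coarser_onD[OF j(1) that(1) gnew(2)] that(2) gnew(3) by simp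
    qed
    moreover have "card (g ` insert w W) = card (g ` W) + 1" "card (f ` insert w W) = card (f ` W)"
      using gnew ci by auto
    moreover have "card (meet f g ` insert w W) = card (meet f g ` W) + 1"
    proof -
      have "meet f g w \<notin> meet f g ` W" using gnew(1) by (auto simp: meet_eq image_iff)
      then show ?thesis using cm by simp
    qed
    moreover have "card (j ` W) \<le> card (?j ` insert w W)" by (simp only: updW)
    ultimately show ?thesis using j(3) by (intro exI[of _ ?j] conjI) linarith+
  next
    case new
    obtain k where k: "k \<notin> j ` W" using ex_new_if_finite[of "j ` W"] insert.hyps(1) by auto
    let ?j = "j(w := k)"
    have "coarser_on (insert w W) ?j f"
      by (rule coarser_on_extend[OF j(1) image_notinD[OF new(1)] insert.hyps(2)])
    moreover have "coarser_on (insert w W) ?j g"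
      by (rule coarser_on_extend[OF j(2) image_notinD[OF new(2)] insert.hyps(2)])
    moreover have "card (f ` insert w W) = card (f ` W) + 1" "card (g ` insert w W) = card (g ` W) + 1"
      using new ci by auto
    moreover have "card (meet f g ` insert w W) = card (meet f g ` W) + 1"
    proof -
      have "meet f g w \<notin> meet f g ` W" using new(1) by (auto simp: meet_eq image_iff)
      then show ?thesis using cm by simp
    qed
    moreover have "card (?j ` insert w W) = card (j ` W) + 1" using k by (simp only: updW) simp
    ultimately show ?thesis using j(3) by (intro exI[of _ ?j] conjI) linarith+
  qed
qed

lemma crosses_uncross:
  assumes "coarser_on W j f" "coarser_on W j g" "N \<subseteq> W"
  shows "of_bool (crosses (meet f g) N) + of_bool (crosses j N)
      \<le> (of_bool (crosses f N) + of_bool (crosses g N) :: int)"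
proof -
  have "crosses (meet f g) N = (crosses f N \<or> crosses g N)"
    unfolding crosses_def meet_eq by blast
  moreover have "crosses j N \<Longrightarrow> crosses f N \<and> crosses g N"
    using assms unfolding crosses_def coarser_on_def by blast
  ultimately show ?thesis by auto
qed

text \<open>
The function \<open>r\<close> counts the edges and hyperedges that cross a partition, apart from the one that is
being trimmed.
\<close>

definition uncrossing :: "'v set \<Rightarrow> (('v \<Rightarrow> nat) \<Rightarrow> int) \<Rightarrow> bool" where
  "uncrossing W r \<longleftrightarrow> (\<forall>f g j. coarser_on W j f \<longrightarrow> coarser_on W j g \<longrightarrow>
     r (meet f g) + r j \<le> r f + r g)"

text \<open>
If neither \<open>a\<close> nor \<open>b\<close> could be removed from \<open>N\<close>, there would be tight partitions \<open>f\<close> and \<open>g\<close> in which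
only \<open>a\<close>, respectively only \<open>b\<close>, is separated from the rest of \<open>N\<close>. A third vertex of \<open>N\<close>
shows that \<open>N\<close> does not cross the common coarsening, so uncrossing gains 1 and contradicts tightness.
\<close>

lemma trim_one_vertex:
  fixes k :: int
  assumes "finite W" and r: "uncrossing W r" and k: "0 \<le> k"
    and N: "N \<subseteq> W" "3 \<le> card N"
    and con: "\<And>c. k * (int (card (c ` W)) - 1) \<le> r c + of_bool (crosses c N)"
  shows "\<exists>a\<in>N. \<forall>c. k * (int (card (c ` W)) - 1) \<le> r c + of_bool (crosses c (N - {a}))"
proof (rule ccontr)
  assume neg: "\<not> ?thesis"
  have finN: "finite N" using N assms(1) finite_subset by blast
  obtain a where a: "a \<in> N" using N(2) by fastforce
  have "card (N - {a}) \<noteq> 0" using N(2) a finN by simp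
  then have "N - {a} \<noteq> {}" by (metis card.empty)
  then obtain b where b: "b \<in> N" "b \<noteq> a" by blast
  have "card (N - {a} - {b}) \<noteq> 0" using N(2) a b finN by simp
  then have "N - {a} - {b} \<noteq> {}" by (metis card.empty)
  then obtain d where d: "d \<in> N" "d \<noteq> a" "d \<noteq> b" by blast
  have bad: "\<exists>c. r c < k * (int (card (c ` W)) - 1) \<and> \<not> crosses c (N - {z}) \<and> crosses c N"
    if "z \<in> N" for z
  proof -
    have "\<not> (\<forall>c. k * (int (card (c ` W)) - 1) \<le> r c + of_bool (crosses c (N - {z})))"
    proof
      assume "\<forall>c. k * (int (card (c ` W)) - 1) \<le> r c + of_bool (crosses c (N - {z}))"
      then have "\<exists>a\<in>N. \<forall>c. k * (int (card (c ` W)) - 1) \<le> r c + of_bool (crosses c (N - {a}))"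
        using that by (rule bexI)
      with neg show False by (rule notE)
    qed
    then obtain c where c: "\<not> k * (int (card (c ` W)) - 1) \<le> r c + of_bool (crosses c (N - {z}))"
      by (rule not_all[THEN iffD1, THEN exE])
    have "r c < k * (int (card (c ` W)) - 1)" using c by (cases "crosses c (N - {z})") simp_all
    moreover have "\<not> crosses c (N - {z})"
    proof
      assume "crosses c (N - {z})"
      then show False using c con[of c] by (cases "crosses c N") simp_all
    qed
    moreover have "crosses c N"
    proof (rule ccontr)
      assume "\<not> crosses c N"
      then show False using c con[of c] by (cases "crosses c (N - {z})") simp_all
    qed
    ultimately show ?thesis by blast
  qed
  obtain f where f: "r f < k * (int (card (f ` W)) - 1)" "\<not> crosses f (N - {a})" "crosses f N"
    using bad[OF a] by blast
  obtain g where g: "r g < k * (int (card (g ` W)) - 1)" "\<not> crosses g (N - {b})" "crosses g N"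
    using bad[OF b(1)] by blast
  obtain j where j: "coarser_on W j f" "coarser_on W j g"
    "card (f ` W) + card (g ` W) \<le> card (meet f g ` W) + card (j ` W)"
    using colourings_semimodular[OF assms(1)] by blast
  have NW: "x \<in> W" if "x \<in> N" for x using that N(1) by blast
  have jd: "j x = j d" if x: "x \<in> N" for x
  proof (cases "x = a")
    case True
    have "x \<in> N - {b}" "d \<in> N - {b}" using True b a d by auto
    then have "g x = g d" using g(2) unfolding crosses_def by blast
    then show ?thesis by (rule coarser_onD[OF j(2) NW[OF x] NW[OF d(1)]])
  next
    case False
    have "x \<in> N - {a}" "d \<in> N - {a}" using False x d by auto
    then have "f x = f d" using f(2) unfolding crosses_def by blast
    then show ?thesis by (rule coarser_onD[OF j(1) NW[OF x] NW[OF d(1)]])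
  qed
  then have "\<not> crosses j N" unfolding crosses_def by metis
  then have "k * (int (card (j ` W)) - 1) \<le> r j" using con[of j] by simp
  moreover have "k * (int (card (meet f g ` W)) - 1) \<le> r (meet f g) + 1"
    using con[of "meet f g"] by (cases "crosses (meet f g) N") simp_all
  moreover have "r (meet f g) + r j \<le> r f + r g"
    using r j(1,2) unfolding uncrossing_def by blast
  moreover have "k * (int (card (f ` W)) + int (card (g ` W))) \<le> k * (int (card (meet f g ` W)) + int (card (j ` W)))"
    using j(3) k by (intro mult_left_mono) linarith+
  ultimately show False using f(1) g(1) by (simp add: algebra_simps)
qed

text \<open>
If \<open>N\<close> is a single vertex, the two vertices of the pair coincide and the resulting edge is a loop.
\<close>

lemma trim_to_pair:
  fixes k :: int
  assumes "finite W" and r: "uncrossing W r" and k: "0 \<le> k"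
    and "N \<subseteq> W" "N \<noteq> {}"
    and "\<And>c. k * (int (card (c ` W)) - 1) \<le> r c + of_bool (crosses c N)"
  shows "\<exists>a\<in>N. \<exists>b\<in>N. (card N \<noteq> 1 \<longrightarrow> a \<noteq> b) \<and>
     (\<forall>c. k * (int (card (c ` W)) - 1) \<le> r c + of_bool (c a \<noteq> c b))"
  using assms(4-6)
proof (induction "card N" arbitrary: N rule: less_induct)
  case less
  have finN: "finite N" using less.prems(1) assms(1) finite_subset by blast
  then have "card N \<noteq> 0" using less.prems(2) by simp
  then consider "card N = 1" | "card N = 2" | "3 \<le> card N" by linarith
  then show ?case
  proof cases
    case 1
    then obtain a where "N = {a}" by (rule card_1_singletonE)
    then show ?thesis using less.prems(3) by (auto simp: crosses_def)
  next
    case 2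
    then obtain a b where ab: "N = {a,b}" "a \<noteq> b" by (auto simp: card_2_iff)
    then have "crosses c N = (c a \<noteq> c b)" for c by (auto simp: crosses_def)
    then show ?thesis using less.prems(3) ab by auto
  next
    case 3
    obtain a where a: "a \<in> N"
      "\<And>c. k * (int (card (c ` W)) - 1) \<le> r c + of_bool (crosses c (N - {a}))"
      using trim_one_vertex[OF assms(1) r k less.prems(1) 3 less.prems(3)] by blast
    have "card (N - {a}) = card N - 1" using a(1) finN by simp
    then have lt: "card (N - {a}) < card N" and ge1: "card (N - {a}) \<noteq> 1" and "card (N - {a}) \<noteq> 0"
      using 3 by linarith+
    then have ge: "N - {a} \<noteq> {}" by (metis card.empty)
    have "N - {a} \<subseteq> W" using less.prems(1) by blast
    from less.hyps[OF lt this ge a(2)] obtain b d where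
      "b \<in> N - {a}" "d \<in> N - {a}" "card (N - {a}) \<noteq> 1 \<longrightarrow> b \<noteq> d"
      "\<forall>c. k * (int (card (c ` W)) - 1) \<le> r c + of_bool (c b \<noteq> c d)" by blast
    then show ?thesis using ge1 by (intro bexI[of _ b] bexI[of _ d]) auto
  qed
qed

section \<open>Suppressing low vertices\<close>

definition neighbours :: "'e set \<Rightarrow> ('e \<Rightarrow> 'v) \<Rightarrow> ('e \<Rightarrow> 'v) \<Rightarrow> 'v \<Rightarrow> 'v set" where
  "neighbours E s t v = {y. \<exists>e\<in>E. joins s t e v y}"

definition incident :: "'e set \<Rightarrow> ('e \<Rightarrow> 'v) \<Rightarrow> ('e \<Rightarrow> 'v) \<Rightarrow> 'v \<Rightarrow> 'e set" where
  "incident E s t v = {e \<in> E. s e = v \<or> t e = v}"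

definition crossing_edges :: "'v set \<Rightarrow> 'e set \<Rightarrow> ('e \<Rightarrow> 'v) \<Rightarrow> ('e \<Rightarrow> 'v) \<Rightarrow> ('v \<Rightarrow> nat) \<Rightarrow> int" where
  "crossing_edges W E s t c = (\<Sum>e\<in>{e \<in> E. s e \<in> W \<and> t e \<in> W}. of_bool (c (s e) \<noteq> c (t e)))"

definition crossing_stars :: "'v set \<Rightarrow> 'e set \<Rightarrow> ('e \<Rightarrow> 'v) \<Rightarrow> ('e \<Rightarrow> 'v) \<Rightarrow> ('v \<Rightarrow> nat) \<Rightarrow> int" where
  "crossing_stars L E s t c = (\<Sum>v\<in>L. of_bool (crosses c (neighbours E s t v)))"

text \<open>
The vertices in \<open>L\<close> are the low ones, still to be suppressed. They are independent, and in the
partitions of the other vertices the neighbourhood of each of them counts as a single hyperedge.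
\<close>

definition partition_connected ::
    "'v set \<Rightarrow> 'v set \<Rightarrow> 'e set \<Rightarrow> ('e \<Rightarrow> 'v) \<Rightarrow> ('e \<Rightarrow> 'v) \<Rightarrow> bool" where
  "partition_connected V L E s t \<longleftrightarrow> finite V \<and> finite E \<and> (\<forall>e\<in>E. s e \<in> V \<and> t e \<in> V) \<and> L \<subseteq> V
     \<and> (\<forall>e\<in>E. s e \<in> L \<longrightarrow> t e \<in> V - L) \<and> (\<forall>e\<in>E. t e \<in> L \<longrightarrow> s e \<in> V - L)
     \<and> (\<forall>v\<in>L. 4 \<le> card (incident E s t v))
     \<and> (\<forall>c. 4 * (int (card (c ` (V - L))) - 1)
            \<le> crossing_edges (V - L) E s t c + crossing_stars L E s t c)"

lemma partition_connectedD:
  assumes "partition_connected V L E s t"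
  shows "finite V" "finite E" "\<forall>e\<in>E. s e \<in> V \<and> t e \<in> V" "L \<subseteq> V"
    "\<forall>e\<in>E. s e \<in> L \<longrightarrow> t e \<in> V - L" "\<forall>e\<in>E. t e \<in> L \<longrightarrow> s e \<in> V - L"
    "\<And>v. v \<in> L \<Longrightarrow> 4 \<le> card (incident E s t v)"
    "\<And>c. 4 * (int (card (c ` (V - L))) - 1) \<le> crossing_edges (V - L) E s t c + crossing_stars L E s t c"
  using assms unfolding partition_connected_def by blast+

lemma crosses_pair: "crosses c {x, y} = (c x \<noteq> c y)"
  by (auto simp: crosses_def)

lemma uncrossing_crossings:
  assumes "\<And>v. v \<in> M \<Longrightarrow> N v \<subseteq> W"
  shows "uncrossing W (\<lambda>c. crossing_edges W E s t c + (\<Sum>v\<in>M. of_bool (crosses c (N v))))"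
  unfolding uncrossing_def
proof (intro allI impI)
  fix f g j assume j: "coarser_on W j f" "coarser_on W j g"
  let ?E = "{e \<in> E. s e \<in> W \<and> t e \<in> W}"
  have "crossing_edges W E s t (meet f g) + crossing_edges W E s t j
      \<le> crossing_edges W E s t f + crossing_edges W E s t g"
    unfolding crossing_edges_def sum.distrib[symmetric]
  proof (rule sum_mono)
    fix e assume "e \<in> ?E"
    then have "{s e, t e} \<subseteq> W" by simp
    from crosses_uncross[OF j this]
    show "of_bool (meet f g (s e) \<noteq> meet f g (t e)) + of_bool (j (s e) \<noteq> j (t e))
        \<le> (of_bool (f (s e) \<noteq> f (t e)) + of_bool (g (s e) \<noteq> g (t e)) :: int)"
      unfolding crosses_pair .
  qed
  moreover have "(\<Sum>v\<in>M. of_bool (crosses (meet f g) (N v))) + (\<Sum>v\<in>M. of_bool (crosses j (N v)))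
      \<le> (\<Sum>v\<in>M. of_bool (crosses f (N v))) + (\<Sum>v\<in>M. of_bool (crosses g (N v)) :: int)"
    unfolding sum.distrib[symmetric] by (rule sum_mono) (rule crosses_uncross[OF j assms])
  ultimately show "crossing_edges W E s t (meet f g) + (\<Sum>v\<in>M. of_bool (crosses (meet f g) (N v))) +
      (crossing_edges W E s t j + (\<Sum>v\<in>M. of_bool (crosses j (N v))))
      \<le> crossing_edges W E s t f + (\<Sum>v\<in>M. of_bool (crosses f (N v))) +
      (crossing_edges W E s t g + (\<Sum>v\<in>M. of_bool (crosses g (N v))))" by linarith
qed

lemma orientable_add_oriented:
  assumes "finite E" "F \<subseteq> E" "\<forall>e. \<rho> e \<in> {1, -1}"
    and "orientable_mod3 V (E - F) s t (\<lambda>x. \<gamma> x - net F s t \<rho> x)"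
  shows "orientable_mod3 V E s t \<gamma>"
proof -
  obtain \<sigma> where s: "\<forall>e. \<sigma> e \<in> {1,-1}"
    "\<forall>x\<in>V. 3 dvd net (E - F) s t \<sigma> x - (\<gamma> x - net F s t \<rho> x)"
    using assms(4) by (rule orientable_mod3E)
  define \<tau> where "\<tau> e = (if e \<in> F then \<rho> e else \<sigma> e)" for e
  have eq: "net E s t \<tau> x - \<gamma> x = net (E - F) s t \<sigma> x - (\<gamma> x - net F s t \<rho> x)" for x
  proof -
    have "net F s t \<tau> x = net F s t \<rho> x" "net (E - F) s t \<tau> x = net (E - F) s t \<sigma> x"
      by (auto intro!: net_cong simp: \<tau>_def)
    then show ?thesis using net_split[OF assms(1,2), of s t \<tau> x] by simp
  qed
  have "\<tau> e \<in> {1,-1}" for e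
    unfolding \<tau>_def using s(1) assms(3) by (cases "e \<in> F") simp_all
  then show ?thesis
  proof (rule orientable_mod3I)
    fix x assume "x \<in> V"
    then show "3 dvd net E s t \<tau> x - \<gamma> x" unfolding eq using s(2) by blast
  qed
qed

text \<open>
The neighbourhood of \<open>v\<close> is trimmed to the ends of two edges at \<open>v\<close>, and these edges are lifted. At
least two edges at \<open>v\<close> remain, enough to realise the residue at \<open>v\<close> in advance.
\<close>

lemma suppress_star:
  fixes V L :: "'v set" and E :: "'e set"
  assumes P: "partition_connected V L E s t" and v: "v \<in> L"
  shows "\<exists>E' s' t'. partition_connected (V - {v}) (L - {v}) E' s' t' \<and>
     (\<forall>\<gamma>. 3 dvd sum \<gamma> V \<longrightarrow> (\<exists>\<gamma>'. 3 dvd sum \<gamma>' (V - {v}) \<and>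
        (orientable_mod3 (V - {v}) (E' :: 'e set) s' t' \<gamma>' \<longrightarrow> orientable_mod3 V E s t \<gamma>)))"
proof -
  note D = partition_connectedD[OF P]
  let ?W = "V - L" and ?N = "neighbours E s t v"
  have vV: "v \<in> V" using D(4) v by blast
  have W: "(V - {v}) - (L - {v}) = ?W" using v by auto
  have NW: "neighbours E s t u \<subseteq> ?W" if "u \<in> L" for u
    using D(5,6) that unfolding neighbours_def joins_def by auto
  have finL: "finite L" using D(1,4) finite_subset by blast
  have finI: "finite (incident E s t v)" using D(2) by (simp add: incident_def)
  have deg: "4 \<le> card (incident E s t v)" by (rule D(7)[OF v])
  have inc_joins: "\<exists>y\<in>?N. joins s t e v y" if "e \<in> incident E s t v" for e
    using that unfolding incident_def neighbours_def joins_def by auto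
  have "incident E s t v \<noteq> {}" using deg by auto
  then have Nne: "?N \<noteq> {}" using inc_joins by blast
  have finW: "finite ?W" using D(1) by simp
  let ?r = "\<lambda>c. crossing_edges ?W E s t c + (\<Sum>u\<in>L - {v}. of_bool (crosses c (neighbours E s t u)))"
  have unc: "uncrossing ?W ?r"
    by (rule uncrossing_crossings) (use NW in blast)
  have con: "4 * (int (card (c ` ?W)) - 1) \<le> ?r c + of_bool (crosses c ?N)" for c
    using D(8)[of c] sum.remove[OF finL v, of "\<lambda>u. of_bool (crosses c (neighbours E s t u)) :: int"]
    unfolding crossing_stars_def by linarith
  obtain a b where ab: "a \<in> ?N" "b \<in> ?N" "card ?N \<noteq> 1 \<longrightarrow> a \<noteq> b"
    "\<forall>c. 4 * (int (card (c ` ?W)) - 1) \<le> ?r c + of_bool (c a \<noteq> c b)"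
    using trim_to_pair[OF finW unc _ NW[OF v] Nne con] by auto
  have abW: "a \<in> ?W" "b \<in> ?W" using ab NW[OF v] by auto
  have vW: "v \<notin> ?W" using v by simp
  have "\<exists>e1 e2. e1 \<in> E \<and> e2 \<in> E \<and> e1 \<noteq> e2 \<and> joins s t e1 v a \<and> joins s t e2 v b"
  proof (cases "a = b")
    case False
    obtain e1 e2 where "e1 \<in> E" "joins s t e1 v a" "e2 \<in> E" "joins s t e2 v b"
      using ab(1,2) unfolding neighbours_def by blast
    moreover from this False have "e1 \<noteq> e2" using abW vW unfolding joins_def by auto
    ultimately show ?thesis by blast
  next
    case True
    then have "card ?N = 1" using ab(3) by blast
    then have Na: "?N = {a}" using ab(1) by (metis card_1_singletonE singletonD)
    have "\<not> card (incident E s t v) \<le> Suc 0" using deg by simp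
    then obtain e1 e2 where e: "e1 \<in> incident E s t v" "e2 \<in> incident E s t v" "e1 \<noteq> e2"
      using card_le_Suc0_iff_eq[OF finI] by blast
    have "joins s t e1 v a" "joins s t e2 v a" using inc_joins[OF e(1)] inc_joins[OF e(2)] Na by auto
    moreover have "e1 \<in> E" "e2 \<in> E" using e by (auto simp: incident_def)
    ultimately show ?thesis using e(3) True by blast
  qed
  then obtain e1 e2 where e: "e1 \<in> E" "e2 \<in> E" "e1 \<noteq> e2" "joins s t e1 v a" "joins s t e2 v b" by blast
  have va: "v \<noteq> a" "v \<noteq> b" using abW vW by auto
  \<comment> \<open>the edges at \<open>v\<close> that are directed in advance\<close>
  define F where "F = incident E s t v - {e1, e2}"
  define E' where "E' = E - F - {e2}"
  define s' where "s' = s(e1 := a)"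
  define t' where "t' = t(e1 := b)"
  have e_inc: "e1 \<in> incident E s t v" "e2 \<in> incident E s t v"
    using e by (auto simp: incident_def joins_def)
  have finF: "finite F" using finI by (simp add: F_def)
  have cF: "2 \<le> card F"
  proof -
    have "card F = card (incident E s t v) - card {e1,e2}"
      unfolding F_def using e_inc by (intro card_Diff_subset) auto
    then show ?thesis using deg e(3) by simp
  qed
  have FE: "F \<subseteq> E" by (auto simp: F_def incident_def)
  have E'_alt: "E' = insert e1 (E - incident E s t v)"
    unfolding E'_def F_def using e_inc e(1,3) by (auto simp: incident_def)
  have keep: "s' g = s g \<and> t' g = t g" if "g \<in> E - incident E s t v" for g
    using that e_inc by (auto simp: s'_def t'_def)
  have e1': "s' e1 = a" "t' e1 = b" by (simp_all add: s'_def t'_def)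
  have inW: "{g \<in> E'. s' g \<in> ?W \<and> t' g \<in> ?W} = insert e1 {g \<in> E. s g \<in> ?W \<and> t g \<in> ?W}"
  proof -
    have "{g \<in> E. s g \<in> ?W \<and> t g \<in> ?W} = {g \<in> E - incident E s t v. s g \<in> ?W \<and> t g \<in> ?W}"
      using vW by (auto simp: incident_def)
    also have "\<dots> = {g \<in> E - incident E s t v. s' g \<in> ?W \<and> t' g \<in> ?W}" using keep by auto
    finally show ?thesis unfolding E'_alt using e1' abW by auto
  qed
  have e1n: "e1 \<notin> {g \<in> E. s g \<in> ?W \<and> t g \<in> ?W}" using e_inc vW by (auto simp: incident_def)
  have ce: "crossing_edges ?W E' s' t' c = crossing_edges ?W E s t c + of_bool (c a \<noteq> c b)" for c
  proof -
    have "crossing_edges ?W E' s' t' c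
        = of_bool (c (s' e1) \<noteq> c (t' e1)) + (\<Sum>g\<in>{g \<in> E. s g \<in> ?W \<and> t g \<in> ?W}. of_bool (c (s' g) \<noteq> c (t' g)))"
      unfolding crossing_edges_def inW using e1n D(2) by (intro sum.insert) auto
    also have "(\<Sum>g\<in>{g \<in> E. s g \<in> ?W \<and> t g \<in> ?W}. of_bool (c (s' g) \<noteq> c (t' g)))
        = crossing_edges ?W E s t c"
      unfolding crossing_edges_def
    proof (rule sum.cong[OF refl])
      fix g assume "g \<in> {g \<in> E. s g \<in> ?W \<and> t g \<in> ?W}"
      then have "g \<noteq> e1" using e1n by blast
      then show "of_bool (c (s' g) \<noteq> c (t' g)) = (of_bool (c (s g) \<noteq> c (t g)) :: int)"
        by (simp add: s'_def t'_def)
    qed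
    finally show ?thesis using e1' by simp
  qed
  have no_common: "g \<notin> incident E s t v" if "u \<in> L - {v}" "g \<in> incident E s t u" for u g
    using that D(5,6) v unfolding incident_def by auto
  have inc_same: "incident E' s' t' u = incident E s t u" if u: "u \<in> L - {v}" for u
  proof
    show "incident E' s' t' u \<subseteq> incident E s t u"
    proof
      fix g assume g: "g \<in> incident E' s' t' u"
      then have "g \<noteq> e1" using e1' abW u by (auto simp: incident_def)
      then have "g \<in> E - incident E s t v" using g unfolding E'_alt incident_def by auto
      then show "g \<in> incident E s t u" using keep[of g] g by (auto simp: incident_def)
    qed
    show "incident E s t u \<subseteq> incident E' s' t' u"
    proof
      fix g assume g: "g \<in> incident E s t u"
      then have "g \<in> E - incident E s t v" using no_common[OF u g] by (auto simp: incident_def)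
      then show "g \<in> incident E' s' t' u" using keep[of g] g unfolding E'_alt incident_def by auto
    qed
  qed
  have nb_alt: "neighbours X p q u = {y. \<exists>g\<in>incident X p q u. joins p q g u y}" for X p q and u :: 'v
    unfolding neighbours_def incident_def joins_def by auto
  have nb_same: "neighbours E' s' t' u = neighbours E s t u" if u: "u \<in> L - {v}" for u
  proof -
    have "joins s' t' g u y = joins s t g u y" if "g \<in> incident E s t u" for g y
      using keep[of g] no_common[OF u that] that unfolding joins_def incident_def by auto
    then show ?thesis unfolding nb_alt inc_same[OF u] by auto
  qed
  have cs: "crossing_stars (L - {v}) E' s' t' c = (\<Sum>u\<in>L - {v}. of_bool (crosses c (neighbours E s t u)))" for c
    unfolding crossing_stars_def using nb_same by (intro sum.cong) auto
  have edge': "g = e1 \<or> g \<in> E - incident E s t v \<and> s' g = s g \<and> t' g = t g" if "g \<in> E'" for g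
    using that keep unfolding E'_alt by auto
  have P': "partition_connected (V - {v}) (L - {v}) E' s' t'"
    unfolding partition_connected_def W
  proof (intro conjI ballI allI impI)
    show "finite (V - {v})" using D(1) by simp
    show "finite E'" using D(2) by (simp add: E'_def)
    show "L - {v} \<subseteq> V - {v}" using D(4) by auto
  next
    fix g assume g: "g \<in> E'"
    show "s' g \<in> V - {v}" "t' g \<in> V - {v}"
      using edge'[OF g] e1' abW va D(3) by (auto simp: incident_def)
    show "t' g \<in> ?W" if "s' g \<in> L - {v}" using edge'[OF g] that e1' abW D(5) by auto
    show "s' g \<in> ?W" if "t' g \<in> L - {v}" using edge'[OF g] that e1' abW D(6) by auto
  next
    fix u assume u: "u \<in> L - {v}"
    show "4 \<le> card (incident E' s' t' u)" unfolding inc_same[OF u] using D(7) u by blast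
  next
    fix c show "4 * (int (card (c ` ?W)) - 1) \<le> crossing_edges ?W E' s' t' c + crossing_stars (L - {v}) E' s' t' c"
      unfolding ce cs using ab(4)[rule_format, of c] by linarith
  qed
  have step: "\<exists>\<gamma>'. 3 dvd sum \<gamma>' (V - {v}) \<and>
        (orientable_mod3 (V - {v}) E' s' t' \<gamma>' \<longrightarrow> orientable_mod3 V E s t \<gamma>)"
    if z: "3 dvd sum \<gamma> V" for \<gamma>
  proof -
    define w where "w g = (of_bool (s g = v) - of_bool (t g = v) :: int)" for g
    have w: "w g \<in> {1, -1}" if "g \<in> F" for g
    proof -
      have "g \<in> E" "s g = v \<or> t g = v" using that unfolding F_def incident_def by auto
      moreover have "\<not> (s g = v \<and> t g = v)" using D(5) v \<open>g \<in> E\<close> by auto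
      ultimately show ?thesis unfolding w_def by auto
    qed
    obtain \<rho> where rho0: "\<forall>g. \<rho> g \<in> {1,-1}" "3 dvd (\<Sum>g\<in>F. \<rho> g * w g) - \<gamma> v"
      by (rule signs_attain_residue[OF finF cF w, where r = "\<gamma> v"])
    have rho: "\<forall>g. \<rho> g \<in> {1,-1}" "3 dvd net F s t \<rho> v - \<gamma> v"
      using rho0 unfolding net_def w_def by simp_all
    define g' where "g' x = \<gamma> x - net F s t \<rho> x" for x
    have "sum g' V = sum \<gamma> V - (\<Sum>x\<in>V. net F s t \<rho> x)" unfolding g'_def by (simp add: sum_subtractf)
    also have "(\<Sum>x\<in>V. net F s t \<rho> x) = 0"
      using sum_net_zero[OF D(1) finF] D(3) FE by blast
    finally have "3 dvd g' v + sum g' (V - {v})" using z sum.remove[OF D(1) vV, of g'] by simp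
    moreover have "3 dvd g' v" using rho(2) unfolding g'_def by (simp add: dvd_diff_commute)
    ultimately have z': "3 dvd sum g' (V - {v})" by (simp add: dvd_add_right_iff)
    have "orientable_mod3 V E s t \<gamma>" if o: "orientable_mod3 (V - {v}) E' s' t' g'"
    proof -
      have mem: "finite (E - F)" "e1 \<in> E - F" "e2 \<in> E - F" using D(2) e by (auto simp: F_def)
      have "orientable_mod3 (V - {v}) (E - F) s t g'"
        by (rule orientable_lift[OF mem e(3,4,5) va]) (use o in \<open>simp add: E'_def s'_def t'_def\<close>)
      then have "orientable_mod3 (V - {v}) E s t \<gamma>"
        unfolding g'_def by (rule orientable_add_oriented[OF D(2) FE rho(1)])
      then show ?thesis by (rule orientable_extend_vertex[OF D(1-3) vV z])
    qed
    then show ?thesis using z' by blast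
  qed
  show ?thesis using P' step by blast
qed

section \<open>Partition-connected graphs\<close>

definition inner :: "'e set \<Rightarrow> ('e \<Rightarrow> 'v) \<Rightarrow> ('e \<Rightarrow> 'v) \<Rightarrow> 'v set \<Rightarrow> int" where
  "inner E s t B = (\<Sum>e\<in>E. of_bool (s e \<in> B \<and> t e \<in> B))"

lemma orientable_drop_loops:
  assumes "finite E" "orientable_mod3 V {e \<in> E. s e \<noteq> t e} s t \<gamma>"
  shows "orientable_mod3 V E s t \<gamma>"
proof -
  obtain \<sigma> where s: "\<forall>e. \<sigma> e \<in> {1,-1}" "\<forall>x\<in>V. 3 dvd net {e \<in> E. s e \<noteq> t e} s t \<sigma> x - \<gamma> x"
    using assms(2) by (rule orientable_mod3E)
  have eq: "net E s t \<sigma> x = net {e \<in> E. s e \<noteq> t e} s t \<sigma> x" for x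
    unfolding net_def using assms(1) by (intro sum.mono_neutral_right) auto
  show ?thesis
  proof (rule orientable_mod3I)
    show "\<sigma> e \<in> {1,-1}" for e using s(1) by blast
    show "3 dvd net E s t \<sigma> x - \<gamma> x" if "x \<in> V" for x unfolding eq using s(2) that by blast
  qed
qed

lemma crossing_edges_all:
  assumes "\<forall>e\<in>E. s e \<in> V \<and> t e \<in> V"
  shows "crossing_edges V E s t c = (\<Sum>e\<in>E. of_bool (c (s e) \<noteq> c (t e)))"
proof -
  have "{e \<in> E. s e \<in> V \<and> t e \<in> V} = E" using assms by blast
  then show ?thesis by (simp only: crossing_edges_def)
qed

lemma crossing_stars_empty: "crossing_stars {} E s t c = 0"
  by (simp add: crossing_stars_def)

lemma partition_connected_drop_loops:
  assumes P: "partition_connected V {} E s t"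
  shows "partition_connected V {} {e \<in> E. s e \<noteq> t e} s t"
proof -
  note D = partition_connectedD[OF P]
  have ends: "\<forall>e\<in>{e \<in> E. s e \<noteq> t e}. s e \<in> V \<and> t e \<in> V" using D(3) by blast
  have "crossing_edges V {e \<in> E. s e \<noteq> t e} s t c = crossing_edges V E s t c" for c
    unfolding crossing_edges_all[OF ends] crossing_edges_all[OF D(3)]
    using D(2) by (intro sum.mono_neutral_left) auto
  then show ?thesis using D(8) D(1,2) ends unfolding partition_connected_def crossing_stars_empty by simp
qed

lemma partition_connected_cut:
  assumes P: "partition_connected V {} E s t" and A: "A \<noteq> {}" "A \<subset> V"
  shows "4 \<le> cut E s t A"
proof -
  note D = partition_connectedD[OF P]
  define c where "c x = (if x \<in> A then 1 else 0 :: nat)" for x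
  obtain x y where xy: "x \<in> A" "y \<in> V" "y \<notin> A" using A by blast
  have "{c x, c y} \<subseteq> c ` (V - {})" using xy A by auto
  then have "card {c x, c y} \<le> card (c ` (V - {}))" using D(1) by (intro card_mono) auto
  moreover have "card {c x, c y} = 2" using xy by (simp add: c_def)
  ultimately have "4 \<le> crossing_edges V E s t c" using D(8)[of c] unfolding crossing_stars_empty by simp
  also have "\<dots> = cut E s t A"
    unfolding crossing_edges_all[OF D(3)] cut_def by (intro sum.cong) (auto simp: c_def)
  finally show ?thesis .
qed

text \<open>
Giving \<open>v\<close> a colour of its own shows that at most one edge is missing in a partition of the other vertices,
since at most 5 edges lie at \<open>v\<close>; the hyperedge makes up for it if it crosses. If it does not, \<open>v\<close>
can be given the colour of its neighbours, and nothing is missing.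
\<close>

lemma partition_connected_low_vertex:
  assumes P: "partition_connected V {} E s t" and loopless: "\<forall>e\<in>E. s e \<noteq> t e"
    and v: "v \<in> V" "V \<noteq> {v}" and low: "cut E s t {v} \<le> 5"
  shows "partition_connected V {v} E s t"
proof -
  note D = partition_connectedD[OF P]
  let ?W = "V - {v}"
  have nb: "neighbours E s t v \<subseteq> ?W"
    using D(3) loopless unfolding neighbours_def joins_def by auto
  have cut_inc: "cut E s t {v} = int (card (incident E s t v))"
  proof -
    have "((s e \<in> {v}) \<noteq> (t e \<in> {v})) = (s e = v \<or> t e = v)" if "e \<in> E" for e
      using loopless that by auto
    then have "{e \<in> E. (s e \<in> {v}) \<noteq> (t e \<in> {v})} = incident E s t v" unfolding incident_def by blast
    then show ?thesis unfolding cut_eq_card[OF D(2)] by simp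
  qed
  have "{v} \<subset> V" using v by auto
  then have four: "4 \<le> cut E s t {v}" by (intro partition_connected_cut[OF P]) auto
  then have "incident E s t v \<noteq> {}" unfolding cut_inc by auto
  then obtain e where e: "e \<in> E" "s e = v \<or> t e = v" by (auto simp: incident_def)
  then obtain u where u: "u \<in> neighbours E s t v" unfolding neighbours_def joins_def by auto
  have split: "(\<Sum>e\<in>E. of_bool (c (s e) \<noteq> c (t e)))
      = crossing_edges ?W E s t c + (\<Sum>e\<in>incident E s t v. of_bool (c (s e) \<noteq> c (t e)))" for c :: "'a \<Rightarrow> nat"
  proof -
    have "{e \<in> E. s e \<in> ?W \<and> t e \<in> ?W} = E - incident E s t v" using D(3) by (auto simp: incident_def)
    moreover have "incident E s t v \<subseteq> E" by (auto simp: incident_def)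
    ultimately show ?thesis unfolding crossing_edges_def using D(2) by (simp only: sum.subset_diff)
  qed
  have ineq: "4 * (int (card (c ` V)) - 1) \<le> (\<Sum>e\<in>E. of_bool (c (s e) \<noteq> c (t e)))" for c :: "'a \<Rightarrow> nat"
    using D(8)[of c] crossing_stars_empty[of E s t c] crossing_edges_all[OF D(3), of c] by simp
  have W_cross: "4 * (int (card (c ` ?W)) - 1) \<le> crossing_edges ?W E s t c + of_bool (crosses c (neighbours E s t v))"
    for c :: "'a \<Rightarrow> nat"
  proof (cases "crosses c (neighbours E s t v)")
    case True
    obtain k where k: "k \<notin> c ` ?W" using ex_new_if_finite[of "c ` ?W"] D(1) by auto
    let ?c = "c(v := k)"
    have "?c ` ?W = c ` ?W" by (intro image_cong) auto
    moreover have "?c ` V = insert k (?c ` ?W)"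
    proof -
      have "V = insert v ?W" using v by auto
      then have "?c ` V = insert (?c v) (?c ` ?W)" by (metis image_insert)
      then show ?thesis by simp
    qed
    ultimately have "card (?c ` V) = card (c ` ?W) + 1" using k D(1) by simp
    moreover have "crossing_edges ?W E s t ?c = crossing_edges ?W E s t c"
      unfolding crossing_edges_def by (intro sum.cong) auto
    moreover have "(\<Sum>e\<in>incident E s t v. of_bool (?c (s e) \<noteq> ?c (t e))) \<le> (5::int)"
    proof -
      have "(\<Sum>e\<in>incident E s t v. of_bool (?c (s e) \<noteq> ?c (t e))) \<le> (\<Sum>e\<in>incident E s t v. 1::int)"
        by (rule sum_mono) auto
      also have "\<dots> \<le> 5" using low cut_inc by simp
      finally show ?thesis .
    qed
    ultimately show ?thesis using ineq[of ?c] split[of ?c] True by simp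
  next
    case False
    let ?c = "c(v := c u)"
    have uW: "u \<in> ?W" using u nb by blast
    have "?c ` V = c ` ?W"
    proof -
      have "V = insert v ?W" using v by auto
      then have "?c ` V = insert (?c v) (?c ` ?W)" by (metis image_insert)
      moreover have "?c ` ?W = c ` ?W" by (intro image_cong) auto
      ultimately show ?thesis using uW by auto
    qed
    moreover have "crossing_edges ?W E s t ?c = crossing_edges ?W E s t c"
      unfolding crossing_edges_def by (intro sum.cong) auto
    moreover have "(\<Sum>e\<in>incident E s t v. of_bool (?c (s e) \<noteq> ?c (t e))) = (0::int)"
    proof (rule sum.neutral, rule ballI)
      fix e assume e: "e \<in> incident E s t v"
      then obtain y where y: "joins s t e v y" "y \<in> neighbours E s t v"
        unfolding incident_def neighbours_def joins_def by auto
      have "c y = c u" using False y(2) u unfolding crosses_def by blast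
      then have "?c (s e) = ?c (t e)" using y unfolding joins_def by auto
      then show "of_bool (?c (s e) \<noteq> ?c (t e)) = (0::int)" by simp
    qed
    ultimately show ?thesis using ineq[of ?c] split[of ?c] False by simp
  qed
  show ?thesis
    unfolding partition_connected_def
  proof (intro conjI ballI allI impI)
    fix e assume e: "e \<in> E"
    show "t e \<in> ?W" if "s e \<in> {v}" using that e D(3) loopless by force
    show "s e \<in> ?W" if "t e \<in> {v}" using that e D(3) loopless by force
    show "s e \<in> V" "t e \<in> V" using D(3) e by auto
  next
    fix u assume "u \<in> {v}"
    then show "4 \<le> card (incident E s t u)" using four cut_inc by simp
  next
    fix c show "4 * (int (card (c ` ?W)) - 1) \<le> crossing_edges ?W E s t c + crossing_stars {v} E s t c"
    proof -
      have "crossing_stars {v} E s t c = of_bool (crosses c (neighbours E s t v))"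
        unfolding crossing_stars_def by (subst sum.insert) auto
      then show ?thesis using W_cross[of c] by simp
    qed
  qed (use D v in auto)
qed

lemma inner_split:
  assumes fin: "finite E" "finite B" 
  shows "inner E s t B = crossing_edges B E s t c + (\<Sum>k\<in>c ` B. inner E s t {x \<in> B. c x = k})"
proof -
  have sub: "inner E s t B = (\<Sum>e\<in>{e \<in> E. s e \<in> B \<and> t e \<in> B}. 1)"
    unfolding inner_def using fin(1) by (simp add: of_bool_def sum.If_cases Int_def conj_commute)
  have "(\<Sum>k\<in>c ` B. inner E s t {x \<in> B. c x = k})
      = (\<Sum>e\<in>E. \<Sum>k\<in>c ` B. of_bool (s e \<in> {x \<in> B. c x = k} \<and> t e \<in> {x \<in> B. c x = k}))"
    unfolding inner_def by (rule sum.swap)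
  also have "\<dots> = (\<Sum>e\<in>E. of_bool (s e \<in> B \<and> t e \<in> B \<and> c (s e) = c (t e)))"
  proof (rule sum.cong[OF refl])
    fix e assume "e \<in> E"
    show "(\<Sum>k\<in>c ` B. of_bool (s e \<in> {x \<in> B. c x = k} \<and> t e \<in> {x \<in> B. c x = k}))
        = (of_bool (s e \<in> B \<and> t e \<in> B \<and> c (s e) = c (t e)) :: int)"
    proof (cases "s e \<in> B \<and> t e \<in> B \<and> c (s e) = c (t e)")
      case True
      have "(\<Sum>k\<in>c ` B. of_bool (s e \<in> {x \<in> B. c x = k} \<and> t e \<in> {x \<in> B. c x = k}))
          = (\<Sum>k\<in>c ` B. if k = c (s e) then 1 else 0 :: int)"
        using True by (intro sum.cong) auto
      also have "\<dots> = 1" using True fin(2) by (simp add: sum.delta)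
      finally show ?thesis using True by simp
    next
      case False
      then have "(\<Sum>k\<in>c ` B. of_bool (s e \<in> {x \<in> B. c x = k} \<and> t e \<in> {x \<in> B. c x = k})) = (0::int)"
        by (intro sum.neutral) auto
      then show ?thesis using False by simp
    qed
  qed
  also have "\<dots> = (\<Sum>e\<in>{e \<in> E. s e \<in> B \<and> t e \<in> B}. of_bool (c (s e) = c (t e)))"
    using fin(1) by (intro sum.mono_neutral_cong_right) auto
  finally show ?thesis
    unfolding sub crossing_edges_def by (simp only: sum.distrib[symmetric]) (rule sum.cong[OF refl], auto)
qed

text \<open>
The classes of a partition are sparse by minimality, so the edges of \<open>B\<close> that are not inside a class are
numerous enough.
\<close>

lemma partition_connected_of_minimal_dense:
  fixes B :: "'v set" and E :: "'e set"
  assumes fin: "finite E" "finite B" and loopless: "\<forall>e\<in>E. s e \<noteq> t e"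
    and dense: "4 * (int (card B) - 1) \<le> inner E s t B"
    and sparse: "\<And>A. A \<subset> B \<Longrightarrow> 2 \<le> card A \<Longrightarrow> inner E s t A < 4 * (int (card A) - 1)"
  shows "partition_connected B {} {e \<in> E. s e \<in> B \<and> t e \<in> B} s t"
proof -
  let ?E = "{e \<in> E. s e \<in> B \<and> t e \<in> B}"
  have "4 * (int (card (c ` B)) - 1) \<le> crossing_edges B ?E s t c" for c :: "'v \<Rightarrow> nat"
  proof (cases "2 \<le> card (c ` B)")
    case False
    moreover have "0 \<le> crossing_edges B ?E s t c" unfolding crossing_edges_def by (intro sum_nonneg) auto
    ultimately show ?thesis by simp
  next
    case True
    have part: "inner E s t {x \<in> B. c x = k} \<le> 4 * (int (card {x \<in> B. c x = k}) - 1)" if k: "k \<in> c ` B" for k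
    proof (cases "2 \<le> card {x \<in> B. c x = k}")
      case two: True
      have "{x \<in> B. c x = k} \<noteq> B"
      proof
        assume "{x \<in> B. c x = k} = B"
        then have "c ` B \<subseteq> {k}" by auto
        then have "card (c ` B) \<le> card {k}" by (intro card_mono) auto
        then show False using True by simp
      qed
      then have "{x \<in> B. c x = k} \<subset> B" by blast
      then show ?thesis using sparse[OF _ two] by fastforce
    next
      case False
      obtain x where x: "x \<in> B" "c x = k" using k by blast
      have "finite {x \<in> B. c x = k}" using fin by simp
      then have "card {x \<in> B. c x = k} \<noteq> 0" using x by auto
      then have one: "card {x \<in> B. c x = k} = 1" using False by linarith
      then obtain y where y: "{x \<in> B. c x = k} = {y}" by (rule card_1_singletonE)
      have "inner E s t {y} = 0" unfolding inner_def using loopless by (intro sum.neutral) auto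
      then show ?thesis using one y by simp
    qed
    have "(\<Sum>k\<in>c ` B. inner E s t {x \<in> B. c x = k}) \<le> (\<Sum>k\<in>c ` B. 4 * (int (card {x \<in> B. c x = k}) - 1))"
      by (rule sum_mono) (rule part)
    also have "\<dots> = 4 * (int (\<Sum>k\<in>c ` B. card {x \<in> B. c x = k}) - int (card (c ` B)))"
      by (simp add: sum_distrib_left[symmetric] sum_subtractf)
    also have "(\<Sum>k\<in>c ` B. card {x \<in> B. c x = k}) = card B"
      using sum.image_gen[OF fin(2), of "\<lambda>_. 1::nat" c] by simp
    finally have "inner E s t B \<le> crossing_edges B E s t c + 4 * (int (card B) - int (card (c ` B)))"
      using inner_split[OF fin, of s t c] by linarith
    moreover have "crossing_edges B ?E s t c = crossing_edges B E s t c"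
      unfolding crossing_edges_def by (intro sum.cong) auto
    ultimately show ?thesis using dense by (simp add: algebra_simps)
  qed
  then show ?thesis unfolding partition_connected_def crossing_stars_empty using fin by simp
qed

lemma partition_connected_collapse:
  assumes P: "partition_connected V {} E s t" and B: "B \<subseteq> V" "a \<in> B"
  shows "partition_connected (insert a (V - B)) {} E (collapse B a \<circ> s) (collapse B a \<circ> t)"
proof -
  note D = partition_connectedD[OF P]
  have ends: "\<forall>e\<in>E. (collapse B a \<circ> s) e \<in> insert a (V - B) \<and> (collapse B a \<circ> t) e \<in> insert a (V - B)"
    using D(3) by (auto simp: collapse_def)
  have im: "collapse B a ` V = insert a (V - B)" using B by (auto simp: collapse_def image_iff)
  have "4 * (int (card (c ` insert a (V - B))) - 1)
      \<le> crossing_edges (insert a (V - B)) E (collapse B a \<circ> s) (collapse B a \<circ> t) c" for c :: "'a \<Rightarrow> nat"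
  proof -
    have "(c \<circ> collapse B a) ` V = c ` insert a (V - B)" unfolding image_comp[symmetric] im ..
    moreover have "4 * (int (card ((c \<circ> collapse B a) ` V)) - 1) \<le> crossing_edges V E s t (c \<circ> collapse B a)"
      using D(8)[of "c \<circ> collapse B a"] unfolding crossing_stars_empty by simp
    ultimately show ?thesis
      unfolding crossing_edges_all[OF D(3)] crossing_edges_all[OF ends] by simp
  qed
  then show ?thesis
    unfolding partition_connected_def crossing_stars_empty using D(1,2) ends by simp
qed

text \<open>
The partition into single vertices yields \<open>4(n - 1)\<close> edges. At most 5 of them lie in the cut, so that
one of its two sides must be dense.
\<close>

lemma dense_proper_subset:
  assumes P: "partition_connected V {} E s t"
    and A: "A \<subseteq> V" "2 \<le> card A" "2 \<le> card (V - A)" "cut E s t A \<le> 5" and loopless: "\<forall>e\<in>E. s e \<noteq> t e"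
  shows "\<exists>B. B \<subset> V \<and> 2 \<le> card B \<and> 4 * (int (card B) - 1) \<le> inner E s t B"
proof -
  note D = partition_connectedD[OF P]
  obtain c :: "'a \<Rightarrow> nat" where c: "inj_on c V" using finite_imp_inj_to_nat_seg[OF D(1)] by auto
  have "crossing_edges V E s t c = (\<Sum>e\<in>E. 1)"
    unfolding crossing_edges_all[OF D(3)]
  proof (rule sum.cong[OF refl])
    fix e assume e: "e \<in> E"
    then have "c (s e) \<noteq> c (t e)" using inj_onD[OF c, of "s e" "t e"] D(3) loopless by blast
    then show "of_bool (c (s e) \<noteq> c (t e)) = (1::int)" by simp
  qed
  then have "4 * (int (card V) - 1) \<le> (\<Sum>e\<in>E. 1)"
    using D(8)[of c] card_image[OF c] unfolding crossing_stars_empty by simp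
  also have "(\<Sum>e\<in>E. 1) = inner E s t A + inner E s t (V - A) + cut E s t A"
    unfolding inner_def cut_def sum.distrib[symmetric] using D(3) by (intro sum.cong) auto
  finally have tot: "4 * (int (card V) - 1) \<le> inner E s t A + inner E s t (V - A) + 5" using A(4) by linarith
  have finA: "finite A" using A(1) D(1) finite_subset by blast
  have cV: "int (card V) = int (card A) + int (card (V - A))"
    using card_Diff_subset[OF finA A(1)] card_mono[OF D(1) A(1)] by simp
  have "A \<noteq> {}" "V - A \<noteq> {}"
    using A(2,3) by (metis card.empty not_numeral_le_zero)+
  then have "A \<subset> V" "V - A \<subset> V" using A(1) by blast+
  moreover have "4 * (int (card A) - 1) \<le> inner E s t A \<or> 4 * (int (card (V - A)) - 1) \<le> inner E s t (V - A)"
    using tot cV by (auto simp: algebra_simps)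
  ultimately show ?thesis using A(2,3) by blast
qed

text \<open>
Induction on the number of vertices, by suppression of a low vertex, contraction of a dense subset, or
the theorem on graphs without cuts of fewer than 6 edges.
\<close>

theorem orientable_of_partition_connected:
  fixes V L :: "'v set" and E :: "'e set"
  assumes "partition_connected V L E s t" "3 dvd sum \<gamma> V"
  shows "orientable_mod3 V E s t \<gamma>"
  using assms
proof (induction "card V" arbitrary: V L E s t \<gamma> rule: less_induct)
  case less
  have star: "orientable_mod3 V E' s t \<gamma>" if st: "partition_connected V M E' s t" "v \<in> M" for M E' v
  proof -
    note D = partition_connectedD[OF st(1)]
    have vV: "v \<in> V" using D(4) st(2) by blast
    obtain E'' s' t' where **: "partition_connected (V - {v}) (M - {v}) (E'' :: 'e set) s' t'"
      "\<forall>\<gamma>. 3 dvd sum \<gamma> V \<longrightarrow> (\<exists>\<gamma>'. 3 dvd sum \<gamma>' (V - {v}) \<and>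
        (orientable_mod3 (V - {v}) E'' s' t' \<gamma>' \<longrightarrow> orientable_mod3 V E' s t \<gamma>))"
      using suppress_star[OF st] by (elim exE conjE)
    obtain \<gamma>' where *: "3 dvd sum \<gamma>' (V - {v})"
      "orientable_mod3 (V - {v}) E'' s' t' \<gamma>' \<longrightarrow> orientable_mod3 V E' s t \<gamma>"
      using **(2)[rule_format, OF less.prems(2)] by (elim exE conjE)
    have "card (V - {v}) < card V" using D(1) vV by (intro psubset_card_mono) auto
    then show ?thesis by (rule *(2)[rule_format, OF less.hyps[OF _ **(1) *(1)]])
  qed
  show ?case
  proof (cases "L = {}")
    case False
    then show ?thesis using star[OF less.prems(1)] by blast
  next
    case True
    let ?E = "{e \<in> E. s e \<noteq> t e}"
    have P0: "partition_connected V {} ?E s t" using partition_connected_drop_loops less.prems(1) True by blast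
    note D = partition_connectedD[OF P0]
    have loopless: "\<forall>e\<in>?E. s e \<noteq> t e" by blast
    have "orientable_mod3 V ?E s t \<gamma>"
    proof (cases "2 \<le> card V")
      case False
      show ?thesis
      proof (cases "V = {}")
        case True
        then show ?thesis by (intro orientable_mod3I[of "\<lambda>_. 1"]) auto
      next
        case ne: False
        then have "card V \<noteq> 0" using D(1) by simp
        then have "card V = 1" using False by linarith
        then obtain u where u: "V = {u}" by (rule card_1_singletonE)
        show ?thesis
        proof (rule orientable_star[OF D(1-3), of u])
          show "u \<in> V" using u by simp
          show "3 dvd sum \<gamma> V" by (rule less.prems(2))
          show "2 \<le> card {e \<in> ?E. joins s t e w u}" if "w \<in> V - {u}" for w using that u by simp
        qed
      qed
    next
      case two: True
      show ?thesis
      proof (cases "\<exists>A. A \<noteq> {} \<and> A \<subset> V \<and> cut ?E s t A \<le> 5")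
        case False
        have "6 \<le> cut ?E s t A" if A: "A \<noteq> {}" "A \<subset> V" for A
        proof (rule ccontr)
          assume "\<not> ?thesis"
          then have "cut ?E s t A \<le> 5" by linarith
          then show False using False A by blast
        qed
        then show ?thesis by (rule orientable_of_six_edge_connected[OF D(1-3) less.prems(2) two])
      next
        case True
        then obtain A where A: "A \<noteq> {}" "A \<subset> V" "cut ?E s t A \<le> 5" by blast
        have single: "orientable_mod3 V ?E s t \<gamma>" if "v \<in> V" "cut ?E s t {v} \<le> 5" for v
        proof -
          have "V \<noteq> {v}" using two by auto
          from star[OF partition_connected_low_vertex[OF P0 loopless that(1) this that(2)]] show ?thesis by blast
        qed
        have finA: "finite A" using A(2) D(1) finite_subset by blast
        have ne: "card A \<noteq> 0" "card (V - A) \<noteq> 0" using A finA D(1) by auto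
        consider "card A = 1" | "card (V - A) = 1" | "2 \<le> card A" "2 \<le> card (V - A)"
          using ne by linarith
        then show ?thesis
        proof cases
          case 1
          then obtain v where "A = {v}" by (rule card_1_singletonE)
          then show ?thesis using single A by auto
        next
          case 2
          then obtain v where v: "V - A = {v}" by (rule card_1_singletonE)
          have "cut ?E s t {v} \<le> 5" using A(3) cut_compl[OF D(3), of A] v by simp
          then show ?thesis using single[of v] v by blast
        next
          case 3
          have AV: "A \<subseteq> V" using A by blast
          define good where "good B \<longleftrightarrow> B \<subset> V \<and> 2 \<le> card B \<and> 4 * (int (card B) - 1) \<le> inner ?E s t B" for B
          have ex: "\<exists>B. good B" using dense_proper_subset[OF P0 AV 3 A(3) loopless] unfolding good_def .
          obtain B where B: "good B" "\<And>B'. good B' \<Longrightarrow> card B \<le> card B'"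
            using ex_has_least_nat[of good _ card] ex by metis
          have BV: "B \<subset> V" "2 \<le> card B" "4 * (int (card B) - 1) \<le> inner ?E s t B"
            using B(1) unfolding good_def by auto
          have BV': "B \<subseteq> V" using BV(1) by blast
          have finB: "finite B" using BV' D(1) finite_subset by blast
          obtain a where a: "a \<in> B" using BV(2) by fastforce
          have sparse: "inner ?E s t A' < 4 * (int (card A') - 1)" if "A' \<subset> B" "2 \<le> card A'" for A'
          proof (rule ccontr)
            assume "\<not> ?thesis"
            then have "good A'" unfolding good_def using that BV(1) by auto
            then have "card B \<le> card A'" by (rule B(2))
            then show False using psubset_card_mono[OF finB that(1)] by simp
          qed
          have PB: "partition_connected B {} {e \<in> ?E. s e \<in> B \<and> t e \<in> B} s t"
            by (rule partition_connected_of_minimal_dense[OF D(2) finB loopless BV(3) sparse])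
          have cd: "card (insert a (V - B)) = card V - card B + 1" "card B < card V"
            using card_collapse[OF D(1) BV(1) a] by auto
          have lt: "card (insert a (V - B)) < card V" using cd BV(2) by linarith
          have "sum (\<gamma>(a := sum \<gamma> B)) (insert a (V - B)) = sum \<gamma> V"
          proof -
            have "insert a (V - B) \<union> B = V" using BV' a by auto
            then show ?thesis using sum_contract[OF D(1) BV' a order_refl, of \<gamma>] by simp
          qed
          then have z: "3 dvd sum (\<gamma>(a := sum \<gamma> B)) (insert a (V - B))" using less.prems(2) by simp
          show ?thesis
          proof (rule orientable_contract_all[OF D(1,2) BV' a])
            show "orientable_mod3 (insert a (V - B)) ?E (collapse B a \<circ> s) (collapse B a \<circ> t) (\<gamma>(a := sum \<gamma> B))"
              by (rule less.hyps[OF lt partition_connected_collapse[OF P0 BV' a] z])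
            show "orientable_mod3 B {e \<in> ?E. s e \<in> B \<and> t e \<in> B} s t g" if "3 dvd sum g B" for g
              by (rule less.hyps[OF cd(2) PB that])
          qed
        qed
      qed
    qed
    then show ?thesis by (rule orientable_drop_loops[OF partition_connectedD(2)[OF less.prems(1)]])
  qed
qed

section \<open>Two adjacent vertices that meet every edge\<close>

text \<open>
Every other vertex has at least two parallel edges to one of the hubs and can be absorbed by it. The
sets \<open>U\<close> and \<open>Y\<close> absorbed by the two hubs are joined by at least four edges.
\<close>

lemma orientable_two_hubs:
  fixes V :: "'v set" and E :: "'e set"
  assumes fin: "finite V" "finite E" and ends: "\<forall>e\<in>E. s e \<in> V \<and> t e \<in> V"
    and loopless: "\<forall>e\<in>E. s e \<noteq> t e"
    and four: "\<And>A. A \<noteq> {} \<Longrightarrow> A \<subset> V \<Longrightarrow> 4 \<le> cut E s t A"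
    and uv: "u \<in> V" "v \<in> V" "u \<noteq> v"
    and hubs: "\<And>e. e \<in> E \<Longrightarrow> s e \<in> {u,v} \<or> t e \<in> {u,v}"
    and z: "3 dvd sum \<gamma> V"
  shows "orientable_mod3 V E s t \<gamma>"
proof -
  define U where "U = {w \<in> V - {v}. w = u \<or> 2 \<le> card {e \<in> E. joins s t e w u}}"
  define Y where "Y = V - U"
  have U: "U \<subseteq> V" "u \<in> U" and vY: "v \<in> Y" using uv by (auto simp: U_def Y_def)
  have Y_two: "2 \<le> card {e \<in> E. joins s t e w v}" if w: "w \<in> Y - {v}" for w
  proof -
    have wV: "w \<in> V" "w \<noteq> u" "w \<noteq> v" using w U(2) by (auto simp: Y_def)
    have few: "card {e \<in> E. joins s t e w u} \<le> 1" using w wV by (auto simp: Y_def U_def)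
    have "{w} \<subset> V" using wV uv by blast
    then have "4 \<le> cut E s t {w}" by (intro four) auto
    moreover have "{e \<in> E. (s e \<in> {w}) \<noteq> (t e \<in> {w})} \<subseteq> {e \<in> E. joins s t e w u} \<union> {e \<in> E. joins s t e w v}"
    proof
      fix e assume "e \<in> {e \<in> E. (s e \<in> {w}) \<noteq> (t e \<in> {w})}"
      then have "e \<in> E" "s e = w \<or> t e = w" by auto
      then show "e \<in> {e \<in> E. joins s t e w u} \<union> {e \<in> E. joins s t e w v}"
        using hubs[of e] wV unfolding joins_def by auto
    qed
    then have "card {e \<in> E. (s e \<in> {w}) \<noteq> (t e \<in> {w})}
        \<le> card ({e \<in> E. joins s t e w u} \<union> {e \<in> E. joins s t e w v})"
      using fin(2) by (intro card_mono) auto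
    moreover have "card ({e \<in> E. joins s t e w u} \<union> {e \<in> E. joins s t e w v})
        \<le> card {e \<in> E. joins s t e w u} + card {e \<in> E. joins s t e w v}" by (rule card_Un_le)
    ultimately show ?thesis using few unfolding cut_eq_card[OF fin(2)] by linarith
  qed
  let ?s = "collapse U u \<circ> s" and ?t = "collapse U u \<circ> t"
  let ?g = "\<gamma>(u := sum \<gamma> U)"
  let ?V = "insert u (V - U)"
  have finV: "finite ?V" using fin by simp
  have uY: "u \<notin> Y" using U by (simp add: Y_def)
  have YV: "Y \<subseteq> ?V" by (auto simp: Y_def)
  have VUY: "?V - Y = {u}" using uY by (auto simp: Y_def)
  have sum1: "sum ?g ?V = sum \<gamma> V"
  proof -
    have "?V \<union> U = V" using U by auto
    then show ?thesis using sum_contract[OF fin(1) U order_refl, of \<gamma>] by simp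
  qed
  show ?thesis
  proof (rule orientable_contract_all[OF fin U])
    fix g :: "'v \<Rightarrow> int" assume g: "3 dvd sum g U"
    show "orientable_mod3 U {e \<in> E. s e \<in> U \<and> t e \<in> U} s t g"
    proof (rule orientable_star[of _ _ _ _ u])
      fix w assume w: "w \<in> U - {u}"
      have "{e \<in> {e \<in> E. s e \<in> U \<and> t e \<in> U}. joins s t e w u} = {e \<in> E. joins s t e w u}"
        using w U(2) by (auto simp: joins_def)
      then show "2 \<le> card {e \<in> {e \<in> E. s e \<in> U \<and> t e \<in> U}. joins s t e w u}"
        using w by (auto simp: U_def)
    next
      show "finite U" using U(1) fin(1) finite_subset by blast
    qed (use U g fin in auto)
  next
    show "orientable_mod3 ?V E ?s ?t ?g"
    proof (rule orientable_contract_all[OF finV fin(2) YV vY])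
      fix g :: "'v \<Rightarrow> int" assume g: "3 dvd sum g Y"
      show "orientable_mod3 Y {e \<in> E. ?s e \<in> Y \<and> ?t e \<in> Y} ?s ?t g"
      proof (rule orientable_star[of _ _ _ _ v])
        fix w assume w: "w \<in> Y - {v}"
        have "w \<notin> U" "v \<notin> U" using w vY by (auto simp: Y_def)
        then have "joins ?s ?t e w v" "?s e \<in> Y" "?t e \<in> Y" if "joins s t e w v" for e
          using that w vY unfolding joins_def collapse_def by auto
        then have "{e \<in> E. joins s t e w v} \<subseteq> {e \<in> {e \<in> E. ?s e \<in> Y \<and> ?t e \<in> Y}. joins ?s ?t e w v}"
          by blast
        then have "card {e \<in> E. joins s t e w v}
            \<le> card {e \<in> {e \<in> E. ?s e \<in> Y \<and> ?t e \<in> Y}. joins ?s ?t e w v}"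
          using fin(2) by (intro card_mono) auto
        then show "2 \<le> card {e \<in> {e \<in> E. ?s e \<in> Y \<and> ?t e \<in> Y}. joins ?s ?t e w v}"
          using Y_two[OF w] by linarith
      next
        show "finite Y" using fin(1) by (simp add: Y_def)
        show "finite {e \<in> E. ?s e \<in> Y \<and> ?t e \<in> Y}" using fin(2) by simp
        show "\<forall>e\<in>{e \<in> E. ?s e \<in> Y \<and> ?t e \<in> Y}. ?s e \<in> Y \<and> ?t e \<in> Y" by blast
      qed (rule vY, rule g)
    next
      let ?ss = "collapse Y v \<circ> ?s" and ?tt = "collapse Y v \<circ> ?t"
      let ?gg = "?g(v := sum ?g Y)"
      have sum2: "sum ?gg (insert v (?V - Y)) = sum ?g ?V"
      proof -
        have "insert v (?V - Y) \<union> Y = ?V" using YV vY by auto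
        then show ?thesis using sum_contract[OF finV YV vY order_refl, of ?g] by simp
      qed
      have val: "(collapse Y v \<circ> (collapse U u \<circ> f)) e = (if f e \<in> U then u else v)" if "f e \<in> V"
        for f :: "'e \<Rightarrow> 'v" and e
        using that uY unfolding collapse_def by (auto simp: Y_def)
      have U_proper: "U \<noteq> {}" "U \<subset> V" using U uv by (auto simp: U_def)
      show "orientable_mod3 (insert v (?V - Y)) E ?ss ?tt ?gg"
      proof (rule orientable_star[of _ _ _ _ u])
        show "finite (insert v (?V - Y))" "finite E" using fin by simp_all
        show "\<forall>e\<in>E. ?ss e \<in> insert v (?V - Y) \<and> ?tt e \<in> insert v (?V - Y)"
          unfolding VUY using val[of s] val[of t] ends by simp
        show "u \<in> insert v (?V - Y)" unfolding VUY by simp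
        show "3 dvd sum ?gg (insert v (?V - Y))" unfolding sum2 sum1 by (rule z)
        fix w assume "w \<in> insert v (?V - Y) - {u}"
        then have w: "w = v" unfolding VUY by blast
        have "{e \<in> E. (s e \<in> U) \<noteq> (t e \<in> U)} \<subseteq> {e \<in> E. joins ?ss ?tt e w u}"
          using val[of s] val[of t] ends unfolding w joins_def by auto
        then have "card {e \<in> E. (s e \<in> U) \<noteq> (t e \<in> U)} \<le> card {e \<in> E. joins ?ss ?tt e w u}"
          using fin(2) by (intro card_mono) auto
        moreover have "4 \<le> cut E s t U" by (rule four[OF U_proper])
        ultimately show "2 \<le> card {e \<in> E. joins ?ss ?tt e w u}"
          unfolding cut_eq_card[OF fin(2)] by linarith
      qed
    qed
  qed
qed


section \<open>Essentially connected graphs\<close>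

lemma sum_of_bool_eq:
  fixes f :: "'b \<Rightarrow> int"
  assumes "finite K" "a \<in> K"
  shows "(\<Sum>i\<in>K. f i * of_bool (i = a)) = f a"
proof -
  have "(\<Sum>i\<in>K. f i * of_bool (i = a)) = (\<Sum>i\<in>K. if i = a then f i else 0)"
    by (intro sum.cong) auto
  also have "\<dots> = f a" using assms by simp
  finally show ?thesis .
qed

text \<open>
A graph without hubs. Every edge then has another edge disjoint from it, so the cut around the two ends of an
edge is essential and has at least 41 edges.
\<close>

locale essentially_connected =
  fixes V :: "'v set" and E :: "'e set" and s t
  assumes fin: "finite V" "finite E" and ends: "\<forall>e\<in>E. s e \<in> V \<and> t e \<in> V"
    and loopless: "\<forall>e\<in>E. s e \<noteq> t e"
    and four: "\<And>A. A \<noteq> {} \<Longrightarrow> A \<subset> V \<Longrightarrow> 4 \<le> cut E s t A"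
    and essential: "\<And>A e f. A \<subseteq> V \<Longrightarrow> e \<in> E \<Longrightarrow> f \<in> E \<Longrightarrow> s e \<in> A \<Longrightarrow> t e \<in> A \<Longrightarrow>
       s f \<notin> A \<Longrightarrow> t f \<notin> A \<Longrightarrow> 41 \<le> cut E s t A"
    and no_hubs: "\<And>e. e \<in> E \<Longrightarrow> \<exists>f\<in>E. s f \<notin> {s e, t e} \<and> t f \<notin> {s e, t e}"
begin

abbreviation deg where "deg x \<equiv> cut E s t {x}"

lemma deg_incident: "deg x = int (card (incident E s t x))"
proof -
  have "((s e \<in> {x}) \<noteq> (t e \<in> {x})) = (s e = x \<or> t e = x)" if "e \<in> E" for e
    using loopless that by auto
  then have "{e \<in> E. (s e \<in> {x}) \<noteq> (t e \<in> {x})} = incident E s t x" unfolding incident_def by blast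
  then show ?thesis unfolding cut_eq_card[OF fin(2)] by simp
qed

lemma adjacent_degrees:
  assumes e: "e \<in> E" "joins s t e x y"
  shows "43 \<le> deg x + deg y"
proof -
  have xy: "x \<noteq> y" "{x,y} = {s e, t e}" using e loopless by (auto simp: joins_def)
  obtain f where f: "f \<in> E" "s f \<notin> {x,y}" "t f \<notin> {x,y}" using no_hubs[OF e(1)] xy(2) by auto
  have sub: "{x,y} \<subseteq> V" using e(1) ends xy by auto
  have "41 \<le> cut E s t {x,y}"
    by (rule essential[OF sub e(1) f(1) _ _ f(2,3)]) (use xy(2) in auto)
  moreover have "cut E s t {x,y} + 2 \<le> deg x + deg y"
  proof -
    have "cut E s t {x,y} = cut (E - {e}) s t {x,y} + of_bool ((x \<in> {x,y}) \<noteq> (y \<in> {x,y}))"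
      by (rule cut_remove[OF fin(2) e])
    moreover have "deg x = cut (E - {e}) s t {x} + of_bool ((x \<in> {x}) \<noteq> (y \<in> {x}))"
      by (rule cut_remove[OF fin(2) e])
    moreover have "deg y = cut (E - {e}) s t {y} + of_bool ((x \<in> {y}) \<noteq> (y \<in> {y}))"
      by (rule cut_remove[OF fin(2) e])
    moreover have "cut (E - {e}) s t {x,y} \<le> cut (E - {e}) s t {x} + cut (E - {e}) s t {y}"
      unfolding cut_def sum.distrib[symmetric] using xy(1) by (intro sum_mono) auto
    ultimately show ?thesis using xy(1) by simp
  qed
  ultimately show ?thesis by linarith
qed

definition low where "low = {v \<in> V. deg v \<le> 5}"

lemma low_neighbour:
  assumes "e \<in> E" "joins s t e v x" "v \<in> low"
  shows "38 \<le> deg x" "x \<in> V - low"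
proof -
  show "38 \<le> deg x" using adjacent_degrees[OF assms(1,2)] assms(3) by (auto simp: low_def)
  moreover have "x \<in> V" using assms(1,2) ends by (auto simp: joins_def)
  ultimately show "x \<in> V - low" by (auto simp: low_def)
qed

context
  assumes two: "2 \<le> card V"
begin

lemma deg_ge4: "x \<in> V \<Longrightarrow> 4 \<le> deg x"
proof -
  assume "x \<in> V"
  moreover have "V \<noteq> {x}" using two by auto
  ultimately have "{x} \<subset> V" by blast
  then show ?thesis by (intro four) auto
qed

context
  fixes c :: "'v \<Rightarrow> nat"
begin

text \<open>
A low vertex whose neighbours all have colour \<open>i\<close> is placed into the part of colour \<open>i\<close>; the
other low vertices are those whose hyperedge crosses, and they lie in no part.
\<close>

definition part where "part i = {x \<in> V - low. c x = i} \<union> {v \<in> low. neighbours E s t v \<subseteq> {x \<in> V - low. c x = i}}"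
text \<open>
Small parts consist of pairwise nonadjacent vertices of degree at most 19. No two of them are
adjacent, and they have no low neighbours. They need a larger share of the edges that leave them.
\<close>

definition small where "small i \<longleftrightarrow> cut E s t (part i) \<le> 19 \<and> (\<forall>e\<in>E. \<not> (s e \<in> part i \<and> t e \<in> part i))"
definition weight :: "nat \<Rightarrow> int" where "weight i = (if small i then 10 else 3)"

lemma part_subset: "part i \<subseteq> V"
  by (auto simp: part_def low_def)

lemma part_high: "x \<in> V - low \<Longrightarrow> x \<in> part i \<longleftrightarrow> c x = i"
  by (auto simp: part_def)

lemma part_low:
  "v \<in> low \<Longrightarrow> v \<in> part i \<longleftrightarrow> neighbours E s t v \<subseteq> {x \<in> V - low. c x = i}"
  by (auto simp: part_def)

lemma low_has_neighbour:
  assumes "v \<in> low"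
  shows "neighbours E s t v \<noteq> {}"
proof -
  have "4 \<le> deg v" using assms deg_ge4 by (auto simp: low_def)
  then have "incident E s t v \<noteq> {}" unfolding deg_incident by auto
  then show ?thesis unfolding incident_def neighbours_def joins_def by auto
qed

lemma part_disjoint: "i \<noteq> j \<Longrightarrow> x \<in> part i \<Longrightarrow> x \<notin> part j"
  using low_has_neighbour[of x] unfolding part_def by blast

lemma small_deg:
  assumes "small i" "x \<in> part i"
  shows "deg x \<le> 19"
proof -
  have "deg x \<le> cut E s t (part i)"
    unfolding cut_def using assms loopless by (intro sum_mono) (auto simp: small_def)
  then show ?thesis using assms(1) unfolding small_def by linarith
qed

lemma weight_part:
  assumes "x \<in> V - low"
    and "small (c x) \<or> 20 \<le> cut E s t (part (c x))"
  shows "60 \<le> weight (c x) * cut E s t (part (c x))"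
proof (cases "small (c x)")
  case True
  have "deg x \<le> cut E s t (part (c x))"
    unfolding cut_def using True part_high[OF assms(1)] loopless by (intro sum_mono) (auto simp: small_def)
  moreover have "6 \<le> deg x" using assms(1) by (auto simp: low_def)
  ultimately show ?thesis using True by (simp add: weight_def)
next
  case False
  then show ?thesis using assms(2) by (simp add: weight_def)
qed

text \<open>
A part that is neither small nor has a cut of at least 20 edges contains an edge, and two such parts
would be separated by an essential cut that is too small.
\<close>

lemma exceptional_part_unique:
  assumes "\<not> small i" "\<not> 20 \<le> cut E s t (part i)" "\<not> small j" "\<not> 20 \<le> cut E s t (part j)"
  shows "i = j"
proof (rule ccontr)
  assume ij: "i \<noteq> j"
  obtain e where e: "e \<in> E" "s e \<in> part i" "t e \<in> part i" using assms(1,2) by (auto simp: small_def)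
  obtain f where f: "f \<in> E" "s f \<in> part j" "t f \<in> part j" using assms(3,4) by (auto simp: small_def)
  have "41 \<le> cut E s t (part i)"
    by (rule essential[OF part_subset e(1) f(1) e(2,3)]) (use part_disjoint ij f in blast)+
  then show False using assms(2) by simp
qed

text \<open>
The account of an edge is 15 if it crosses the partition away from the low vertices, and 3 if it lies at a low
vertex whose hyperedge crosses; such a hyperedge has at most 5 edges and so is also worth 15 in total.
\<close>

definition charge :: "'e \<Rightarrow> int" where
  "charge e = 15 * of_bool (s e \<in> V - low \<and> t e \<in> V - low \<and> c (s e) \<noteq> c (t e))
     + 3 * (\<Sum>v\<in>low. of_bool (s e = v \<or> t e = v) * of_bool (crosses c (neighbours E s t v)))"

lemma finite_low: "finite low" using fin by (simp add: low_def)

lemma charge_low: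
  assumes "v \<in> low" "s e = v \<or> t e = v"
  shows "3 * of_bool (crosses c (neighbours E s t v)) \<le> charge e"
proof -
  have "of_bool (s e = v \<or> t e = v) * of_bool (crosses c (neighbours E s t v))
      \<le> (\<Sum>v\<in>low. of_bool (s e = v \<or> t e = v) * of_bool (crosses c (neighbours E s t v)) :: int)"
    using finite_low assms(1) by (intro member_le_sum) auto
  moreover have "of_bool (s e = v \<or> t e = v) = (1::int)" using assms(2) by simp
  ultimately have "of_bool (crosses c (neighbours E s t v))
      \<le> (\<Sum>v\<in>low. of_bool (s e = v \<or> t e = v) * of_bool (crosses c (neighbours E s t v)) :: int)"
    by (simp only: mult_1)
  moreover have "0 \<le> (of_bool (s e \<in> V - low \<and> t e \<in> V - low \<and> c (s e) \<noteq> c (t e)) :: int)" by simp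
  ultimately show ?thesis unfolding charge_def by linarith
qed

lemma edge_charge_low:
  assumes e: "e \<in> E" "joins s t e v x" and v: "v \<in> low"
  shows "(\<Sum>i\<in>c ` (V - low). weight i * of_bool ((s e \<in> part i) \<noteq> (t e \<in> part i))) \<le> charge e"
proof -
  have x: "x \<in> V - low" and dx: "38 \<le> deg x" using low_neighbour[OF e v] by auto
  have xn: "x \<in> neighbours E s t v" using e unfolding neighbours_def by blast
  have nb: "neighbours E s t v \<subseteq> V - low" using low_neighbour(2)[OF _ _ v] unfolding neighbours_def by blast
  have st: "((s e \<in> A) \<noteq> (t e \<in> A)) = ((v \<in> A) \<noteq> (x \<in> A))" for A
    using e(2) unfolding joins_def by auto
  have K: "finite (c ` (V - low))" "c x \<in> c ` (V - low)" using fin x by auto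
  show ?thesis
  proof (cases "crosses c (neighbours E s t v)")
    case False
    have "((v \<in> part i) \<noteq> (x \<in> part i)) = False" for i
    proof -
      have same: "c y = c x" if "y \<in> neighbours E s t v" for y
        using False that xn unfolding crosses_def by blast
      have "neighbours E s t v \<subseteq> {x \<in> V - low. c x = i} \<longleftrightarrow> c x = i"
      proof
        assume "neighbours E s t v \<subseteq> {x \<in> V - low. c x = i}"
        then show "c x = i" using xn by blast
      next
        assume i: "c x = i"
        show "neighbours E s t v \<subseteq> {x \<in> V - low. c x = i}"
        proof
          fix y assume y: "y \<in> neighbours E s t v"
          then have "y \<in> V - low" using nb by blast
          moreover have "c y = i" using same[OF y] i by (rule trans)
          ultimately show "y \<in> {x \<in> V - low. c x = i}" by blast
        qed
      qed
      then show ?thesis using part_high[OF x, of i] part_low[OF v, of i] by simp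
    qed
    then have "(\<Sum>i\<in>c ` (V - low). weight i * of_bool ((s e \<in> part i) \<noteq> (t e \<in> part i))) = 0"
      unfolding st by (intro sum.neutral) simp
    also have "0 \<le> charge e" unfolding charge_def by (auto intro!: add_nonneg_nonneg sum_nonneg)
    finally show ?thesis .
  next
    case True
    have "((v \<in> part i) \<noteq> (x \<in> part i)) = (i = c x)" for i
    proof -
      have "v \<notin> part i" using True unfolding part_low[OF v] crosses_def by blast
      then show ?thesis using part_high[OF x, of i] by auto
    qed
    then have "(\<Sum>i\<in>c ` (V - low). weight i * of_bool ((s e \<in> part i) \<noteq> (t e \<in> part i)))
        = (\<Sum>i\<in>c ` (V - low). weight i * of_bool (i = c x))"
      unfolding st by simp
    also have "\<dots> = weight (c x)" by (rule sum_of_bool_eq[OF K])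
    also have "weight (c x) = 3"
    proof -
      have "\<not> small (c x)" using small_deg[of "c x" x] part_high[OF x, of "c x"] dx by auto
      then show ?thesis by (simp add: weight_def)
    qed
    also have "3 \<le> charge e"
      using charge_low[OF v, of e] e(2) True unfolding joins_def by auto
    finally show ?thesis .
  qed
qed

text \<open>
An edge leaves at most two parts. If neither end is low, at most one of the parts is small, and the weights
add up to at most 13.
\<close>

lemma edge_charge:
  assumes e: "e \<in> E"
  shows "(\<Sum>i\<in>c ` (V - low). weight i * of_bool ((s e \<in> part i) \<noteq> (t e \<in> part i))) \<le> charge e"
proof (cases "s e \<in> low \<or> t e \<in> low")
  case True
  then show ?thesis
  proof
    assume "s e \<in> low"
    then show ?thesis using edge_charge_low[OF e, of "s e" "t e"] by (simp add: joins_def)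
  next
    assume "t e \<in> low"
    then show ?thesis using edge_charge_low[OF e, of "t e" "s e"] by (simp add: joins_def)
  qed
next
  case False
  then have W: "s e \<in> V - low" "t e \<in> V - low" using ends e by auto
  have K: "finite (c ` (V - low))" "c (s e) \<in> c ` (V - low)" "c (t e) \<in> c ` (V - low)" using fin W by auto
  have ch: "15 * of_bool (c (s e) \<noteq> c (t e)) \<le> charge e"
    using W unfolding charge_def by (auto intro!: sum_nonneg)
  show ?thesis
  proof (cases "c (s e) = c (t e)")
    case True
    then have "(\<Sum>i\<in>c ` (V - low). weight i * of_bool ((s e \<in> part i) \<noteq> (t e \<in> part i))) = 0"
      using part_high[OF W(1)] part_high[OF W(2)] by (intro sum.neutral) simp
    then show ?thesis using ch True by simp
  next
    case ne: False
    have "((s e \<in> part i) \<noteq> (t e \<in> part i)) = (i = c (s e) \<or> i = c (t e))" for i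
      using part_high[OF W(1), of i] part_high[OF W(2), of i] ne by auto
    then have "(\<Sum>i\<in>c ` (V - low). weight i * of_bool ((s e \<in> part i) \<noteq> (t e \<in> part i)))
        = (\<Sum>i\<in>c ` (V - low). weight i * of_bool (i = c (s e)) + weight i * of_bool (i = c (t e)))"
      using ne by (intro sum.cong) auto
    also have "\<dots> = weight (c (s e)) + weight (c (t e))"
      unfolding sum.distrib using sum_of_bool_eq[OF K(1,2)] sum_of_bool_eq[OF K(1,3)] by simp
    also have "\<dots> \<le> 15"
    proof -
      have "\<not> (small (c (s e)) \<and> small (c (t e)))"
      proof
        assume sm: "small (c (s e)) \<and> small (c (t e))"
        have "deg (s e) \<le> 19" "deg (t e) \<le> 19"
          using small_deg sm part_high[OF W(1)] part_high[OF W(2)] by blast+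
        moreover have "43 \<le> deg (s e) + deg (t e)" by (rule adjacent_degrees[OF e]) (simp add: joins_def)
        ultimately show False by linarith
      qed
      then show ?thesis by (auto simp: weight_def)
    qed
    finally show ?thesis using ch ne by simp
  qed
qed

lemma total_charge:
  "(\<Sum>e\<in>E. charge e) \<le> 15 * (crossing_edges (V - low) E s t c + crossing_stars low E s t c)"
proof -
  have a: "(\<Sum>e\<in>E. 15 * of_bool (s e \<in> V - low \<and> t e \<in> V - low \<and> c (s e) \<noteq> c (t e)) :: int)
      = 15 * crossing_edges (V - low) E s t c"
  proof -
    have "(\<Sum>e\<in>E. of_bool (s e \<in> V - low \<and> t e \<in> V - low \<and> c (s e) \<noteq> c (t e)) :: int)
        = crossing_edges (V - low) E s t c"
      unfolding crossing_edges_def using fin(2) by (intro sum.mono_neutral_cong_right) auto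
    then show ?thesis by (simp only: sum_distrib_left[symmetric])
  qed
  have "(\<Sum>e\<in>E. 3 * (\<Sum>v\<in>low. of_bool (s e = v \<or> t e = v) * of_bool (crosses c (neighbours E s t v))) :: int)
      = 3 * (\<Sum>v\<in>low. \<Sum>e\<in>E. of_bool (s e = v \<or> t e = v) * of_bool (crosses c (neighbours E s t v)))"
    unfolding sum_distrib_left[symmetric] by (subst sum.swap) (rule refl)
  also have "\<dots> \<le> 3 * (\<Sum>v\<in>low. 5 * of_bool (crosses c (neighbours E s t v)))"
  proof (intro mult_left_mono sum_mono)
    fix v assume v: "v \<in> low"
    have "(\<Sum>e\<in>E. of_bool (s e = v \<or> t e = v) :: int) = deg v"
      unfolding cut_def using loopless by (intro sum.cong) auto
    then have "(\<Sum>e\<in>E. of_bool (s e = v \<or> t e = v) :: int) \<le> 5" using v by (simp add: low_def)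
    then show "(\<Sum>e\<in>E. of_bool (s e = v \<or> t e = v) * of_bool (crosses c (neighbours E s t v)))
        \<le> (5 * of_bool (crosses c (neighbours E s t v)) :: int)"
      unfolding sum_distrib_right[symmetric] by (intro mult_right_mono) auto
  qed auto
  also have "\<dots> = 15 * crossing_stars low E s t c"
    unfolding crossing_stars_def by (simp add: sum_distrib_left[symmetric])
  finally show ?thesis using a unfolding charge_def sum.distrib by simp
qed

text \<open>
Each part collects its weight for every edge that leaves it, at least 60 in total, with a single
possible exception; 6 edges suffice for a small part and 20 for another one. Each crossing edge or
hyperedge pays at most 15.
\<close>

lemma colouring_bound:
  "4 * (int (card (c ` (V - low))) - 1) \<le> crossing_edges (V - low) E s t c + crossing_stars low E s t c"
proof -
  let ?K = "c ` (V - low)"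
  let ?w = "\<lambda>i. weight i * cut E s t (part i)"
  have K: "finite ?K" using fin by simp
  have "(\<Sum>i\<in>?K. ?w i) = (\<Sum>e\<in>E. \<Sum>i\<in>?K. weight i * of_bool ((s e \<in> part i) \<noteq> (t e \<in> part i)))"
    unfolding cut_def sum_distrib_left by (rule sum.swap)
  also have "\<dots> \<le> (\<Sum>e\<in>E. charge e)" by (rule sum_mono) (rule edge_charge)
  also note total_charge
  finally have up: "(\<Sum>i\<in>?K. ?w i) \<le> 15 * (crossing_edges (V - low) E s t c + crossing_stars low E s t c)" .
  have nn: "0 \<le> ?w i" for i using cut_nonneg[of E s t "part i"] by (simp add: weight_def)
  have low60: "60 \<le> ?w i" if "i \<in> ?K" "small i \<or> 20 \<le> cut E s t (part i)" for i
    using weight_part that by blast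
  have "60 * (int (card ?K) - 1) \<le> (\<Sum>i\<in>?K. ?w i)"
  proof (cases "\<exists>i0\<in>?K. \<not> small i0 \<and> \<not> 20 \<le> cut E s t (part i0)")
    case True
    then obtain i0 where i0: "i0 \<in> ?K" "\<not> small i0" "\<not> 20 \<le> cut E s t (part i0)" by blast
    have ge: "60 \<le> ?w i" if "i \<in> ?K - {i0}" for i
      using low60[of i] exceptional_part_unique[OF i0(2,3), of i] that by blast
    have "60 * (int (card ?K) - 1) = (\<Sum>i\<in>?K - {i0}. 60)"
      using card_Suc_Diff1[OF K i0(1)] by simp
    also have "\<dots> \<le> (\<Sum>i\<in>?K - {i0}. ?w i)" by (rule sum_mono) (rule ge)
    also have "\<dots> \<le> (\<Sum>i\<in>?K. ?w i)" using sum.remove[OF K i0(1), of ?w] nn[of i0] by linarith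
    finally show ?thesis .
  next
    case False
    then have ge: "60 \<le> ?w i" if "i \<in> ?K" for i using low60 that by blast
    have "60 * (int (card ?K) - 1) \<le> (\<Sum>i\<in>?K. 60)" by simp
    also have "\<dots> \<le> (\<Sum>i\<in>?K. ?w i)" by (rule sum_mono) (rule ge)
    finally show ?thesis .
  qed
  then show ?thesis using up by simp
qed

end

lemma partition_connected_low: "partition_connected V low E s t"
  unfolding partition_connected_def
proof (intro conjI ballI allI impI)
  fix e assume e: "e \<in> E"
  show "s e \<in> V" "t e \<in> V" using ends e by auto
  show "t e \<in> V - low" if "s e \<in> low"
    by (rule low_neighbour(2)[OF e _ that]) (simp add: joins_def)
  show "s e \<in> V - low" if "t e \<in> low"
    by (rule low_neighbour(2)[OF e _ that]) (simp add: joins_def)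
next
  fix v assume "v \<in> low"
  then have "4 \<le> deg v" using deg_ge4 by (auto simp: low_def)
  then show "4 \<le> card (incident E s t v)" unfolding deg_incident by simp
next
  show "low \<subseteq> V" by (auto simp: low_def)
qed (rule fin(1), rule fin(2), rule colouring_bound)

end

end

theorem orientable_of_essentially_connected:
  fixes V :: "'v set" and E :: "'e set"
  assumes fin: "finite V" "finite E" and ends: "\<forall>e\<in>E. s e \<in> V \<and> t e \<in> V"
    and loopless: "\<forall>e\<in>E. s e \<noteq> t e"
    and four: "\<And>A. A \<noteq> {} \<Longrightarrow> A \<subset> V \<Longrightarrow> 4 \<le> cut E s t A"
    and essential: "\<And>A e f. A \<subseteq> V \<Longrightarrow> e \<in> E \<Longrightarrow> f \<in> E \<Longrightarrow> s e \<in> A \<Longrightarrow> t e \<in> A \<Longrightarrow>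
       s f \<notin> A \<Longrightarrow> t f \<notin> A \<Longrightarrow> 41 \<le> cut E s t A"
    and z: "3 dvd sum \<gamma> V"
  shows "orientable_mod3 V E s t \<gamma>"
proof (cases "\<exists>e\<in>E. \<forall>f\<in>E. s f \<in> {s e, t e} \<or> t f \<in> {s e, t e}")
  case True
  then obtain e where e: "e \<in> E" "\<And>f. f \<in> E \<Longrightarrow> s f \<in> {s e, t e} \<or> t f \<in> {s e, t e}" by blast
  have "s e \<in> V" "t e \<in> V" "s e \<noteq> t e" using ends loopless e(1) by auto
  from orientable_two_hubs[OF fin ends loopless four this e(2) z] show ?thesis .
next
  case False
  interpret essentially_connected V E s t
  proof
    show "\<exists>f\<in>E. s f \<notin> {s e, t e} \<and> t f \<notin> {s e, t e}" if "e \<in> E" for e using False that by blast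
  qed (fact fin ends loopless four essential)+
  show ?thesis
  proof (cases "2 \<le> card V")
    case True
    show ?thesis by (rule orientable_of_partition_connected[OF partition_connected_low[OF True] z])
  next
    case small: False
    show ?thesis
    proof (cases "V = {}")
      case True
      then show ?thesis by (intro orientable_mod3I[of "\<lambda>_. 1"]) auto
    next
      case ne: False
      then have "card V \<noteq> 0" using fin(1) by simp
      then have "card V = 1" using small by linarith
      then obtain u where u: "V = {u}" by (rule card_1_singletonE)
      show ?thesis
      proof (rule orientable_star[OF fin ends])
        show "u \<in> V" using u by simp
        show "2 \<le> card {e \<in> E. joins s t e w u}" if "w \<in> V - {u}" for w using that u by simp
      qed (rule z)
    qed
  qed
qed

section \<open>From residues to integral flows\<close>

lemma positive_net_edge:
  assumes "finite S" "finite E" "0 < (\<Sum>x\<in>S. net E s t \<phi> x)"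
  shows "\<exists>e\<in>E. (s e \<in> S \<and> t e \<notin> S \<and> 0 < \<phi> e) \<or> (t e \<in> S \<and> s e \<notin> S \<and> \<phi> e < 0)"
proof (rule ccontr)
  assume neg: "\<not> ?thesis"
  have "(\<Sum>x\<in>S. net E s t \<phi> x) \<le> (\<Sum>e\<in>E. 0)"
    unfolding sum_net[OF assms(1,2)]
  proof (rule sum_mono)
    fix e assume "e \<in> E"
    then have "\<not> (s e \<in> S \<and> t e \<notin> S \<and> 0 < \<phi> e)" "\<not> (t e \<in> S \<and> s e \<notin> S \<and> \<phi> e < 0)" using neg by auto
    then show "\<phi> e * (of_bool (s e \<in> S) - of_bool (t e \<in> S)) \<le> 0"
      by (cases "s e \<in> S"; cases "t e \<in> S") auto
  qed
  then show False using assms(3) by simp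
qed

lemma net_fun_upd:
  assumes "finite E" "e \<in> E"
  shows "net E s t (\<phi>(e := v)) z = net E s t \<phi> z + (v - \<phi> e) * (of_bool (s e = z) - of_bool (t e = z))"
proof -
  have "net (E - {e}) s t (\<phi>(e := v)) z = net (E - {e}) s t \<phi> z" by (rule net_cong) auto
  then show ?thesis
    using net_remove[OF assms, of s t \<phi> z] net_remove[OF assms, of s t "\<phi>(e := v)" z]
    by (simp add: algebra_simps)
qed

text \<open>
Values 1 and -2, with respect to the given orientation, are congruent modulo 3. Choose such values with
least total imbalance. If \<open>v\<close> has a positive imbalance, consider the sets \<open>S\<close> such that from \<open>v\<close> to each
vertex of \<open>S\<close> the imbalance 3 can be shifted by changing edges inside \<open>S\<close>. A largest such set
contains no vertex of negative imbalance, so the values leaving \<open>S\<close> are positive in total, and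
an edge that leaves \<open>S\<close> with positive value extends \<open>S\<close>.
\<close>

theorem integral_flow_of_mod3:
  fixes V :: "'v set" and E :: "'e set"
  assumes fin: "finite V" "finite E" and ends: "\<forall>e\<in>E. s e \<in> V \<and> t e \<in> V"
    and o: "orientable_mod3 V E s t (\<lambda>_. 0)"
  shows "\<exists>\<phi>. (\<forall>e. \<phi> e \<in> {1, 2, -1, -2 :: int}) \<and> (\<forall>x\<in>V. net E s t \<phi> x = 0)"
proof -
  obtain \<sigma> where sg: "\<forall>e. \<sigma> e \<in> {1,-1::int}" "\<forall>x\<in>V. 3 dvd net E s t \<sigma> x - 0"
    using o by (rule orientable_mod3E)
  define ok where "ok \<phi> \<longleftrightarrow> (\<forall>e. \<phi> e \<in> {\<sigma> e, -2 * \<sigma> e})" for \<phi> :: "'e \<Rightarrow> int"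
  define M where "M \<phi> = nat (\<Sum>x\<in>V. \<bar>net E s t \<phi> x\<bar>)" for \<phi>
  have "ok \<sigma>" by (simp add: ok_def)
  then obtain \<phi> where ph: "ok \<phi>" "\<And>\<psi>. ok \<psi> \<Longrightarrow> M \<phi> \<le> M \<psi>"
    using ex_has_least_nat[of ok \<sigma> M] by metis
  have dvd: "3 dvd net E s t \<psi> x" if "ok \<psi>" "x \<in> V" for \<psi> x
  proof -
    have "3 dvd \<psi> e - \<sigma> e" for e
    proof -
      have "\<psi> e = \<sigma> e \<or> \<psi> e = -2 * \<sigma> e" using that(1) by (simp add: ok_def)
      then show ?thesis by auto
    qed
    then have "3 dvd (\<Sum>e\<in>E. (\<psi> e - \<sigma> e) * (of_bool (s e = x) - of_bool (t e = x)))"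
      by (intro dvd_sum dvd_mult2)
    also have "(\<Sum>e\<in>E. (\<psi> e - \<sigma> e) * (of_bool (s e = x) - of_bool (t e = x)))
        = net E s t \<psi> x - net E s t \<sigma> x"
      unfolding net_def by (simp only: sum_subtractf[symmetric] left_diff_distrib)
    finally have "3 dvd net E s t \<psi> x - net E s t \<sigma> x" .
    moreover have "3 dvd net E s t \<sigma> x" using sg(2) that(2) by simp
    ultimately have "3 dvd (net E s t \<psi> x - net E s t \<sigma> x) + net E s t \<sigma> x" by (rule dvd_add)
    then show ?thesis by simp
  qed
  have tot: "(\<Sum>x\<in>V. net E s t \<phi> x) = 0" by (rule sum_net_zero[OF fin ends])
  have zero: "net E s t \<phi> x = 0" if x: "x \<in> V" for x
  proof (rule ccontr)
    assume nz: "net E s t \<phi> x \<noteq> 0"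
    have "\<exists>v\<in>V. 0 < net E s t \<phi> v"
    proof (rule ccontr)
      assume "\<not> ?thesis"
      then have np: "\<forall>z\<in>V. 0 \<le> - net E s t \<phi> z" by force
      moreover have "(\<Sum>z\<in>V. - net E s t \<phi> z) = 0" using tot by (simp add: sum_negf)
      ultimately have "\<forall>z\<in>V. - net E s t \<phi> z = 0"
        using sum_nonneg_eq_0_iff[OF fin(1), of "\<lambda>z. - net E s t \<phi> z"] by blast
      then show False using x nz by simp
    qed
    then obtain v where v: "v \<in> V" "0 < net E s t \<phi> v" by blast
    define shifts where "shifts S y \<psi> \<longleftrightarrow> ok \<psi> \<and> (\<forall>e. \<psi> e \<noteq> \<phi> e \<longrightarrow> s e \<in> S \<and> t e \<in> S) \<and>
      (\<forall>z. net E s t \<psi> z = net E s t \<phi> z - 3 * of_bool (z = v) + 3 * of_bool (z = y))" for S y \<psi>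
    define good where "good S \<longleftrightarrow> v \<in> S \<and> S \<subseteq> V \<and> (\<forall>y\<in>S. \<exists>\<psi>. shifts S y \<psi>)" for S
    have "shifts {v} v \<phi>" using ph(1) by (simp add: shifts_def)
    then have g0: "good {v}" using v(1) unfolding good_def by blast
    have "\<forall>S. good S \<longrightarrow> card S < Suc (card V)"
      unfolding good_def using card_mono[OF fin(1)] by (auto simp: less_Suc_eq_le)
    then have "\<exists>S. good S \<and> (\<forall>S'. good S' \<longrightarrow> card S' \<le> card S)"
      by (rule Lattices_Big.ex_has_greatest_nat[where P = good, OF g0])
    then obtain S where S: "good S" "\<And>S'. good S' \<Longrightarrow> card S' \<le> card S" by blast
    have SV: "S \<subseteq> V" and vS: "v \<in> S" using S(1) by (auto simp: good_def)
    have finS: "finite S" using SV fin(1) finite_subset by blast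
    have nonneg: "0 \<le> net E s t \<phi> y" if y: "y \<in> S" for y
    proof (rule ccontr)
      assume "\<not> ?thesis"
      then have ny: "net E s t \<phi> y < 0" by simp
      have yV: "y \<in> V" using y SV by blast
      have "y \<noteq> v" using ny v(2) by auto
      obtain \<psi> where p: "shifts S y \<psi>" using S(1) y unfolding good_def by blast
      then have okp: "ok \<psi>" by (simp add: shifts_def)
      have np: "net E s t \<psi> z = net E s t \<phi> z - 3 * of_bool (z = v) + 3 * of_bool (z = y)" for z
        using p by (simp add: shifts_def)
      have "3 dvd net E s t \<phi> v" "3 dvd net E s t \<phi> y" using dvd[OF ph(1)] v(1) yV by auto
      then have big: "3 \<le> net E s t \<phi> v" "net E s t \<phi> y \<le> -3" using v(2) ny by presburger+
      have "(\<Sum>z\<in>V. \<bar>net E s t \<psi> z\<bar>) < (\<Sum>z\<in>V. \<bar>net E s t \<phi> z\<bar>)"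
      proof (rule sum_strict_mono_ex1[OF fin(1)])
        show "\<forall>z\<in>V. \<bar>net E s t \<psi> z\<bar> \<le> \<bar>net E s t \<phi> z\<bar>" using np big \<open>y \<noteq> v\<close> by auto
        show "\<exists>z\<in>V. \<bar>net E s t \<psi> z\<bar> < \<bar>net E s t \<phi> z\<bar>"
          using np[of v] big(1) \<open>y \<noteq> v\<close> v(1) by (intro bexI[of _ v]) auto
      qed
      moreover have "0 \<le> (\<Sum>z\<in>V. \<bar>net E s t \<psi> z\<bar>)" by (rule sum_nonneg) simp
      ultimately have "M \<psi> < M \<phi>" unfolding M_def by (subst nat_mono_iff) linarith+
      then show False using ph(2)[OF okp] by simp
    qed
    have "0 < (\<Sum>y\<in>S. net E s t \<phi> y)" by (rule sum_pos2[OF finS vS, where f = "net E s t \<phi>"]) (use v(2) nonneg in auto)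
    from positive_net_edge[OF finS fin(2) this] obtain e where e: "e \<in> E"
      "(s e \<in> S \<and> t e \<notin> S \<and> 0 < \<phi> e) \<or> (t e \<in> S \<and> s e \<notin> S \<and> \<phi> e < 0)" by blast
    \<comment> \<open>on \<open>e\<close>, the amount 3 is to be moved from \<open>a\<close> in \<open>S\<close> to \<open>b\<close> outside \<open>S\<close>; \<open>d\<close> is the sign of that direction\<close>
    define d :: int where "d = (if 0 < \<phi> e then 1 else -1)"
    obtain a b where ab: "a \<in> S" "b \<notin> S" "b \<in> V" "a = (if 0 < \<phi> e then s e else t e)" "b = (if 0 < \<phi> e then t e else s e)"
      using e ends by auto
    have ab': "of_bool (s e = z) - of_bool (t e = z) = d * (of_bool (z = a) - of_bool (z = b))" for z
      unfolding d_def ab(4,5) by (auto simp: of_bool_def)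
    have ne: "a \<noteq> b" using ab by blast
    obtain \<psi> where p: "shifts S a \<psi>" using S(1) ab(1) unfolding good_def by blast
    have same: "\<psi> e = \<phi> e"
    proof (rule ccontr)
      assume "\<psi> e \<noteq> \<phi> e"
      then have "s e \<in> S" "t e \<in> S" using p unfolding shifts_def by auto
      then show False using e(2) by blast
    qed
    let ?\<psi> = "\<psi>(e := \<phi> e - 3 * d)"
    have okp: "ok ?\<psi>"
      unfolding ok_def
    proof
      fix g
      have "\<sigma> e \<in> {1,-1}" "\<phi> e = \<sigma> e \<or> \<phi> e = -2 * \<sigma> e" using sg(1) ph(1) unfolding ok_def by auto
      then have "\<phi> e - 3 * d \<in> {\<sigma> e, -2 * \<sigma> e}" unfolding d_def by auto
      moreover have "\<psi> g \<in> {\<sigma> g, -2 * \<sigma> g}" using p unfolding shifts_def ok_def by blast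
      ultimately show "?\<psi> g \<in> {\<sigma> g, -2 * \<sigma> g}" by (cases "g = e") simp_all
    qed
    have np: "net E s t ?\<psi> z = net E s t \<phi> z - 3 * of_bool (z = v) + 3 * of_bool (z = b)" for z
    proof -
      have "net E s t ?\<psi> z = net E s t \<psi> z + (- 3 * d) * (d * (of_bool (z = a) - of_bool (z = b)))"
        unfolding net_fun_upd[OF fin(2) e(1)] ab' same by simp
      also have "(- 3 * d) * (d * (of_bool (z = a) - of_bool (z = b))) = - 3 * of_bool (z = a) + 3 * of_bool (z = b)"
        unfolding d_def by auto
      also have "net E s t \<psi> z = net E s t \<phi> z - 3 * of_bool (z = v) + 3 * of_bool (z = a)"
        using p unfolding shifts_def by blast
      finally show ?thesis by linarith
    qed
    have "shifts (insert b S) y \<chi>" if "shifts S y \<chi>" for y \<chi> using that unfolding shifts_def by blast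
    moreover have "shifts (insert b S) b ?\<psi>"
      unfolding shifts_def
    proof (intro conjI allI impI)
      show "ok ?\<psi>" by (rule okp)
      fix g assume g: "?\<psi> g \<noteq> \<phi> g"
      have "s g \<in> insert b S \<and> t g \<in> insert b S"
      proof (cases "g = e")
        case True
        then show ?thesis using ab by (auto split: if_splits)
      next
        case False
        then show ?thesis using g p unfolding shifts_def by auto
      qed
      then show "s g \<in> insert b S" "t g \<in> insert b S" by blast+
    next
      fix z show "net E s t ?\<psi> z = net E s t \<phi> z - 3 * of_bool (z = v) + 3 * of_bool (z = b)" by (rule np)
    qed
    ultimately have "good (insert b S)" using S(1) ab(3) unfolding good_def by blast
    then have "card (insert b S) \<le> card S" by (rule S(2))
    then show False using ab(2) finS by simp
  qed
  have "\<phi> e \<in> {1,2,-1,-2}" for e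
  proof -
    have "\<sigma> e \<in> {1,-1}" "\<phi> e = \<sigma> e \<or> \<phi> e = -2 * \<sigma> e" using sg(1) ph(1) unfolding ok_def by auto
    then show ?thesis by auto
  qed
  then show ?thesis using zero by blast
qed


section \<open>Bonds of multigraphs and the 3-flow\<close>

lemma (in finite_multigraph) endpoint_functions:
  obtains s t where "\<forall>e\<in>medges G. ends G e = {s e, t e} \<and> s e \<noteq> t e \<and> s e \<in> mverts G \<and> t e \<in> mverts G"
proof -
  have "\<exists>p. ends G e = {fst p, snd p} \<and> fst p \<noteq> snd p" if "e \<in> medges G" for e
    using loopless[OF that] by (auto simp: card_2_iff)
  then obtain p where p: "\<And>e. e \<in> medges G \<Longrightarrow> ends G e = {fst (p e), snd (p e)} \<and> fst (p e) \<noteq> snd (p e)"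
    by metis
  then have "\<forall>e\<in>medges G. ends G e = {(fst \<circ> p) e, (snd \<circ> p) e} \<and> (fst \<circ> p) e \<noteq> (snd \<circ> p) e
      \<and> (fst \<circ> p) e \<in> mverts G \<and> (snd \<circ> p) e \<in> mverts G"
    using ends_in_verts by fastforce
  then show thesis by (rule that)
qed

locale multigraph_with_ends =
  fixes G :: "('v, 'e) multigraph" and s t :: "'e \<Rightarrow> 'v"
  assumes fin: "finite (mverts G)" "finite (medges G)"
    and ends: "\<forall>e\<in>medges G. ends G e = {s e, t e} \<and> s e \<noteq> t e \<and> s e \<in> mverts G \<and> t e \<in> mverts G"
begin

abbreviation V where "V \<equiv> mverts G"
abbreviation E where "E \<equiv> medges G"

definition boundary where "boundary A = {e \<in> E. (s e \<in> A) \<noteq> (t e \<in> A)}"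

lemma delete_simps: "mverts (delete_edges G F) = V" "medges (delete_edges G F) = E - F"
  by (simp_all add: delete_edges_def)

lemma adjacency_delete: "(a, b) \<in> adjacency (delete_edges G F) \<longleftrightarrow> (\<exists>e\<in>E - F. joins s t e a b)"
  unfolding adjacency_def delete_edges_def joins_def using ends by (auto simp: doubleton_eq_iff)

text \<open>
A path that avoids \<open>F\<close> cannot leave a set whose boundary is contained in \<open>F\<close>.
\<close>

lemma reachable_closed:
  assumes "(a, b) \<in> (adjacency (delete_edges G F))\<^sup>*" "a \<in> A" "boundary A \<subseteq> F"
  shows "b \<in> A"
  using assms(1,2)
proof (induction rule: rtrancl_induct)
  case (step y z)
  then obtain e where e: "e \<in> E - F" "joins s t e y z" using adjacency_delete by blast
  have "e \<notin> boundary A" using e(1) assms(3) by blast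
  then show ?case using e step unfolding boundary_def joins_def by auto
qed

lemma connected_boundary:
  assumes "connected_multigraph (delete_edges G F)" "A \<noteq> {}" "A \<subset> V"
  shows "\<not> boundary A \<subseteq> F"
proof
  assume sub: "boundary A \<subseteq> F"
  let ?R = "(adjacency (delete_edges G F))\<^sup>*"
  obtain x y where xy: "x \<in> A" "x \<in> V" "y \<in> V" "y \<notin> A" using assms(2,3) by blast
  obtain C where "components (delete_edges G F) = {C}"
    using assms(1) unfolding connected_multigraph_def by (rule card_1_singletonE)
  then have img: "(\<lambda>v. ?R `` {v}) ` V = {C}" unfolding components_def delete_simps .
  have "?R `` {x} = C" "?R `` {y} = C" using imageI[OF xy(2)] imageI[OF xy(3)] img by (metis singletonD)+
  then have "y \<in> ?R `` {x}" by (metis Image_singleton_iff rtrancl.rtrancl_refl)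
  then have "(x, y) \<in> ?R" by (rule Image_singleton_iff[THEN iffD1])
  then show False using reachable_closed[OF _ xy(1) sub] xy(4) by blast
qed

lemma connected_of_boundaries:
  assumes ne: "V \<noteq> {}" and b: "\<And>A. A \<noteq> {} \<Longrightarrow> A \<subset> V \<Longrightarrow> \<not> boundary A \<subseteq> F"
  shows "connected_multigraph (delete_edges G F)"
proof -
  let ?R = "(adjacency (delete_edges G F))\<^sup>*"
  have "?R `` {x} = V" if x: "x \<in> V" for x
  proof -
    have "?R `` {x} \<subseteq> V"
    proof
      fix y assume y: "y \<in> ?R `` {x}"
      have "boundary V \<subseteq> F" using ends by (auto simp: boundary_def)
      then show "y \<in> V" using reachable_closed[of x y F V] y x by blast
    qed
    moreover have "boundary (?R `` {x}) \<subseteq> F"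
    proof
      fix e assume e: "e \<in> boundary (?R `` {x})"
      show "e \<in> F"
      proof (rule ccontr)
        assume "e \<notin> F"
        then have "(s e, t e) \<in> adjacency (delete_edges G F)" "(t e, s e) \<in> adjacency (delete_edges G F)"
          using e unfolding adjacency_delete boundary_def joins_def by blast+
        then have "(x, s e) \<in> ?R \<longleftrightarrow> (x, t e) \<in> ?R" by (meson rtrancl.rtrancl_into_rtrancl)
        then show False using e unfolding boundary_def by blast
      qed
    qed
    moreover have "?R `` {x} \<noteq> {}" by blast
    ultimately show ?thesis using b[of "?R `` {x}"] by blast
  qed
  then have "components (delete_edges G F) = {V}"
    using ne unfolding components_def delete_simps by auto
  then show ?thesis unfolding connected_multigraph_def by simp
qed

lemma delete_none: "delete_edges G {} = G"
  by (simp add: delete_edges_def)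

lemma finite_components: "finite (components (delete_edges G F))"
  unfolding components_def delete_simps using fin by simp

lemma boundary_symmetric_difference:
  assumes "boundary B \<subseteq> boundary X"
  shows "boundary ((X - B) \<union> (B - X)) = boundary X - boundary B"
proof -
  have "(z \<in> (X - B) \<union> (B - X)) = ((z \<in> X) \<noteq> (z \<in> B))" for z by blast
  then have "boundary ((X - B) \<union> (B - X))
      = {e \<in> E. ((s e \<in> X) \<noteq> (t e \<in> X)) \<noteq> ((s e \<in> B) \<noteq> (t e \<in> B))}"
    unfolding boundary_def by (simp only:) blast
  also have "\<dots> = boundary X - boundary B" using assms unfolding boundary_def by blast
  finally show ?thesis .
qed

lemma boundary_compl: "boundary (V - B) = boundary B"
  unfolding boundary_def using ends by blast

text \<open>
Among the sets that separate \<open>e\<close> from \<open>f\<close>, take \<open>X\<close> with smallest boundary. If a proper subset of this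
boundary were the boundary of some \<open>B\<close>, then one of \<open>B\<close>, its complement, and the symmetric differences of
\<open>X\<close> with these two would separate \<open>e\<close> from \<open>f\<close> and have a smaller boundary. Hence the boundary of \<open>X\<close> is a bond.
\<close>

lemma essential_cut_between:
  assumes con: "connected_multigraph G"
    and A: "A \<subseteq> V" and e: "e \<in> E" "s e \<in> A" "t e \<in> A" and f: "f \<in> E" "s f \<notin> A" "t f \<notin> A"
  shows "\<exists>F. essential_edge_cut G F \<and> card F \<le> card (boundary A)"
proof -
  define sep where "sep X \<longleftrightarrow> X \<subseteq> V \<and> s e \<in> X \<and> t e \<in> X \<and> s f \<notin> X \<and> t f \<notin> X" for X
  have sA: "sep A" using A e f by (simp add: sep_def)
  obtain X where X: "sep X" "\<And>Y. sep Y \<Longrightarrow> card (boundary X) \<le> card (boundary Y)"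
    using ex_has_least_nat[of sep A "\<lambda>X. card (boundary X)"] sA by metis
  let ?F = "boundary X"
  have Xd: "X \<subseteq> V" "s e \<in> X" "t e \<in> X" "s f \<notin> X" "t f \<notin> X" using X(1) by (simp_all add: sep_def)
  have fV: "s f \<in> V" "t f \<in> V" using f ends by auto
  have FE: "?F \<subseteq> E" by (auto simp: boundary_def)
  have finF: "finite ?F" using FE fin finite_subset by blast
  have Vne: "V \<noteq> {}" using fV by blast
  have one: "card (components G) = 1" using con by (simp add: connected_multigraph_def)
  have Xp: "X \<noteq> {}" "X \<subset> V" using Xd fV by auto
  have sep_F: "separating G ?F"
  proof -
    have "card (components (delete_edges G ?F)) \<noteq> 1"
      using connected_boundary[OF _ Xp, of ?F] unfolding connected_multigraph_def by blast
    moreover have "components (delete_edges G ?F) \<noteq> {}"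
      unfolding components_def delete_simps using Vne by blast
    then have "card (components (delete_edges G ?F)) \<noteq> 0" using finite_components by simp
    ultimately show ?thesis unfolding separating_def using one FE by simp
  qed
  have min: "\<not> separating G F'" if F': "F' \<subset> ?F" for F'
  proof -
    have "connected_multigraph (delete_edges G F')"
    proof (rule connected_of_boundaries[OF Vne])
      fix B assume B: "B \<noteq> {}" "B \<subset> V"
      show "\<not> boundary B \<subseteq> F'"
      proof
        assume bF: "boundary B \<subseteq> F'"
        have smaller: "card Y < card ?F" if "Y \<subset> ?F" for Y using psubset_card_mono[OF finF that] .
        have bne: "boundary B \<noteq> {}" using connected_boundary[of "{}" B] B con delete_none by auto
        have bX: "boundary B \<subset> ?F" using bF F' by blast
        have "e \<notin> ?F" "f \<notin> ?F" using Xd by (auto simp: boundary_def)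
        then have "e \<notin> boundary B" "f \<notin> boundary B" using bX by blast+
        then have same: "(s e \<in> B) = (t e \<in> B)" "(s f \<in> B) = (t f \<in> B)"
          using e(1) f(1) by (auto simp: boundary_def)
        have BV: "B \<subseteq> V" using B by blast
        \<comment> \<open>a set that again separates the two edges, according to the side of \<open>B\<close> on which each of them lies\<close>
        define Y where "Y = (if s e \<in> B then (if s f \<in> B then (X - (V - B)) \<union> ((V - B) - X) else B)
           else (if s f \<in> B then V - B else (X - B) \<union> (B - X)))"
        have "sep Y"
          unfolding sep_def Y_def using Xd same BV fV by auto
        moreover have "boundary Y \<subset> ?F"
        proof -
          have sd: "boundary ((X - C) \<union> (C - X)) \<subset> ?F" if "boundary C = boundary B" for C
            using boundary_symmetric_difference[of C X] that bX bne by blast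
          show ?thesis unfolding Y_def using sd[of B] sd[of "V - B"] boundary_compl[of B] bX by simp
        qed
        then have "card (boundary Y) < card ?F" by (rule smaller)
        ultimately show False using X(2)[of Y] by simp
      qed
    qed
    then show ?thesis unfolding separating_def connected_multigraph_def using one by simp
  qed
  let ?R = "(adjacency (delete_edges G ?F))\<^sup>*"
  have comp: "?R `` {s g} \<in> nontrivial_components (delete_edges G ?F)" if g: "g \<in> E" "g \<notin> ?F" for g
  proof -
    have "(s g, t g) \<in> adjacency (delete_edges G ?F)"
      unfolding adjacency_delete joins_def using g by blast
    then have "Defs.ends (delete_edges G ?F) g \<subseteq> ?R `` {s g}"
      using ends g(1) by (auto simp: delete_edges_def)
    moreover have "?R `` {s g} \<in> components (delete_edges G ?F)"
      unfolding components_def delete_simps using ends g(1) by blast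
    ultimately show ?thesis unfolding nontrivial_components_def delete_simps using g by blast
  qed
  have "e \<notin> ?F" "f \<notin> ?F" using Xd by (auto simp: boundary_def)
  then have c: "{?R `` {s e}, ?R `` {s f}} \<subseteq> nontrivial_components (delete_edges G ?F)"
    using comp e(1) f(1) by blast
  have "s f \<notin> ?R `` {s e}" using reachable_closed[of "s e" "s f" ?F X] Xd by blast
  then have "?R `` {s e} \<noteq> ?R `` {s f}" by blast
  then have "card {?R `` {s e}, ?R `` {s f}} = 2" by simp
  moreover have "finite (nontrivial_components (delete_edges G ?F))"
    unfolding nontrivial_components_def using finite_components by simp
  ultimately have "2 \<le> card (nontrivial_components (delete_edges G ?F))" using card_mono[OF _ c] by simp
  then have "essential_edge_cut G ?F"
    unfolding essential_edge_cut_def edge_cut_def using sep_F min by blast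
  then show ?thesis using X(2)[OF sA] by blast
qed

lemma cut_boundary: "cut E s t A = int (card (boundary A))"
  unfolding boundary_def by (rule cut_eq_card[OF fin(2)])

lemma nowhere_zero_3_flow_of_net:
  assumes val: "\<forall>e. \<phi> e \<in> {1, 2, -1, -2 :: int}" and net: "\<forall>x\<in>V. net E s t \<phi> x = 0"
  shows "\<exists>D f. nowhere_zero_flow 3 G D f"
proof -
  define D where "D = \<lparr>verts = V, arcs = E, tail = (\<lambda>e. if 0 < \<phi> e then s e else t e),
    head = (\<lambda>e. if 0 < \<phi> e then t e else s e)\<rparr>"
  define f where "f e = nat \<bar>\<phi> e\<bar>" for e
  have "orientation_of G D"
    unfolding orientation_of_def D_def using ends by (auto simp: insert_commute)
  moreover have "f e \<in> {1..3 - 1}" for e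
  proof -
    have "\<phi> e \<in> {1,2,-1,-2}" using val by blast
    then show ?thesis by (auto simp: f_def)
  qed
  moreover have "(\<Sum>e\<in>out_arcs D x. f e) = (\<Sum>e\<in>in_arcs D x. f e)" if x: "x \<in> V" for x
  proof -
    have "int (\<Sum>e\<in>out_arcs D x. f e) = (\<Sum>e\<in>E. int (f e) * of_bool (tail D e = x))"
      unfolding out_arcs_def int_sum using fin(2) by (intro sum.mono_neutral_cong_left) (auto simp: D_def)
    moreover have "int (\<Sum>e\<in>in_arcs D x. f e) = (\<Sum>e\<in>E. int (f e) * of_bool (head D e = x))"
      unfolding in_arcs_def int_sum using fin(2) by (intro sum.mono_neutral_cong_left) (auto simp: D_def)
    moreover have "(\<Sum>e\<in>E. int (f e) * of_bool (tail D e = x)) - (\<Sum>e\<in>E. int (f e) * of_bool (head D e = x))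
        = net E s t \<phi> x"
      unfolding net_def sum_subtractf[symmetric]
      by (intro sum.cong) (auto simp: D_def f_def)
    moreover have "net E s t \<phi> x = 0" using net x by blast
    ultimately have "int (\<Sum>e\<in>out_arcs D x. f e) = int (\<Sum>e\<in>in_arcs D x. f e)" by linarith
    then show ?thesis by (simp only: of_nat_eq_iff)
  qed
  ultimately show ?thesis unfolding nowhere_zero_flow_def by blast
qed

end

theorem theorem1p4:
  fixes G :: "('v, 'e) multigraph"
  assumes "finite_multigraph G"
    and "k_edge_connected 4 G"
    and "essentially_edge_connected 41 G"
  shows "\<exists>D f. nowhere_zero_flow 3 G D f"
proof -
  interpret finite_multigraph G by (rule assms(1))
  obtain s t where st: "\<forall>e\<in>medges G. ends G e = {s e, t e} \<and> s e \<noteq> t e \<and> s e \<in> mverts G \<and> t e \<in> mverts G"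
    by (rule endpoint_functions)
  interpret multigraph_with_ends G s t
    by unfold_locales (fact finite_verts finite_edges st)+
  have con: "connected_multigraph G" using assms(2) by (simp add: k_edge_connected_def)
  have "orientable_mod3 V E s t (\<lambda>_. 0)"
  proof (rule orientable_of_essentially_connected)
    show "finite V" "finite E" using fin by auto
    show "\<forall>e\<in>E. s e \<in> V \<and> t e \<in> V" "\<forall>e\<in>E. s e \<noteq> t e" using st by blast+
    fix A assume A: "A \<noteq> {}" "A \<subset> V"
    have bE: "boundary A \<subseteq> E" by (auto simp: boundary_def)
    have "\<not> card (boundary A) < 4"
    proof
      assume "card (boundary A) < 4"
      then have "connected_multigraph (delete_edges G (boundary A))"
        using assms(2) bE unfolding k_edge_connected_def by blast
      then show False using connected_boundary[OF _ A] by blast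
    qed
    then show "4 \<le> cut E s t A" unfolding cut_boundary by simp
  next
    fix A e f assume a: "A \<subseteq> V" "e \<in> E" "f \<in> E" "s e \<in> A" "t e \<in> A" "s f \<notin> A" "t f \<notin> A"
    obtain F where F: "essential_edge_cut G F" "card F \<le> card (boundary A)"
      using essential_cut_between[OF con a(1,2,4,5,3,6,7)] by blast
    have "\<not> card F < 41" using assms(3) F(1) unfolding essentially_edge_connected_def by blast
    then show "41 \<le> cut E s t A" using F(2) unfolding cut_boundary by simp
  next
    show "3 dvd sum (\<lambda>_. 0 :: int) V" by simp
  qed
  from integral_flow_of_mod3[OF fin _ this] st
  obtain \<phi> where "\<forall>e. \<phi> e \<in> {1, 2, -1, -2 :: int}" "\<forall>x\<in>V. net E s t \<phi> x = 0" by blast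
  then show ?thesis by (rule nowhere_zero_3_flow_of_net)
qed

end
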